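(* Let $\Sigma\in\mathbb{R}^{d\times d}$ be positive definite and let $X_t=\sqrt{\Sigma}\,B_t$, $t\in[0,1]$, be the Brownian motion with covariance $\Sigma$, where $B_t$ is a standard $d$-dimensional Brownian motion. Then $$\mathbf{E}\big(\log \mathsf{IIS}(X)\big)=0,$$ and consequently the barycenter of (the law of) the signature of $X$ is the identity: $\mathbf{m}_{\mathsf{IIS}(X)}=\mathsf{e}$.
   Context: $\mathsf{IIS}(X)=\sum_w c_w\,w$ is the iterated-integrals signature of $X$ over $[0,1]$: the formal series over words $w=w_1\cdots w_k$ in the letters $1,\dots,d$ with coefficients $c_w=\int_{0\le t_1\le\cdots\le t_k\le1}\mathrm dX^{(w_1)}_{t_1}\cdots\mathrm dX^{(w_k)}_{t_k}$ (Stratonovich integrals). It is grouplike: for each $L$ its truncation $\mathsf{IIS}_{\le L}(X)$ to words of length $\le L$ takes values in $\mathcal{G}_{\le L}(\mathbb{R}^d)=\exp(\mathfrak{g}_{\le L}(\mathbb{R}^d))$, where $\mathfrak{g}_{\le L}(\mathbb{R}^d)$ is the smallest sub-Lie algebra containing the letters of the truncated tensor algebra $T_{\le L}(\mathbb{R}^d)$ (words of length $\le L$, concatenation product with words longer than $L$ set to $0$, unit the empty word $\mathsf{e}$, commutator bracket). Here $\log(\mathbf{g})=\sum_{k\ge1}\frac{(-1)^{k+1}}{k}(\mathbf{g}-\mathsf{e})^k$, and expectations are taken coefficientwise. A barycenter (group mean) of a probability measure $\nu$ on $\mathcal{G}_{\le L}(\mathbb{R}^d)$ is an element $\mathbf{m}_\nu\in\mathcal{G}_{\le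 L}(\mathbb{R}^d)$ with $\int\log(\mathbf{m}_\nu^{-1}\mathbf{x})\,\nu(\mathrm d\mathbf{x})=0$; it exists and is unique when $\nu$ is integrable as a measure on the linear space $T_{\le L}(\mathbb{R}^d)$. The statements are understood at every truncation level $L$ (hence projectively for the untruncated signature). *)

theory Defs
  imports "HOL-Probability.Probability" "HOL-Algebra.Group"
begin

section \<open>The truncated tensor algebra and its free nilpotent group\<close>

type_synonym 'd series = "'d list \<Rightarrow> real"

definition trunc :: "nat \<Rightarrow> 'd series \<Rightarrow> 'd series" where
  "trunc L x = (\<lambda>w. if length w \<le> L then x w else 0)"

definition concat_prod :: "'d series \<Rightarrow> 'd series \<Rightarrow> 'd series" where
  "concat_prod x y = (\<lambda>w. \<Sum>i\<le>length w. x (take i w) * y (drop i w))"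

definition tensor_alg :: "nat \<Rightarrow> 'd series monoid" where
  "tensor_alg L =
     \<lparr>carrier = {x. \<forall>w. L < length w \<longrightarrow> x w = 0},
      mult = (\<lambda>x y. trunc L (concat_prod x y)),
      one = (\<lambda>w. if w = [] then 1 else 0)\<rparr>"

lemma tensor_alg_monoid: "monoid (tensor_alg L)"
proof
  fix x y z :: "'a series"
  assume "x \<in> carrier (tensor_alg L)" "y \<in> carrier (tensor_alg L)" "z \<in> carrier (tensor_alg L)"
  show "x \<otimes>\<^bsub>tensor_alg L\<^esub> y \<otimes>\<^bsub>tensor_alg L\<^esub> z = x \<otimes>\<^bsub>tensor_alg L\<^esub> (y \<otimes>\<^bsub>tensor_alg L\<^esub> z)"
  proof
    fix w :: "'a list"
    let ?n = "length w"
    define f where "f i j = x (take i w) * y (take j (drop i w)) * z (drop (i + j) w)" for i j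
    have l: "(\<Sum>k\<le>?n. (\<Sum>i\<le>length (take k w). x (take i (take k w)) * y (drop i (take k w))) * z (drop k w))
          = (\<Sum>k\<le>?n. \<Sum>i\<le>k. f i (k - i))"
      by (intro sum.cong refl)
         (auto simp: f_def sum_distrib_right min_def drop_take intro!: sum.cong)
    have r: "(\<Sum>i\<le>?n. x (take i w) *
            (\<Sum>j\<le>length (drop i w). y (take j (drop i w)) * z (drop j (drop i w))))
          = (\<Sum>i\<le>?n. \<Sum>j\<le>?n - i. f i j)"
      by (intro sum.cong refl)
         (auto simp: f_def sum_distrib_left mult.assoc add.commute intro!: sum.cong)
    have "(\<Sum>k\<le>?n. \<Sum>i\<le>k. f i (k - i)) = (\<Sum>(i, j)\<in>{(i, j). i + j \<le> ?n}. f i j)"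
      by (simp add: sum.triangle_reindex_eq)
    also have "{(i, j). i + j \<le> ?n} = (SIGMA i:{..?n}. {..?n - i})"
      by auto
    also have "(\<Sum>(i, j)\<in>\<dots>. f i j) = (\<Sum>i\<le>?n. \<Sum>j\<le>?n - i. f i j)"
      by (simp add: sum.Sigma)
    finally have eq: "concat_prod (concat_prod x y) z w = concat_prod x (concat_prod y z) w"
      using l r by (simp add: concat_prod_def)
    have cong: "concat_prod a b w = concat_prod a' b' w"
      if "?n \<le> L" "\<And>u. length u \<le> L \<Longrightarrow> a u = a' u \<and> b u = b' u" for a b a' b' :: "'a series"
      unfolding concat_prod_def by (intro sum.cong refl) (use that in auto)
    have "concat_prod (trunc L (concat_prod x y)) z w = concat_prod (concat_prod x y) z w"
      and "concat_prod x (trunc L (concat_prod y z)) w = concat_prod x (concat_prod y z) w"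
      if "?n \<le> L"
      using that by (auto intro!: cong simp: trunc_def)
    with eq show "(x \<otimes>\<^bsub>tensor_alg L\<^esub> y \<otimes>\<^bsub>tensor_alg L\<^esub> z) w
        = (x \<otimes>\<^bsub>tensor_alg L\<^esub> (y \<otimes>\<^bsub>tensor_alg L\<^esub> z)) w"
      by (simp add: tensor_alg_def trunc_def[of L "concat_prod _ z"] trunc_def[of L "concat_prod x _"])
  qed
next
  fix x :: "'a series" assume x: "x \<in> carrier (tensor_alg L)"
  show "\<one>\<^bsub>tensor_alg L\<^esub> \<otimes>\<^bsub>tensor_alg L\<^esub> x = x"
  proof
    fix w :: "'a list"
    have "(\<Sum>i\<le>length w. (if take i w = [] then 1 else 0) * x (drop i w))
        = (\<Sum>i\<le>length w. if i = 0 then x w else 0)"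
      by (intro sum.cong) auto
    then show "(\<one>\<^bsub>tensor_alg L\<^esub> \<otimes>\<^bsub>tensor_alg L\<^esub> x) w = x w"
      using x by (auto simp: tensor_alg_def trunc_def concat_prod_def)
  qed
  show "x \<otimes>\<^bsub>tensor_alg L\<^esub> \<one>\<^bsub>tensor_alg L\<^esub> = x"
  proof
    fix w :: "'a list"
    have "(\<Sum>i\<le>length w. x (take i w) * (if drop i w = [] then 1 else 0))
        = (\<Sum>i\<le>length w. if i = length w then x w else 0)"
      by (intro sum.cong) auto
    then show "(x \<otimes>\<^bsub>tensor_alg L\<^esub> \<one>\<^bsub>tensor_alg L\<^esub>) w = x w"
      using x by (auto simp: tensor_alg_def trunc_def concat_prod_def)
  qed
qed (auto simp: tensor_alg_def trunc_def)

definition tensor_letter :: "nat \<Rightarrow> 'd \<Rightarrow> 'd series" where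
  "tensor_letter L a = trunc L (\<lambda>w. if w = [a] then 1 else 0)"

definition lie_bracket :: "nat \<Rightarrow> 'd series \<Rightarrow> 'd series \<Rightarrow> 'd series" where
  "lie_bracket L x y =
     (\<lambda>w. (x \<otimes>\<^bsub>tensor_alg L\<^esub> y) w - (y \<otimes>\<^bsub>tensor_alg L\<^esub> x) w)"

definition lie_subalgebra :: "nat \<Rightarrow> 'd series set \<Rightarrow> bool" where
  "lie_subalgebra L A \<longleftrightarrow>
     A \<subseteq> carrier (tensor_alg L) \<and>
     (\<lambda>w. 0) \<in> A \<and>
     (\<forall>x\<in>A. \<forall>y\<in>A. (\<lambda>w. x w + y w) \<in> A) \<and>
     (\<forall>c. \<forall>x\<in>A. (\<lambda>w. c * x w) \<in> A) \<and>
     (\<forall>x\<in>A. \<forall>y\<in>A. lie_bracket L x y \<in> A)"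

definition free_lie :: "nat \<Rightarrow> 'd series set" where
  "free_lie L = \<Inter>{A. lie_subalgebra L A \<and> range (tensor_letter L) \<subseteq> A}"

text \<open>The two series below are evaluated coefficientwise. On series with constant coefficient
  \<open>0\<close> (for the exponential) resp. \<open>1\<close> (for the logarithm) all but finitely many terms vanish.\<close>

definition tensor_exp :: "nat \<Rightarrow> 'd series \<Rightarrow> 'd series" where
  "tensor_exp L x = (\<lambda>w. \<Sum>k. (x [^]\<^bsub>tensor_alg L\<^esub> k) w / fact k)"

definition tensor_log :: "nat \<Rightarrow> 'd series \<Rightarrow> 'd series" where
  "tensor_log L g = (\<lambda>w. \<Sum>k. (-1) ^ k / real (Suc k) *
     ((\<lambda>u. g u - \<one>\<^bsub>tensor_alg L\<^esub> u) [^]\<^bsub>tensor_alg L\<^esub> Suc k) w)"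

definition free_nilpotent_group :: "nat \<Rightarrow> 'd series set" where
  "free_nilpotent_group L = tensor_exp L ` free_lie L"

text \<open>Measures on the group are modelled as Borel measures for coefficientwise convergence on the
  space of all series that give full mass to the group.\<close>

definition is_barycenter :: "nat \<Rightarrow> 'd series measure \<Rightarrow> 'd series \<Rightarrow> bool" where
  "is_barycenter L \<nu> m \<longleftrightarrow>
     prob_space \<nu> \<and> sets \<nu> = sets borel \<and> (AE x in \<nu>. x \<in> free_nilpotent_group L) \<and>
     m \<in> free_nilpotent_group L \<and>
     (\<forall>w. integrable \<nu> (\<lambda>x. tensor_log L (inv\<^bsub>tensor_alg L\<^esub> m \<otimes>\<^bsub>tensor_alg L\<^esub> x) w) \<and>
          (\<integral>x. tensor_log L (inv\<^bsub>tensor_alg L\<^esub> m \<otimes>\<^bsub>tensor_alg L\<^esub> x) w \<partial>\<nu>) = 0)"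


section \<open>Brownian motion and Stratonovich iterated integrals\<close>

definition is_partition :: "real \<Rightarrow> real \<Rightarrow> nat \<Rightarrow> (nat \<Rightarrow> real) \<Rightarrow> bool" where
  "is_partition s t n p \<longleftrightarrow> p 0 = s \<and> p n = t \<and> (\<forall>i<n. p i < p (Suc i))"

definition standard_brownian_motion ::
  "'w measure \<Rightarrow> (real \<Rightarrow> 'w \<Rightarrow> real ^ 'd) \<Rightarrow> bool" where
  "standard_brownian_motion M B \<longleftrightarrow>
     prob_space M \<and>
     (\<forall>t\<in>{0..1}. B t \<in> borel_measurable M) \<and>
     (AE \<omega> in M. B 0 \<omega> = 0) \<and>
     (AE \<omega> in M. continuous_on {0..1} (\<lambda>t. B t \<omega>)) \<and>
     (\<forall>n p. is_partition 0 1 n p \<longrightarrow>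
        prob_space.indep_vars M (\<lambda>_. borel) (\<lambda>i \<omega>. B (p (Suc i)) \<omega> - B (p i) \<omega>) {..<n}) \<and>
     (\<forall>s t. 0 \<le> s \<and> s < t \<and> t \<le> 1 \<longrightarrow>
        distributed M lborel (\<lambda>\<omega>. B t \<omega> - B s \<omega>)
          (\<lambda>x. ennreal (\<Prod>i\<in>UNIV. normal_density 0 (sqrt (t - s)) (x $ i))))"

definition positive_definite :: "real ^ 'd ^ 'd \<Rightarrow> bool" where
  "positive_definite C \<longleftrightarrow> transpose C = C \<and> (\<forall>x. x \<noteq> 0 \<longrightarrow> 0 < x \<bullet> (C *v x))"

definition matrix_sqrt :: "real ^ 'd ^ 'd \<Rightarrow> real ^ 'd ^ 'd" where
  "matrix_sqrt C = (THE R. positive_definite R \<and> R ** R = C)"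

text \<open>\<open>Z\<close> is a version of the Stratonovich integral of \<open>Y\<close> against \<open>X\<close> over \<open>[0, t]\<close>: the limit in
  probability of the trapezoidal sums as the mesh of the deterministic partition tends to \<open>0\<close>.\<close>

definition trapezoidal_sum ::
  "(real \<Rightarrow> 'w \<Rightarrow> real) \<Rightarrow> (real \<Rightarrow> 'w \<Rightarrow> real) \<Rightarrow> nat \<Rightarrow> (nat \<Rightarrow> real) \<Rightarrow> 'w \<Rightarrow> real" where
  "trapezoidal_sum Y X n p \<omega> =
     (\<Sum>i<n. (Y (p i) \<omega> + Y (p (Suc i)) \<omega>) / 2 * (X (p (Suc i)) \<omega> - X (p i) \<omega>))"

definition has_stratonovich_integral ::
  "'w measure \<Rightarrow> (real \<Rightarrow> 'w \<Rightarrow> real) \<Rightarrow> (real \<Rightarrow> 'w \<Rightarrow> real) \<Rightarrow> real \<Rightarrow> ('w \<Rightarrow> real) \<Rightarrow> bool" where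
  "has_stratonovich_integral M Y X t Z \<longleftrightarrow>
     Z \<in> borel_measurable M \<and>
     (\<forall>\<epsilon>>0. \<exists>\<delta>>0. \<forall>n p. is_partition 0 t n p \<and> (\<forall>i<n. p (Suc i) - p i < \<delta>) \<longrightarrow>
        measure M {\<omega> \<in> space M. \<epsilon> < \<bar>trapezoidal_sum Y X n p \<omega> - Z \<omega>\<bar>} < \<epsilon>)"

text \<open>\<open>I w t\<close> is a version of the iterated integral of the word \<open>w\<close> over
  \<open>0 \<le> t\<^sub>1 \<le> \<dots> \<le> t\<^sub>k \<le> t\<close>; the last letter belongs to the outermost integral.\<close>

definition stratonovich_iterated_integrals ::
  "'w measure \<Rightarrow> (real \<Rightarrow> 'w \<Rightarrow> real ^ 'd) \<Rightarrow> ('d list \<Rightarrow> real \<Rightarrow> 'w \<Rightarrow> real) \<Rightarrow> bool" where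
  "stratonovich_iterated_integrals M X I \<longleftrightarrow>
     (\<forall>t\<in>{0..1}. \<forall>\<omega>\<in>space M. I [] t \<omega> = 1) \<and>
     (\<forall>w a. \<forall>t\<in>{0..1}.
        has_stratonovich_integral M (I w) (\<lambda>s \<omega>. X s \<omega> $ a) t (I (w @ [a]) t))"

definition signature :: "('d list \<Rightarrow> real \<Rightarrow> 'w \<Rightarrow> real) \<Rightarrow> 'w \<Rightarrow> 'd series" where
  "signature I \<omega> = (\<lambda>w. I w 1 \<omega>)"

end

theory Submission
  imports Defs "HOL-Computational_Algebra.Polynomial"
begin

text \<open>The signature \<open>J\<close> of the dyadic piecewise linear interpolation of \<open>X\<close> is a product of
  exponentials of independent, identically distributed, symmetric increments. Reversing the order and
  the signs of the increments turns \<open>J\<close> into \<open>J\<^sup>-\<^sup>1\<close> and does not change the expected coefficients.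
  As the coefficients of \<open>log g\<close> are linear functions of the coefficients of a grouplike \<open>g\<close>, and
  \<open>log (J\<^sup>-\<^sup>1) = - log J\<close>, the expectation of \<open>log J\<close> vanishes.

  The passage to the limit rests on the shuffle identity, which reduces all moments of \<open>J\<close> to
  expected coefficients and these to powers of the expected exponential of one increment. Comparing
  \<open>J\<close> with its trapezoidal sums over a coarser grid, the centred Levy area and vanishing third moments
  make the squared error satisfy a discrete Gronwall inequality uniformly in the finer grid, so that
  \<open>J\<close> converges in probability to the Stratonovich signature, and by \<open>L\<^sup>2\<close>-boundedness also in mean.
  The shuffle identity survives in the limit; it makes the logarithm vanish on shuffles, hence a Lie
  series by Dynkin's criterion, so the limit lies in the group. A barycenter with vanishing mean
  logarithm at the identity is unique because the logarithm is additive to leading order.\<close>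

text \<open>The obstacle is that the integrand of an iterated integral is itself known only as a
  limit in probability, while the Stratonovich definition controls trapezoidal sums of the exact
  integrand. Two scales separate the limits. A coarse dyadic grid is fixed first, so that the
  trapezoidal sum involves finitely many values of the integrand; induction on the word, at all
  dyadic times at once, handles these as the fine mesh tends to 0. The discrepancy between the
  interpolated signature and its coarse trapezoidal sums is bounded independently of the fine mesh,
  so it can be made small before the fine limit is taken.

  The logarithm is handled by interpolating powers: each coefficient of g^n is a polynomial in n
  whose linear term is the coefficient of log g. Identities for powers at natural exponents
  therefore yield the inverse rule, the vanishing on shuffles and g = exp(log g) by comparing
  coefficients of polynomials.

  Series stay untruncated until the group and the barycenter enter; products are compatible with
  truncation, so the algebra carries no level L.\<close>

abbreviation cprod :: "'d series \<Rightarrow> 'd series \<Rightarrow> 'd series" (infixl "\<odot>" 70) where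
  "x \<odot> y \<equiv> concat_prod x y"

definition sone :: "'d series" where
  "sone = (\<lambda>w. if w = [] then 1 else 0)"

primrec spow :: "'d series \<Rightarrow> nat \<Rightarrow> 'd series" where
  "spow x 0 = sone"
| "spow x (Suc k) = spow x k \<odot> x"

subsection \<open>The concatenation algebra\<close>

lemma sone_simps [simp]: "sone [] = 1" "w \<noteq> [] \<Longrightarrow> sone w = 0"
  by (auto simp: sone_def)

lemma cprod_Nil [simp]: "(x \<odot> y) [] = x [] * y []"
  by (simp add: concat_prod_def)

lemma cprod_Cons: "(x \<odot> y) (a # w) = x [] * y (a # w) + ((\<lambda>u. x (a # u)) \<odot> y) w"
  by (simp add: concat_prod_def sum.atMost_Suc_shift del: sum.atMost_Suc)

lemma cprod_last: "(x \<odot> y) w = (\<Sum>i<length w. x (take i w) * y (drop i w)) + x w * y []"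
  by (simp add: concat_prod_def flip: lessThan_Suc_atMost)

lemma cprod_cong:
  assumes "\<And>i. i \<le> length w \<Longrightarrow> x (take i w) = x' (take i w)"
    and "\<And>i. i \<le> length w \<Longrightarrow> y (drop i w) = y' (drop i w)"
  shows "(x \<odot> y) w = (x' \<odot> y') w"
  using assms by (simp add: concat_prod_def)

lemma cprod_add_left: "(\<lambda>w. x w + y w) \<odot> z = (\<lambda>w. (x \<odot> z) w + (y \<odot> z) w)"
  and cprod_add_right: "z \<odot> (\<lambda>w. x w + y w) = (\<lambda>w. (z \<odot> x) w + (z \<odot> y) w)"
  and cprod_scale_left: "(\<lambda>w. c * x w) \<odot> z = (\<lambda>w. c * (x \<odot> z) w)"
  and cprod_scale_right: "z \<odot> (\<lambda>w. c * x w) = (\<lambda>w. c * (z \<odot> x) w)"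
  by (auto simp: concat_prod_def algebra_simps sum.distrib sum_distrib_left)

lemma cprod_sum_left: "(\<lambda>w. \<Sum>i\<in>A. f i w) \<odot> z = (\<lambda>w. \<Sum>i\<in>A. (f i \<odot> z) w)"
  by (auto simp: concat_prod_def sum_distrib_right intro: sum.swap)

lemma cprod_assoc: "(x \<odot> y) \<odot> z = x \<odot> (y \<odot> z)"
proof
  fix w show "((x \<odot> y) \<odot> z) w = (x \<odot> (y \<odot> z)) w"
    by (induction w arbitrary: x y)
       (simp_all add: cprod_Cons cprod_add_left cprod_scale_left algebra_simps)
qed

lemma sone_cprod [simp]: "sone \<odot> x = x"
proof
  fix w
  have "(sone \<odot> x) w = (\<Sum>i\<le>length w. if i = 0 then x w else 0)"
    unfolding concat_prod_def by (intro sum.cong) (auto simp: sone_def)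
  then show "(sone \<odot> x) w = x w" by simp
qed

lemma cprod_sone [simp]: "x \<odot> sone = x"
proof
  fix w
  have "(x \<odot> sone) w = (\<Sum>i\<le>length w. if i = length w then x w else 0)"
    unfolding concat_prod_def by (intro sum.cong) (auto simp: sone_def)
  then show "(x \<odot> sone) w = x w" by simp
qed

lemma spow_commute: "x \<odot> spow x n = spow x n \<odot> x"
  by (induction n) (simp_all flip: cprod_assoc)

lemma spow_add: "spow x (m + n) = spow x m \<odot> spow x n"
  by (induction n) (simp_all add: cprod_assoc)

lemma spow_Nil [simp]: "spow x n [] = x [] ^ n"
  by (induction n) simp_all

lemma spow_eq_0:
  assumes "x [] = 0" "length w < k"
  shows "spow x k w = 0"
  using assms(2)
proof (induction k arbitrary: w)
  case (Suc k)
  show ?case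
    unfolding spow.simps concat_prod_def
  proof (intro sum.neutral ballI)
    fix i assume i: "i \<in> {..length w}"
    show "spow x k (take i w) * x (drop i w) = 0"
    proof (cases "i = length w")
      case False
      with i Suc.prems have "length (take i w) < k" by auto
      with Suc.IH show ?thesis by simp
    qed (simp add: assms)
  qed
qed simp

text \<open>Scaling every letter by \<open>c\<close> is an endomorphism of the concatenation
  algebra. It serves twice: with a square root of time as Brownian scaling, and with
  \<open>c = -1\<close> as a parity argument.\<close>

lemma spow_homogeneous: "spow (\<lambda>w. c ^ length w * x w) k w = c ^ length w * spow x k w"
proof (induction k arbitrary: w)
  case (Suc k)
  have "c ^ i * (c ^ (length w - i)) = c ^ length w" if "i \<le> length w" for i
    using that by (simp flip: power_add)
  then show ?case
    by (auto simp: concat_prod_def Suc sum_distrib_left min_def intro!: sum.cong)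
qed (simp add: sone_def)

lemma trunc_cprod [simp]:
  "trunc L (trunc L x \<odot> y) = trunc L (x \<odot> y)" "trunc L (x \<odot> trunc L y) = trunc L (x \<odot> y)"
  by (auto simp: trunc_def fun_eq_iff intro!: cprod_cong)

lemma trunc_trunc [simp]: "trunc L (trunc L x) = trunc L x"
  by (auto simp: trunc_def)

lemma trunc_sone [simp]: "trunc L sone = sone"
  by (auto simp: trunc_def sone_def)

lemma trunc_in_carrier [simp]: "trunc L x \<in> carrier (tensor_alg L)"
  by (auto simp: trunc_def tensor_alg_def)

lemma tensor_alg_simps:
  "x \<otimes>\<^bsub>tensor_alg L\<^esub> y = trunc L (x \<odot> y)" "\<one>\<^bsub>tensor_alg L\<^esub> = sone"
  by (simp_all add: tensor_alg_def sone_def)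

lemma tensor_alg_pow: "x [^]\<^bsub>tensor_alg L\<^esub> k = trunc L (spow x k)"
  for k :: nat
  by (induction k) (simp_all add: monoid.nat_pow_0 monoid.nat_pow_Suc tensor_alg_monoid tensor_alg_simps)

lemma spow_trunc: "trunc L (spow (trunc L x) k) = trunc L (spow x k)"
  by (induction k) (simp_all, metis trunc_cprod)

subsection \<open>Shuffles and characters\<close>

text \<open>\<open>shs g u v\<close> is the value of the linear functional \<open>g\<close> at the shuffle product of \<open>u\<close> and \<open>v\<close>.\<close>

fun shs :: "'d series \<Rightarrow> 'd list \<Rightarrow> 'd list \<Rightarrow> real" where
  "shs g [] v = g v"
| "shs g (a # u) [] = g (a # u)"
| "shs g (a # u) (b # v) = shs (\<lambda>w. g (a # w)) u (b # v) + shs (\<lambda>w. g (b # w)) (a # u) v"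

lemma shs_Nil2 [simp]: "shs g u [] = g u"
  by (cases u) auto

lemma shs_add: "shs (\<lambda>w. f w + g w) u v = shs f u v + shs g u v"
  by (induction f u v arbitrary: g rule: shs.induct) simp_all

lemma shs_scale: "shs (\<lambda>w. c * f w) u v = c * shs f u v"
  by (induction f u v rule: shs.induct) (simp_all add: algebra_simps)

lemma shs_zero: "shs (\<lambda>w. 0) u v = 0"
  using shs_scale[of 0 "\<lambda>w. 0" u v] by simp

lemma shs_sum: "shs (\<lambda>w. \<Sum>i\<in>A. f i w) u v = (\<Sum>i\<in>A. shs (f i) u v)"
  by (induction A rule: infinite_finite_induct) (simp_all add: shs_zero shs_add)

lemma shs_cong:
  assumes "\<And>w. length w = length u + length v \<Longrightarrow> f w = g w"
  shows "shs f u v = shs g u v"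
  using assms by (induction f u v arbitrary: g rule: shs.induct) (auto intro!: arg_cong2[of _ _ _ _ "(+)"])

text \<open>All words in the shuffle of \<open>u\<close> and \<open>v\<close> have the same length
  and the same letters with multiplicity, so only their number matters; Pascal's rule closes the
  induction. The free function \<open>f\<close> of the length absorbs the letter removed in the
  inductive step.\<close>

lemma shs_symmetric:
  "shs (\<lambda>w. f (length w) * prod_list (map x w)) u v =
     real ((length u + length v) choose length u) * f (length u + length v)
       * prod_list (map x u) * prod_list (map x v)"
proof (induction "length u + length v" arbitrary: f u v)
  case (Suc n)
  show ?case
  proof (cases u; cases v)
    fix a u' b v' assume uv: "u = a # u'" "v = b # v'"
    have *: "shs (\<lambda>w. f (Suc (length w)) * (x c * prod_list (map x w))) p q =
       x c * (real ((length p + length q) choose length p) * f (Suc (length p + length q))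
         * prod_list (map x p) * prod_list (map x q))" if "n = length p + length q" for c p q
      using Suc(1)[OF that, of "\<lambda>k. f (Suc k)"]
        shs_scale[of "x c" "\<lambda>w. f (Suc (length w)) * prod_list (map x w)" p q]
      by (simp add: ac_simps)
    show ?thesis
      using Suc(2) uv by (simp add: *) (simp add: algebra_simps)
  qed (use Suc(2) in simp_all)
qed simp

text \<open>Deconcatenation is multiplicative for the shuffle product: cutting a shuffle of
  \<open>u\<close> and \<open>v\<close> in two cuts \<open>u\<close> and \<open>v\<close> separately
  and shuffles the corresponding parts.\<close>

lemma shs_cprod:
  "shs (g \<odot> h) u v = (\<Sum>i\<le>length u. \<Sum>j\<le>length v.
     shs g (take i u) (take j v) * shs h (drop i u) (drop j v))"
proof (induction "length u + length v" arbitrary: u v g)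
  case (Suc n)
  show ?case
  proof (cases u; cases v)
    fix a u' b v' assume uv: "u = a # u'" "v = b # v'"
    define S where "S g p q i j = shs g (take i p) (take j q) * shs h (drop i p) (drop j q)"
      for g and p q :: "'a list" and i j
    have step: "shs (\<lambda>w. (g \<odot> h) (c # w)) p q = g [] * shs (\<lambda>w. h (c # w)) p q
        + (\<Sum>i\<le>length p. \<Sum>j\<le>length q. S (\<lambda>w. g (c # w)) p q i j)"
      if "n = length p + length q" for c p q
      unfolding S_def by (simp add: cprod_Cons shs_add shs_scale Suc(1)[OF that])
    let ?ga = "\<lambda>w. g (a # w)" and ?gb = "\<lambda>w. g (b # w)"
    \<comment> \<open>The prefixes are sorted by whether the first letter of their shuffle comes
      from \<open>u\<close> or from \<open>v\<close>. Only the pair of empty prefixes has no first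
      letter and contributes the term with \<open>g []\<close>.\<close>
    have S_Suc: "S g u v i (Suc j) = (case i of 0 \<Rightarrow> 0 | Suc i \<Rightarrow> S ?ga u' v i (Suc j)) + S ?gb u v' i j"
      for i j by (auto simp: S_def uv algebra_simps split: nat.split)
    have S_0: "S g u v i 0 = (case i of 0 \<Rightarrow> g [] * shs h u v | Suc i \<Rightarrow> S ?ga u' v i 0)"
      for i by (auto simp: S_def uv algebra_simps split: nat.split)
    have "(\<Sum>i\<le>length u. \<Sum>j\<le>length v. S g u v i j) =
        (\<Sum>i\<le>length u. S g u v i 0 + (\<Sum>j\<le>length v'. S g u v i (Suc j)))"
      by (simp add: uv sum.atMost_Suc_shift del: sum.atMost_Suc)
    also have "\<dots> = (\<Sum>i\<le>length u. (case i of 0 \<Rightarrow> g [] * shs h u v | Suc i \<Rightarrow> (\<Sum>j\<le>length v. S ?ga u' v i j)) + (\<Sum>j\<le>length v'. S ?gb u v' i j))"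
    proof (intro sum.cong refl, goal_cases)
      case (1 i)
      show ?case
        unfolding S_Suc S_0 sum.distrib
        by (cases i) (simp_all add: uv(2) sum.atMost_Suc_shift del: sum.atMost_Suc)
    qed
    also have "\<dots> = g [] * shs h u v + (\<Sum>i\<le>length u'. \<Sum>j\<le>length v. S ?ga u' v i j)
        + (\<Sum>i\<le>length u. \<Sum>j\<le>length v'. S ?gb u v' i j)"
      unfolding sum.distrib by (simp add: uv(1) sum.atMost_Suc_shift del: sum.atMost_Suc)
    finally show ?thesis
      using Suc(2) step[of u' v a] step[of u v' b] by (simp add: S_def uv algebra_simps)
  next
    fix b v' assume "u = []" "v = b # v'"
    then show ?thesis by (simp add: concat_prod_def)
  next
    fix b v' assume "u = b # v'" "v = []"
    then show ?thesis by (simp add: concat_prod_def)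
  qed (use Suc(2) in simp_all)
qed simp

text \<open>The dual description of grouplike series up to degree \<open>L\<close>, as characters of
  the shuffle algebra. Being a family of polynomial equations in the coefficients, it passes to
  limits and is measurable.\<close>

definition shuffle_char :: "nat \<Rightarrow> 'd series \<Rightarrow> bool" where
  "shuffle_char L g \<longleftrightarrow>
     g [] = 1 \<and> (\<forall>u v. length u + length v \<le> L \<longrightarrow> shs g u v = g u * g v)"

lemma shuffle_charD:
  assumes "shuffle_char L g"
  shows "g [] = 1" "length u + length v \<le> L \<Longrightarrow> shs g u v = g u * g v"
  using assms by (auto simp: shuffle_char_def)

lemma shuffle_char_sone: "shuffle_char L sone"
proof -
  have "shs sone u v = sone u * sone v" for u v :: "'a list"
    by (cases u; cases v) (simp_all add: sone_def shs_zero)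
  then show ?thesis by (simp add: shuffle_char_def)
qed

lemma shuffle_char_cprod:
  assumes g: "shuffle_char L g" and h: "shuffle_char L h"
  shows "shuffle_char L (g \<odot> h)"
  unfolding shuffle_char_def
proof (intro conjI allI impI)
  fix u v :: "'a list" assume uv: "length u + length v \<le> L"
  have "shs (g \<odot> h) u v = (\<Sum>i\<le>length u. \<Sum>j\<le>length v.
     (g (take i u) * h (drop i u)) * (g (take j v) * h (drop j v)))"
    unfolding shs_cprod
  proof (intro sum.cong refl, goal_cases)
    case (1 i j)
    then show ?case
      using uv shuffle_charD(2)[OF g, of "take i u" "take j v"]
        shuffle_charD(2)[OF h, of "drop i u" "drop j v"] by simp
  qed
  then show "shs (g \<odot> h) u v = (g \<odot> h) u * (g \<odot> h) v"
    by (simp add: concat_prod_def sum_product)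
qed (use assms in \<open>simp add: shuffle_char_def\<close>)

lemma shuffle_char_spow: "shuffle_char L g \<Longrightarrow> shuffle_char L (spow g n)"
  by (induction n) (simp_all add: shuffle_char_sone shuffle_char_cprod)

lemma shuffle_char_trunc: "shuffle_char L (trunc L g) \<longleftrightarrow> shuffle_char L g"
proof -
  have "shs (trunc L g) u v = shs g u v" if "length u + length v \<le> L" for u v
    using that by (intro shs_cong) (simp add: trunc_def)
  moreover have "trunc L g u = g u" if "length u \<le> L" for u
    using that by (simp add: trunc_def)
  ultimately show ?thesis by (auto simp: shuffle_char_def)
qed

text \<open>The tensor exponential of the degree-one series with coefficients \<open>x\<close>,
  which is the signature of a straight segment with increment \<open>x\<close>.\<close>

definition texp :: "('d \<Rightarrow> real) \<Rightarrow> 'd series" where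
  "texp x = (\<lambda>w. prod_list (map x w) / fact (length w))"

lemma texp_simps [simp]: "texp x [] = 1" "texp x [a] = x a"
  by (simp_all add: texp_def)

lemma shuffle_char_texp: "shuffle_char L (texp x)"
  unfolding shuffle_char_def
proof (intro conjI allI impI)
  fix u v
  show "shs (texp x) u v = texp x u * texp x v"
    using shs_symmetric[of "\<lambda>n. 1 / fact n" x u v] binomial_fact[of "length u" "length u + length v", where 'a=real]
    by (simp add: texp_def field_simps)
qed simp

text \<open>Each coefficient is a multiple of the binomial expansion of (1 + (-1))^n with n the
  length of the word.\<close>

lemma texp_inverse: "texp x \<odot> texp (\<lambda>a. - x a) = sone"
proof
  fix w :: "'a list"
  have neg: "prod_list (map (\<lambda>a. - x a) v) = (-1) ^ length v * prod_list (map x v)" for v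
    by (induction v) auto
  have "(texp x \<odot> texp (\<lambda>a. - x a)) w =
     (\<Sum>i\<le>length w. prod_list (map x w) / fact (length w) * (of_nat (length w choose i) * 1 ^ i * (-1) ^ (length w - i)))"
    unfolding concat_prod_def
  proof (intro sum.cong refl, goal_cases)
    case (1 i)
    have P: "prod_list (map x w) = prod_list (map x (take i w)) * prod_list (map x (drop i w))"
      by (simp flip: prod_list.append map_append)
    have C: "real (length w choose i) = fact (length w) / (fact i * fact (length w - i))"
      using 1 by (intro binomial_fact) simp
    show ?case
      unfolding P C texp_def neg using 1 by (simp add: min_def)
  qed
  also have "\<dots> = prod_list (map x w) / fact (length w) * (1 + (-1)) ^ length w"
    unfolding binomial_ring by (rule sum_distrib_left [symmetric])
  finally show "(texp x \<odot> texp (\<lambda>a. - x a)) w = sone w"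
    by (cases w) (simp_all add: sone_def)
qed

subsection \<open>Powers and the logarithm\<close>

text \<open>This turns identities between powers with natural exponents into identities between
  polynomials, whose coefficients may then be compared.\<close>

lemma poly_eq_if_eq_nat:
  fixes p q :: "real poly"
  assumes "\<And>n::nat. poly p (of_nat n) = poly q (of_nat n)"
  shows "p = q"
proof (rule ccontr)
  assume "p \<noteq> q"
  then have "finite {x. poly (p - q) x = 0}"
    by (intro poly_roots_finite) simp
  moreover have "range (of_nat :: nat \<Rightarrow> real) \<subseteq> {x. poly (p - q) x = 0}"
    using assms by auto
  ultimately show False
    using finite_subset range_inj_infinite[OF inj_of_nat[where 'a = real]] by blast
qed

definition binom_poly :: "nat \<Rightarrow> real poly" where
  "binom_poly k = smult (1 / fact k) (\<Prod>i<k. [:- real i, 1:])"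

lemma poly_binom_poly [simp]: "poly (binom_poly k) (real n) = real (n choose k)"
  by (simp add: binom_poly_def poly_prod binomial_gbinomial gbinomial_prod_rev lessThan_atLeast0)

lemma binom_poly_0 [simp]: "binom_poly 0 = 1"
  by (simp add: binom_poly_def)

text \<open>The linear coefficients are those of the series of log(1 + x). This is why the linear
  term in n of the n-th power is the logarithm.\<close>

lemma coeff_binom_poly_Suc:
  "coeff (binom_poly (Suc k)) 0 = 0" "coeff (binom_poly (Suc k)) 1 = (-1) ^ k / real (Suc k)"
proof -
  define q where "q = (\<Prod>i<k. [:- real (Suc i), 1:])"
  have "binom_poly (Suc k) = smult (1 / fact (Suc k)) (pCons 0 q)"
    by (simp add: binom_poly_def q_def prod.lessThan_Suc_shift del: prod.lessThan_Suc)
  moreover have "coeff q 0 = (-1) ^ k * fact k"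
  proof -
    have "coeff q 0 = (\<Prod>i<k. - real (Suc i))"
      by (simp add: q_def poly_prod flip: poly_0_coeff_0)
    also have "\<dots> = (\<Prod>i<k. (-1) * real (Suc i))" by simp
    also have "\<dots> = (-1) ^ k * fact k"
      unfolding prod.distrib by (simp add: fact_prod_Suc lessThan_atLeast0)
    finally show ?thesis .
  qed
  ultimately show "coeff (binom_poly (Suc k)) 0 = 0"
    "coeff (binom_poly (Suc k)) 1 = (-1) ^ k / real (Suc k)"
    by simp_all
qed

text \<open>The finite sum contains the powers 1 to \<open>length w\<close>; for constant
  coefficient 1 all higher powers vanish at \<open>w\<close>.\<close>

definition series_log :: "'d series \<Rightarrow> 'd series" where
  "series_log g = (\<lambda>w. \<Sum>k<length w. (-1) ^ k / real (Suc k) * spow (\<lambda>u. g u - sone u) (Suc k) w)"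

text \<open>\<open>pow_poly g w\<close> is the coefficient of \<open>w\<close> in the power \<open>g\<^sup>n\<close> as a polynomial in the exponent \<open>n\<close>.\<close>

definition pow_poly :: "'d series \<Rightarrow> 'd list \<Rightarrow> real poly" where
  "pow_poly g w = (\<Sum>k\<le>length w. smult (spow (\<lambda>u. g u - sone u) k w) (binom_poly k))"

lemma spow_binomial:
  "spow g n w = (\<Sum>k\<le>n. real (n choose k) * spow (\<lambda>u. g u - sone u) k w)"
proof (induction n arbitrary: w)
  case (Suc n)
  define h where "h = (\<lambda>u. g u - sone u)"
  have g: "g = (\<lambda>u. sone u + h u)" by (simp add: h_def)
  have "spow g (Suc n) w = spow g n w + (spow g n \<odot> h) w"
    using cprod_add_right[of "spow g n" sone h] by (simp flip: g)
  also have "spow g n = (\<lambda>w. \<Sum>k\<le>n. real (n choose k) * spow h k w)"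
    using Suc by (auto simp: h_def)
  also have "(\<dots> \<odot> h) w = (\<Sum>k\<le>n. real (n choose k) * spow h (Suc k) w)"
    by (simp add: cprod_sum_left cprod_scale_left)
  also have "(\<Sum>k\<le>n. real (n choose k) * spow h k w) = (\<Sum>k\<le>Suc n. real (n choose k) * spow h k w)"
    by simp
  also have "\<dots> + (\<Sum>k\<le>n. real (n choose k) * spow h (Suc k) w) =
      (\<Sum>k\<le>Suc n. real (Suc n choose k) * spow h k w)"
    by (simp add: sum.atMost_Suc_shift sum.distrib ring_distribs del: sum.atMost_Suc)
  finally show ?case by (simp add: h_def)
qed (simp add: sone_def)

lemma poly_pow_poly:
  assumes "g [] = 1"
  shows "poly (pow_poly g w) (real n) = spow g n w"
proof -
  let ?f = "\<lambda>k. real (n choose k) * spow (\<lambda>u. g u - sone u) k w"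
  have "spow g n w = sum ?f {..max n (length w)}"
    by (subst spow_binomial, intro sum.mono_neutral_left) auto
  also have "\<dots> = sum ?f {..length w}"
    using assms by (intro sum.mono_neutral_right) (auto simp: spow_eq_0)
  finally show ?thesis
    by (simp add: pow_poly_def poly_sum mult.commute)
qed

lemma coeff_pow_poly_0: "coeff (pow_poly g w) 0 = sone w"
  by (simp add: pow_poly_def coeff_sum sum.atMost_shift coeff_binom_poly_Suc)

lemma coeff_pow_poly_1: "coeff (pow_poly g w) 1 = series_log g w"
  by (simp add: pow_poly_def series_log_def coeff_sum sum.atMost_shift coeff_binom_poly_Suc(2)[simplified] mult.commute)

section \<open>Powers as a one-parameter group\<close>

lemma pow_poly_add:
  assumes "g [] = 1"
  shows "poly (pow_poly g w) (real m + real n) =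
    (\<Sum>i\<le>length w. poly (pow_poly g (take i w)) (real m) * poly (pow_poly g (drop i w)) (real n))"
  using spow_add[of g m n]
  by (simp add: poly_pow_poly[of g, OF assms] concat_prod_def flip: of_nat_add)

text \<open>The law g^(m+n) = g^m g^n with \<open>n\<close> kept fixed and m replaced by an
  indeterminate.\<close>

lemma pcompose_pow_poly:
  assumes "g [] = 1"
  shows "pcompose (pow_poly g w) [:real n, 1:] =
    (\<Sum>i\<le>length w. smult (poly (pow_poly g (drop i w)) (real n)) (pow_poly g (take i w)))"
proof (rule poly_eq_if_eq_nat)
  fix m
  show "poly (pcompose (pow_poly g w) [:real n, 1:]) (real m) =
    poly (\<Sum>i\<le>length w. smult (poly (pow_poly g (drop i w)) (real n)) (pow_poly g (take i w))) (real m)"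
    using pow_poly_add[of g w m n, OF assms]
    by (simp add: poly_pcompose poly_sum add.commute mult.commute)
qed

text \<open>Taking the linear coefficient in x of g^(x+n) = g^x g^n gives the derivative at n; since
  powers at natural exponents commute, x may stand on the left. The result is the differential
  equation of the flow generated by log g.\<close>

lemma pderiv_pow_poly:
  assumes "g [] = 1"
  shows "pderiv (pow_poly g w) = (\<Sum>i\<le>length w. smult (series_log g (take i w)) (pow_poly g (drop i w)))"
proof (rule poly_eq_if_eq_nat)
  fix n
  have "poly (pderiv (pow_poly g w)) (real n) = coeff (pcompose (pow_poly g w) [:real n, 1:]) 1"
  proof -
    let ?q = "pcompose (pow_poly g w) [:real n, 1:]"
    have "coeff ?q 1 = poly (pderiv ?q) 0"
      by (simp add: poly_0_coeff_0 coeff_pderiv)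
    also have "pderiv ?q = pcompose (pderiv (pow_poly g w)) [:real n, 1:]"
      by (simp add: pderiv_pcompose pderiv_pCons)
    finally show ?thesis by (simp add: poly_pcompose)
  qed
  also have "\<dots> = (\<Sum>i\<le>length w. poly (pow_poly g (drop i w)) (real n) * series_log g (take i w))"
    unfolding pcompose_pow_poly[of g, OF assms] by (simp add: coeff_sum coeff_pow_poly_1[simplified])
  finally show "poly (pderiv (pow_poly g w)) (real n) =
     poly (\<Sum>i\<le>length w. smult (series_log g (take i w)) (pow_poly g (drop i w))) (real n)"
    by (simp add: poly_sum mult.commute)
qed

text \<open>The differential equation becomes a recursion for the coefficients, and its solution is
  g^n = exp(n log g).\<close>

lemma coeff_pow_poly:
  assumes "g [] = 1"
  shows "coeff (pow_poly g w) k = spow (series_log g) k w / fact k"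
proof (induction k arbitrary: w)
  case (Suc k)
  have "real (Suc k) * coeff (pow_poly g w) (Suc k) = coeff (pderiv (pow_poly g w)) k"
    by (simp add: coeff_pderiv)
  also have "\<dots> = (series_log g \<odot> (\<lambda>u. 1 / fact k * spow (series_log g) k u)) w"
    by (simp add: pderiv_pow_poly[of g, OF assms] coeff_sum Suc concat_prod_def)
  also have "\<dots> = spow (series_log g) (Suc k) w / fact k"
    unfolding cprod_scale_right by (simp add: spow_commute)
  finally have "coeff (pow_poly g w) (Suc k) = spow (series_log g) (Suc k) w / fact k / real (Suc k)"
    by (metis nonzero_mult_div_cancel_left of_nat_neq_0)
  then show ?case by (simp add: mult.commute)
qed (simp add: coeff_pow_poly_0)

lemma series_log_Nil [simp]: "series_log g [] = 0"
  by (simp add: series_log_def)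

lemma poly_pow_poly_coeff:
  assumes "g [] = 1" "length w \<le> n"
  shows "poly (pow_poly g w) x = (\<Sum>k\<le>n. coeff (pow_poly g w) k * x ^ k)"
proof -
  have "degree (pow_poly g w) \<le> n"
    using assms by (intro degree_le) (auto simp: coeff_pow_poly[of g] spow_eq_0)
  from arg_cong[OF poly_as_sum_of_monoms'[OF this], of "\<lambda>p. poly p x"] show ?thesis
    by (simp add: poly_sum poly_monom)
qed

lemma exp_series_log:
  assumes "g [] = 1"
  shows "(\<Sum>k\<le>length w. spow (series_log g) k w / fact k) = g w"
  using poly_pow_poly[of g w 1, OF assms] poly_pow_poly_coeff[of g w "length w" 1]
  by (simp add: assms coeff_pow_poly[of g, OF assms])

text \<open>Since g^n h^n is the unit for every n, the corresponding polynomial is constant in n;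
  its vanishing linear coefficient is the sum of the two logarithms.\<close>

lemma series_log_inverse:
  assumes g: "g [] = 1" and h: "h [] = 1" and gh: "g \<odot> h = sone"
  shows "series_log h w = - series_log g w"
proof -
  have inv: "spow g n \<odot> spow h n = sone" for n
  proof (induction n)
    case (Suc n)
    have "spow g (Suc n) \<odot> spow h (Suc n) = spow g n \<odot> (g \<odot> h) \<odot> spow h n"
      by (simp add: cprod_assoc flip: spow_commute[of h])
    then show ?case using Suc gh by simp
  qed simp
  have "(\<Sum>i\<le>length w. pow_poly g (take i w) * pow_poly h (drop i w)) = [:sone w:]"
  proof (rule poly_eq_if_eq_nat)
    fix n show "poly (\<Sum>i\<le>length w. pow_poly g (take i w) * pow_poly h (drop i w)) (real n) = poly [:sone w:] (real n)"
      using inv[of n] by (simp add: poly_sum poly_pow_poly g h concat_prod_def fun_eq_iff)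
  qed
  then have "coeff (\<Sum>i\<le>length w. pow_poly g (take i w) * pow_poly h (drop i w)) 1 = 0"
    by simp
  moreover have "coeff (p * q) 1 = coeff p 0 * coeff q 1 + coeff p 1 * coeff q 0" for p q :: "real poly"
    by (simp add: coeff_mult)
  ultimately have "(sone \<odot> series_log h) w + (series_log g \<odot> sone) w = 0"
    by (simp only: coeff_sum coeff_pow_poly_0 coeff_pow_poly_1 concat_prod_def sum.distrib)
  then show ?thesis by simp
qed

text \<open>Every power of a character is a character, so the shuffle identity holds as an identity
  of polynomials in the exponent. For nonempty \<open>u\<close> and \<open>v\<close> both factors on
  the right vanish at exponent 0, so the product has no linear term.\<close>

lemma series_log_shuffle:
  assumes g: "shuffle_char L g" and uv: "length u + length v \<le> L" "u \<noteq> []" "v \<noteq> []"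
  shows "shs (series_log g) u v = 0"
proof -
  have g1: "g [] = 1" using g by (simp add: shuffle_char_def)
  define c where "c k = (\<lambda>w. coeff (pow_poly g w) k)" for k
  define N where "N = length u + length v"
  have "(\<Sum>k\<le>N. monom (shs (c k) u v) k) = pow_poly g u * pow_poly g v"
  proof (rule poly_eq_if_eq_nat)
    fix n
    have "poly (\<Sum>k\<le>N. monom (shs (c k) u v) k) (real n) = shs (\<lambda>w. \<Sum>k\<le>N. real n ^ k * c k w) u v"
      unfolding shs_sum shs_scale by (simp add: poly_sum poly_monom mult.commute)
    also have "\<dots> = shs (spow g n) u v"
      using poly_pow_poly_coeff[of g _ N "real n"] poly_pow_poly[of g _ n] g1
      by (intro shs_cong) (simp add: N_def c_def mult.commute)
    also have "\<dots> = spow g n u * spow g n v"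
      using shuffle_char_spow[OF g] uv(1) by (simp add: shuffle_char_def)
    finally show "poly (\<Sum>k\<le>N. monom (shs (c k) u v) k) (real n) = poly (pow_poly g u * pow_poly g v) (real n)"
      by (simp add: poly_pow_poly g1)
  qed
  then have "coeff (\<Sum>k\<le>N. monom (shs (c k) u v) k) 1 = coeff (pow_poly g u * pow_poly g v) 1"
    by simp
  moreover have "1 \<le> N" using uv by (cases u) (auto simp: N_def)
  ultimately have "shs (c 1) u v = 0"
    using uv by (simp add: coeff_sum coeff_mult coeff_pow_poly_0)
  then show ?thesis by (simp only: c_def coeff_pow_poly_1)
qed

subsection \<open>Dynkin's criterion\<close>

text \<open>\<open>dynkin n y\<close> is the series \<open>\<Sum>v. y v * [v]\<close> over the words \<open>v = a\<^sub>1 \<dots> a\<^sub>n\<close>, where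
  \<open>[v] = [a\<^sub>1, [a\<^sub>2, \<dots>, a\<^sub>n]]\<close>, evaluated at words of length \<open>n\<close>.\<close>

fun dynkin :: "nat \<Rightarrow> 'd series \<Rightarrow> 'd series" where
  "dynkin 0 y w = 0"
| "dynkin (Suc 0) y w = y w"
| "dynkin (Suc (Suc n)) y w =
     dynkin (Suc n) (\<lambda>v. y (hd w # v)) (tl w) - dynkin (Suc n) (\<lambda>v. y (last w # v)) (butlast w)"

lemma dynkin_add: "dynkin n (\<lambda>v. f v + g v) w = dynkin n f w + dynkin n g w"
  by (induction n f w arbitrary: g rule: dynkin.induct) simp_all

lemma dynkin_cong:
  assumes "\<And>v. length v = n \<Longrightarrow> v \<noteq> [] \<Longrightarrow> f v = g v" "length w = n"
  shows "dynkin n f w = dynkin n g w"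
  using assms
proof (induction n f w arbitrary: g rule: dynkin.induct)
  case (3 n y w)
  have "dynkin (Suc n) (\<lambda>v. y (hd w # v)) (tl w) = dynkin (Suc n) (\<lambda>v. g (hd w # v)) (tl w)"
    using 3 by (intro 3(1)) auto
  moreover have "dynkin (Suc n) (\<lambda>v. y (last w # v)) (butlast w) = dynkin (Suc n) (\<lambda>v. g (last w # v)) (butlast w)"
    using 3 by (intro 3(2)) auto
  ultimately show ?case by simp
next
  case (2 y w)
  then show ?case by (cases w) auto
qed simp

lemma dynkin_zero: "dynkin n (\<lambda>v. 0) w = 0"
  using dynkin_add[of n "\<lambda>v. 0" "\<lambda>v. 0" w] by simp

text \<open>Dually: \<open>|w| w\<close> is the sum over the splittings \<open>w = u v\<close> of the shuffles of \<open>v\<close>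
  with the adjoint of the bracketing map applied to \<open>u\<close>.\<close>

lemma dynkin_shuffle:
  "length w = n \<Longrightarrow>
     real n * y w = (\<Sum>i\<le>n. dynkin i (\<lambda>u. shs y u (drop i w)) (take i w))"
proof (induction n arbitrary: y w)
  case (Suc n)
  then obtain c w' where w: "w = c # w'" and len: "length w' = n" by (cases w) auto
  define T where "T i = dynkin i (\<lambda>u. shs y u (drop i w)) (take i w)" for i
  define U where "U i = dynkin i (\<lambda>u. shs (\<lambda>x. y (c # x)) u (drop i w')) (take i w')" for i
  \<comment> \<open>Shuffles are sorted by their first letter. \<open>U i\<close> collects those led
    by the first letter of \<open>w\<close>, which reduce to the induction hypothesis.
    \<open>B i\<close> collects those led by \<open>w ! i\<close> when the bracketed prefix ends
    just before it; it occurs in \<open>T i\<close> with sign plus and in \<open>T (Suc i)\<close>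
    with sign minus. The value 0 beyond \<open>n\<close>, where no letter is left, ends the
    telescoping.\<close>
  define B where "B i = (if i \<le> n then dynkin i (\<lambda>u. shs (\<lambda>x. y (w ! i # x)) u (drop (Suc i) w)) (take i w) else 0)" for i
  have T1: "T 1 = y w + B 1"
  proof (cases w')
    case Nil
    then show ?thesis using len by (simp add: T_def B_def w)
  next
    case (Cons f v)
    then have "1 \<le> n" using len by auto
    with Cons show ?thesis by (simp add: T_def B_def w)
  qed
  have last: "last (take (Suc i) w) = w ! i" and butlast: "butlast (take (Suc i) w) = take i w"
    if "i \<le> n" for i
    using that len w take_Suc_conv_app_nth[of i w] by simp_all
  have hd: "hd (take (Suc i) w) = c" and tl: "tl (take (Suc i) w) = take i w'" for i
    by (simp_all add: w)
  have TS: "T (Suc i) = U i + (B (Suc i) - B i)" if i: "1 \<le> i" "i \<le> n" for i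
  proof -
    obtain j where j: "i = Suc j" using i by (cases i) auto
    have T: "T (Suc i) = dynkin i (\<lambda>u. shs y (c # u) (drop (Suc i) w)) (take i w')
                     - dynkin i (\<lambda>u. shs y (w ! i # u) (drop (Suc i) w)) (take i w)"
      using i unfolding T_def by (simp only: j dynkin.simps last butlast hd tl)
    show ?thesis
    proof (cases "i = n")
      case True
      then show ?thesis
        using T len by (simp add: U_def B_def w)
    next
      case False
      then have dr: "drop (Suc i) w = w ! Suc i # drop (Suc (Suc i)) w"
        using i len by (intro Cons_nth_drop_Suc[symmetric]) (simp add: w)
      have "B (Suc i) = dynkin i (\<lambda>u. shs (\<lambda>x. y (w ! Suc i # x)) (c # u) (drop (Suc (Suc i)) w)) (take i w')
         - dynkin i (\<lambda>u. shs (\<lambda>x. y (w ! Suc i # x)) (w ! i # u) (drop (Suc (Suc i)) w)) (take i w)"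
        using i False unfolding B_def by (simp add: last butlast hd tl j dynkin.simps(3))
      then show ?thesis
        using T i dr by (simp add: U_def B_def dynkin_add w)
    qed
  qed
  have "(\<Sum>i\<le>Suc n. T i) = T 0 + T 1 + (\<Sum>i=1..n. T (Suc i))"
    by (simp add: sum.atMost_Suc_shift sum.atLeast1_atMost_eq lessThan_Suc_atMost del: sum.atMost_Suc)
       (cases n; simp add: sum.atMost_Suc_shift lessThan_Suc_atMost del: sum.atMost_Suc)
  also have "(\<Sum>i=1..n. T (Suc i)) = (\<Sum>i=1..n. U i) + (\<Sum>i=1..n. B (Suc i) - B i)"
    using TS by (simp add: sum.distrib)
  also have "(\<Sum>i=1..n. B (Suc i) - B i) = B (Suc n) - B 1"
    using sum_telescope''[of 1 "Suc n" B] by (simp add: sum_Suc_diff)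
  also have "(\<Sum>i=1..n. U i) = (\<Sum>i\<le>n. U i)"
    by (intro sum.mono_neutral_left) (auto simp: U_def Suc_le_eq)
  also have "\<dots> = real n * y w"
    using Suc.IH[OF len, of "\<lambda>x. y (c # x)"] by (simp add: U_def w)
  finally show ?case
    using T1 by (simp add: T_def[of 0] T_def[symmetric] B_def[of "Suc n"] algebra_simps)
qed simp

text \<open>The Dynkin-Specht-Wever criterion: when the shuffles of nonempty words vanish, only the
  splitting with empty tail survives in \<open>dynkin_shuffle\<close>.\<close>

lemma dynkin_eigenvector:
  assumes "length w = n" "\<And>u v. length u + length v = n \<Longrightarrow> u \<noteq> [] \<Longrightarrow> v \<noteq> [] \<Longrightarrow> shs y u v = 0"
  shows "dynkin n y w = real n * y w"
proof -
  have "dynkin i (\<lambda>u. shs y u (drop i w)) (take i w) = 0" if "i < n" for i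
  proof -
    have "dynkin i (\<lambda>u. shs y u (drop i w)) (take i w) = dynkin i (\<lambda>u. 0) (take i w)"
      using that assms by (intro dynkin_cong) auto
    then show ?thesis by (simp add: dynkin_zero)
  qed
  then show ?thesis
    using dynkin_shuffle[OF assms(1), of y] assms(1) by (simp flip: lessThan_Suc_atMost)
qed

subsection \<open>The free Lie algebra and its group\<close>

lemma tensor_letter_eq: "1 \<le> L \<Longrightarrow> tensor_letter L a = (\<lambda>w. if w = [a] then 1 else 0)"
  by (auto simp: tensor_letter_def trunc_def)

lemma letter_cprod:
  "((\<lambda>w. if w = [a] then 1 else 0) \<odot> z) w = (if w \<noteq> [] \<and> hd w = a then z (tl w) else 0)"
proof (cases w)
  case (Cons b v)
  have "(\<lambda>u. if b # u = [a] then 1 else 0) = (if b = a then sone else (\<lambda>_. 0) :: 'a series)"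
    by (auto simp: sone_def)
  moreover have "(\<lambda>_. 0) \<odot> z = (\<lambda>_. 0)" by (simp add: concat_prod_def)
  ultimately show ?thesis using Cons by (simp add: cprod_Cons)
qed simp

lemma cprod_letter:
  "(z \<odot> (\<lambda>w. if w = [a] then 1 else 0)) w = (if w \<noteq> [] \<and> last w = a then z (butlast w) else 0)"
proof (induction w arbitrary: z)
  case (Cons b w)
  then show ?case by (cases w) (auto simp: cprod_Cons)
qed simp

lemma lie_subalgebra_Nil: "lie_subalgebra L {x \<in> carrier (tensor_alg L). x [] = 0}"
  by (auto simp: lie_subalgebra_def lie_bracket_def tensor_alg_def trunc_def concat_prod_def)

lemma free_lie_least: "lie_subalgebra L A \<Longrightarrow> range (tensor_letter L) \<subseteq> A \<Longrightarrow> free_lie L \<subseteq> A"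
  by (auto simp: free_lie_def)

lemma free_lie_Nil: "x \<in> free_lie L \<Longrightarrow> x \<in> carrier (tensor_alg L) \<and> x [] = 0"
proof -
  have "range (tensor_letter L) \<subseteq> {x \<in> carrier (tensor_alg L). x [] = 0}"
    by (auto simp: tensor_letter_def trunc_def tensor_alg_def)
  from free_lie_least[OF lie_subalgebra_Nil this] show "x \<in> free_lie L \<Longrightarrow> ?thesis" by auto
qed

lemma lie_subalgebra_free_lie: "lie_subalgebra L (free_lie L)"
  unfolding lie_subalgebra_def
proof (intro conjI ballI allI)
  show "free_lie L \<subseteq> carrier (tensor_alg L)" using free_lie_Nil by auto
qed (simp_all add: free_lie_def lie_subalgebra_def)

lemma
  fixes x y :: "'d series"
  shows free_lie_zero: "(\<lambda>w :: 'd list. 0) \<in> free_lie L"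
    and free_lie_add: "x \<in> free_lie L \<Longrightarrow> y \<in> free_lie L \<Longrightarrow> (\<lambda>w. x w + y w) \<in> free_lie L"
    and free_lie_scale: "x \<in> free_lie L \<Longrightarrow> (\<lambda>w. c * x w) \<in> free_lie L"
    and free_lie_bracket: "x \<in> free_lie L \<Longrightarrow> y \<in> free_lie L \<Longrightarrow> lie_bracket L x y \<in> free_lie L"
proof -
  have "lie_subalgebra L (free_lie L :: 'd series set)"
    by (rule lie_subalgebra_free_lie)
  then show "(\<lambda>w :: 'd list. 0) \<in> free_lie L"
    "x \<in> free_lie L \<Longrightarrow> y \<in> free_lie L \<Longrightarrow> (\<lambda>w. x w + y w) \<in> free_lie L"
    "x \<in> free_lie L \<Longrightarrow> (\<lambda>w. c * x w) \<in> free_lie L"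
    "x \<in> free_lie L \<Longrightarrow> y \<in> free_lie L \<Longrightarrow> lie_bracket L x y \<in> free_lie L"
    by (simp_all add: lie_subalgebra_def)
qed

lemma tensor_letter_in_free_lie: "tensor_letter L a \<in> free_lie L"
  by (auto simp: free_lie_def)

lemma free_lie_sum:
  assumes "\<And>i. i \<in> A \<Longrightarrow> f i \<in> free_lie L"
  shows "(\<lambda>w. \<Sum>i\<in>A. f i w) \<in> free_lie L"
  using assms
  by (induction A rule: infinite_finite_induct) (simp_all add: free_lie_zero free_lie_add)

text \<open>Sorting the bracketed words by their first letter writes the degree-n image as a sum
  over the finite alphabet of brackets of a letter with an image of degree one less.\<close>

lemma dynkin_in_free_lie:
  fixes y :: "'d :: finite series"
  assumes "1 \<le> n" "n \<le> L"
  shows "(\<lambda>w. if length w = n then dynkin n y w else 0) \<in> free_lie L"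
  using assms
proof (induction n arbitrary: y rule: nat_induct_at_least)
  case base
  have "(\<lambda>w. if length w = 1 then dynkin 1 y w else 0) = (\<lambda>w. \<Sum>a\<in>UNIV. y [a] * tensor_letter L a w)"
  proof
    fix w :: "'d list"
    have "(\<Sum>a\<in>UNIV. y [a] * tensor_letter L a w) = (\<Sum>a\<in>UNIV. if w = [a] then y w else 0)"
      using base by (intro sum.cong) (auto simp: tensor_letter_eq)
    also have "\<dots> = (if length w = 1 then y w else 0)"
      by (cases w) (auto simp: sum.delta')
    finally show "(if length w = 1 then dynkin 1 y w else 0) = (\<Sum>a\<in>UNIV. y [a] * tensor_letter L a w)"
      by simp
  qed
  moreover have "\<dots> \<in> free_lie L"
    by (intro free_lie_sum free_lie_scale tensor_letter_in_free_lie)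
  ultimately show ?case by simp
next
  case (Suc n)
  define z where "z a = (\<lambda>w. if length w = n then dynkin n (\<lambda>v. y (a # v)) w else 0)" for a
  have "(\<lambda>w. if length w = Suc n then dynkin (Suc n) y w else 0) =
      (\<lambda>w. \<Sum>a\<in>UNIV. lie_bracket L (tensor_letter L a) (z a) w)"
  proof
    fix w :: "'d list"
    obtain k where n: "n = Suc k" using Suc by (cases n) auto
    have "lie_bracket L (tensor_letter L a) (z a) w =
       (if w \<noteq> [] \<and> hd w = a then z a (tl w) else 0) - (if w \<noteq> [] \<and> last w = a then z a (butlast w) else 0)" for a
      using Suc by (auto simp: lie_bracket_def tensor_alg_simps tensor_letter_eq letter_cprod cprod_letter trunc_def z_def)
    then have "(\<Sum>a\<in>UNIV. lie_bracket L (tensor_letter L a) (z a) w) =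
       (if w \<noteq> [] then z (hd w) (tl w) - z (last w) (butlast w) else 0)"
      by (auto simp: sum_subtractf)
    also have "\<dots> = (if length w = Suc n then dynkin (Suc n) y w else 0)"
      using n by (auto simp: z_def)
    finally show "(if length w = Suc n then dynkin (Suc n) y w else 0) =
      (\<Sum>a\<in>UNIV. lie_bracket L (tensor_letter L a) (z a) w)" by simp
  qed
  moreover have "\<dots> \<in> free_lie L"
    unfolding z_def using Suc by (intro free_lie_sum free_lie_bracket tensor_letter_in_free_lie) simp
  ultimately show ?case by simp
qed

text \<open>In each positive degree n the logarithm is 1/n times its own Dynkin image; there is no
  component in degree 0.\<close>

lemma series_log_in_free_lie:
  fixes g :: "'d :: finite series"
  assumes "shuffle_char L g"
  shows "trunc L (series_log g) \<in> free_lie L"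
proof -
  define y where "y = series_log g"
  have "trunc L y = (\<lambda>w. \<Sum>n\<in>{1..L}. 1 / real n * (if length w = n then dynkin n y w else 0))"
  proof
    fix w :: "'d list"
    have "(\<Sum>n\<in>{1..L}. 1 / real n * (if length w = n then dynkin n y w else 0)) =
      (\<Sum>n\<in>{1..L}. if length w = n then 1 / real n * dynkin n y w else 0)"
      by (intro sum.cong) auto
    also have "\<dots> = (if length w \<in> {1..L} then 1 / real (length w) * dynkin (length w) y w else 0)"
      by (rule sum.delta') simp
    also have "\<dots> = trunc L y w"
    proof (cases "length w \<in> {1..L}")
      case True
      have "dynkin (length w) y w = real (length w) * y w"
        using True by (intro dynkin_eigenvector refl) (auto simp: y_def intro!: series_log_shuffle[OF assms])
      with True show ?thesis by (auto simp: trunc_def)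
    next
      case False
      then have "w = [] \<or> length w > L" by (cases w) auto
      with False show ?thesis by (auto simp: trunc_def y_def)
    qed
    finally show "trunc L y w = (\<Sum>n\<in>{1..L}. 1 / real n * (if length w = n then dynkin n y w else 0))" ..
  qed
  also have "\<dots> \<in> free_lie L"
    by (intro free_lie_sum free_lie_scale dynkin_in_free_lie) auto
  finally show ?thesis by (simp add: y_def)
qed

section \<open>Exponential, logarithm and inverses in the truncated algebra\<close>

lemma tensor_exp_eq:
  assumes "x [] = 0"
  shows "tensor_exp L x w = (if length w \<le> L then \<Sum>k\<le>length w. spow x k w / fact k else 0)"
proof -
  have "tensor_exp L x w = (\<Sum>k\<le>length w. trunc L (spow x k) w / fact k)"
    unfolding tensor_exp_def tensor_alg_pow
    by (intro suminf_finite) (auto simp: trunc_def spow_eq_0[of x, OF assms])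
  then show ?thesis by (simp add: trunc_def)
qed

lemma tensor_log_trunc:
  assumes "g [] = 1"
  shows "tensor_log L (trunc L g) w = (if length w \<le> L then series_log g w else 0)"
proof -
  let ?h = "\<lambda>u. g u - sone u"
  have h: "(\<lambda>u. trunc L g u - sone u) = trunc L ?h"
    by (auto simp: trunc_def sone_def)
  have "tensor_log L (trunc L g) w = (\<Sum>k. (-1) ^ k / real (Suc k) * trunc L (spow ?h (Suc k)) w)"
    unfolding tensor_log_def tensor_alg_simps h tensor_alg_pow spow_trunc ..
  also have "\<dots> = (\<Sum>k<length w. (-1) ^ k / real (Suc k) * trunc L (spow ?h (Suc k)) w)"
    by (intro suminf_finite) (auto simp: trunc_def simp del: spow.simps intro!: spow_eq_0 assms)
  finally show ?thesis by (simp add: trunc_def series_log_def)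
qed

text \<open>The Lie element whose exponential is \<open>trunc L g\<close> is the truncated logarithm
  of \<open>g\<close>.\<close>

lemma shuffle_char_in_group:
  fixes g :: "'d :: finite series"
  assumes "shuffle_char L g"
  shows "trunc L g \<in> free_nilpotent_group L"
proof -
  have g: "g [] = 1" using assms by (simp add: shuffle_char_def)
  have "trunc L (spow (trunc L (series_log g)) k) = trunc L (spow (series_log g) k)" for k
    by (rule spow_trunc)
  then have pow: "spow (trunc L (series_log g)) k w = spow (series_log g) k w" if "length w \<le> L" for k w
    using that by (metis trunc_def)
  have "tensor_exp L (trunc L (series_log g)) = trunc L g"
  proof
    fix w
    have "tensor_exp L (trunc L (series_log g)) w =
        (if length w \<le> L then \<Sum>k\<le>length w. spow (trunc L (series_log g)) k w / fact k else 0)"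
      by (rule tensor_exp_eq) (simp add: trunc_def)
    also have "\<dots> = trunc L g w"
      using pow exp_series_log[of g w, OF g] by (simp add: trunc_def)
    finally show "tensor_exp L (trunc L (series_log g)) w = trunc L g w" .
  qed
  with series_log_in_free_lie[OF assms] show ?thesis
    unfolding free_nilpotent_group_def by (metis image_eqI)
qed

lemma free_nilpotent_groupD:
  assumes "m \<in> free_nilpotent_group L"
  shows "m \<in> carrier (tensor_alg L)" "m [] = 1"
proof -
  obtain x where x: "m = tensor_exp L x" "x \<in> free_lie L"
    using assms by (auto simp: free_nilpotent_group_def)
  then have "x [] = 0" using free_lie_Nil by auto
  then show "m \<in> carrier (tensor_alg L)" "m [] = 1"
    unfolding x(1) by (simp_all add: tensor_alg_def tensor_exp_eq)
qed

text \<open>A Neumann series: \<open>h\<close> has no constant term, so its powers beyond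
  \<open>L\<close> are cut off and the alternating sum of powers inverts sone + h on both
  sides.\<close>

lemma tensor_alg_Units:
  assumes m: "m \<in> carrier (tensor_alg L)" "m [] = 1"
  shows "m \<in> Units (tensor_alg L)"
proof -
  define h where "h = (\<lambda>u. m u - sone u)"
  define s where "s = (\<lambda>w. \<Sum>k\<le>L. (-1) ^ k * spow h k w)"
  have mh: "m = (\<lambda>u. sone u + h u)" by (simp add: h_def)
  have tel: "(\<Sum>k\<le>n. (-1) ^ k * spow h k w) + (\<Sum>k\<le>n. (-1) ^ k * spow h (Suc k) w)
     = sone w + (-1) ^ n * spow h (Suc n) w" for n w
    by (induction n) (simp_all add: algebra_simps)
  have "s \<odot> h = (\<lambda>w. \<Sum>k\<le>L. (-1) ^ k * spow h (Suc k) w)"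
    by (simp add: s_def cprod_sum_left cprod_scale_left)
  moreover have "h \<odot> s = s \<odot> h"
  proof
    fix w
    have "(h \<odot> s) w = (\<Sum>k\<le>L. (-1) ^ k * (h \<odot> spow h k) w)"
      by (simp add: s_def concat_prod_def sum_distrib_left sum.swap[of _ "{..L}"] mult.left_commute)
    then show "(h \<odot> s) w = (s \<odot> h) w"
      by (simp add: s_def cprod_sum_left cprod_scale_left spow_commute)
  qed
  ultimately have "s \<odot> m = (\<lambda>w. sone w + (-1) ^ L * spow h (Suc L) w)"
    "m \<odot> s = (\<lambda>w. sone w + (-1) ^ L * spow h (Suc L) w)"
    unfolding mh cprod_add_left cprod_add_right by (simp_all add: tel s_def del: spow.simps)
  moreover have "trunc L (\<lambda>w. sone w + (-1) ^ L * spow h (Suc L) w) = sone"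
    using m(2) by (auto simp: fun_eq_iff trunc_def h_def sone_def spow_eq_0 simp del: spow.simps)
  ultimately have "trunc L s \<otimes>\<^bsub>tensor_alg L\<^esub> m = \<one>\<^bsub>tensor_alg L\<^esub>" "m \<otimes>\<^bsub>tensor_alg L\<^esub> trunc L s = \<one>\<^bsub>tensor_alg L\<^esub>"
    by (simp_all add: tensor_alg_simps)
  then show ?thesis
    using m(1) unfolding Units_def by (auto intro!: bexI[of _ "trunc L s"])
qed

lemma tensor_alg_inv:
  assumes m: "m \<in> carrier (tensor_alg L)" "m [] = 1"
  shows "trunc L ((inv\<^bsub>tensor_alg L\<^esub> m) \<odot> m) = sone"
  using monoid.Units_l_inv[OF tensor_alg_monoid tensor_alg_Units[OF m]]
  by (simp add: tensor_alg_simps)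

lemma spow_cong:
  assumes "\<And>u. length u \<le> length w \<Longrightarrow> x u = y u"
  shows "spow x k w = spow y k w"
  using assms
proof (induction k arbitrary: w)
  case (Suc k)
  have "spow x k (take i w) = spow y k (take i w)" for i
    by (intro Suc.IH Suc.prems) simp
  then show ?case using Suc.prems by (auto intro!: cprod_cong)
qed simp

text \<open>In a power of order at least two, a factor can be evaluated at the whole of
  \<open>w\<close> only if the others are evaluated at the empty word, where they vanish. Hence a
  change in the coefficient of \<open>w\<close> itself enters the logarithm through the linear term
  alone.\<close>

lemma series_log_leading:
  assumes "g [] = 1" "h [] = 1" "w \<noteq> []" "\<And>u. length u < length w \<Longrightarrow> g u = h u"
  shows "series_log g w = series_log h w + (g w - h w)"
proof -
  define x where "x = (\<lambda>u. g u - sone u)"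
  define y where "y = (\<lambda>u. h u - sone u)"
  have xy: "x u = y u" if "length u < length w" for u
    using that assms(4) by (simp add: x_def y_def)
  have "spow x (Suc (Suc k)) w = spow y (Suc (Suc k)) w" for k
  proof -
    have "spow x (Suc k) (take i w) * x (drop i w) = spow y (Suc k) (take i w) * y (drop i w)" if "i \<le> length w" for i
    proof (cases "i = 0 \<or> i = length w")
      case True
      then show ?thesis using assms by (auto simp: x_def y_def)
    next
      case False
      then have i: "0 < i" "i < length w" using that by auto
      then show ?thesis
        using xy[of "drop i w"] spow_cong[of "take i w" x y "Suc k"] xy assms(3) by simp
    qed
    then show ?thesis
      unfolding spow.simps(2)[of _ "Suc k"] concat_prod_def by (intro sum.cong) auto
  qed
  then have "(\<Sum>k<n. (-1) ^ Suc k / real (Suc (Suc k)) * spow x (Suc (Suc k)) w) =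
     (\<Sum>k<n. (-1) ^ Suc k / real (Suc (Suc k)) * spow y (Suc (Suc k)) w)" for n
    by simp
  moreover obtain n where n: "length w = Suc n" using assms(3) by (cases w) auto
  ultimately have "series_log g w - series_log h w = spow x 1 w - spow y 1 w"
    unfolding series_log_def x_def[symmetric] y_def[symmetric] n sum.lessThan_Suc_shift by simp
  then show ?thesis by (simp add: x_def y_def)
qed

text \<open>This identifies the lowest nontrivial level of a barycenter \<open>m\<close> with inverse \<open>m'\<close>.\<close>

lemma series_log_inv_shift:
  assumes inv: "trunc L (m' \<odot> m) = sone" and m: "m [] = 1" "\<And>u. length u < length w \<Longrightarrow> m u = sone u"
    and w: "w \<noteq> []" "length w \<le> L" and x: "x [] = 1"
  shows "series_log (m' \<odot> x) w = series_log x w - m w"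
proof -
  have inv': "(m' \<odot> m) u = sone u" if "length u \<le> L" for u
    using fun_cong[OF inv, of u] that by (simp add: trunc_def)
  have short: "m' u = sone u" if "length u < length w" for u
  proof -
    have "(m' \<odot> m) u = (m' \<odot> sone) u"
      using that by (intro cprod_cong refl m(2)) simp
    with inv'[of u] that w show ?thesis by simp
  qed
  define e where "e = (\<lambda>u. m' u - sone u)"
  have e: "e u = 0" if "length u < length w" for u
    using that short by (simp add: e_def)
  \<comment> \<open>Up to the length of \<open>w\<close> the series \<open>e\<close> can be nonzero
    only at full length, so just the splitting with empty second part contributes.\<close>
  have m'x: "(m' \<odot> z) u = z u + e u * z []" if "length u \<le> length w" for u z
  proof -
    have "(m' \<odot> z) u = z u + (e \<odot> z) u"
      using cprod_add_left[of sone e z] by (simp add: e_def fun_eq_iff)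
    also have "(e \<odot> z) u = e u * z []"
      unfolding cprod_last using that by (simp add: e)
    finally show ?thesis .
  qed
  have "m' [] = 1" using short[of "[]"] w by simp
  then have "series_log (m' \<odot> x) w = series_log x w + ((m' \<odot> x) w - x w)"
    using x w by (intro series_log_leading) (simp_all add: m'x e)
  moreover have "m w + e w = 0"
    using m'x[of w m] inv'[of w] m(1) w by simp
  ultimately show ?thesis using m'x[of w x] x by simp
qed

subsection \<open>The logarithm is linear on characters\<close>

text \<open>Polynomials in the coefficients that are homogeneous of weight \<open>n\<close> agree on
  characters with linear forms in degree \<open>n\<close>. Hiding the coefficients of the form
  allows it to be assembled by sums and products, after which moments reduce to expected
  coefficients.\<close>

definition linear_on_chars :: "nat \<Rightarrow> ('d series \<Rightarrow> real) \<Rightarrow> bool" where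
  "linear_on_chars n F \<longleftrightarrow>
     (\<exists>c. \<forall>g. shuffle_char n g \<longrightarrow> F g = (\<Sum>w | length w = n. c w * g w))"

lemma finite_words [simp]: "finite {w :: 'd :: finite list. length w = n}"
  using finite_lists_length_eq[of "UNIV :: 'd set" n] by simp

lemma shuffle_char_mono: "shuffle_char L g \<Longrightarrow> n \<le> L \<Longrightarrow> shuffle_char n g"
  by (auto simp: shuffle_char_def)

lemma shs_expand:
  fixes g :: "'d :: finite series"
  assumes "length u + length v = n"
  shows "shs g u v = (\<Sum>w | length w = n. shs (\<lambda>x. if x = w then 1 else 0) u v * g w)"
proof -
  have "shs g u v = shs (\<lambda>x. \<Sum>w | length w = n. g w * (if x = w then 1 else 0)) u v"
    using assms by (intro shs_cong) (simp add: if_distrib cong: if_cong)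
  then show ?thesis unfolding shs_sum shs_scale by (simp add: mult.commute)
qed

lemma linear_on_chars_coeff: "linear_on_chars (length w) (\<lambda>g :: 'd :: finite series. g w)"
  unfolding linear_on_chars_def
  by (rule exI[of _ "\<lambda>v. if v = w then 1 else 0"]) (simp add: if_distrib[of "\<lambda>x. x * _"] cong: if_cong)

lemma linear_on_chars_scale: "linear_on_chars n F \<Longrightarrow> linear_on_chars n (\<lambda>g. a * F g)"
  unfolding linear_on_chars_def
  by (erule exE, rule_tac x = "\<lambda>w. a * c w" in exI) (simp add: sum_distrib_left mult.assoc)

lemma linear_on_chars_zero: "linear_on_chars n (\<lambda>g. 0)"
  unfolding linear_on_chars_def by (rule exI[of _ "\<lambda>w. 0"]) simp

lemma linear_on_chars_add:
  "linear_on_chars n F \<Longrightarrow> linear_on_chars n G \<Longrightarrow> linear_on_chars n (\<lambda>g. F g + G g)"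
  unfolding linear_on_chars_def
  by (elim exE, rule_tac x = "\<lambda>w. c w + ca w" in exI) (simp add: sum.distrib ring_distribs)

lemma linear_on_chars_sum:
  "(\<And>i. i \<in> A \<Longrightarrow> linear_on_chars n (F i)) \<Longrightarrow> linear_on_chars n (\<lambda>g. \<Sum>i\<in>A. F i g)"
  by (induction A rule: infinite_finite_induct) (simp_all add: linear_on_chars_zero linear_on_chars_add)

text \<open>The shuffle identity replaces each product \<open>g u * g v\<close> by
  \<open>shs g u v\<close>, which is linear in the coefficients whose degree is the sum.\<close>

lemma linear_on_chars_mult:
  fixes F G :: "'d :: finite series \<Rightarrow> real"
  assumes "linear_on_chars n F" "linear_on_chars m G"
  shows "linear_on_chars (n + m) (\<lambda>g. F g * G g)"
proof -
  obtain c where c: "\<And>g. shuffle_char n g \<Longrightarrow> F g = (\<Sum>w | length w = n. c w * g w)"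
    using assms(1) unfolding linear_on_chars_def by blast
  obtain d where d: "\<And>g. shuffle_char m g \<Longrightarrow> G g = (\<Sum>w | length w = m. d w * g w)"
    using assms(2) unfolding linear_on_chars_def by blast
  have "linear_on_chars (n + m) (\<lambda>g. \<Sum>u | length u = n. \<Sum>v | length v = m. c u * d v * shs g u v)"
  proof (rule linear_on_chars_sum, rule linear_on_chars_sum, rule linear_on_chars_scale)
    fix u v :: "'d list" assume "u \<in> {u. length u = n}" "v \<in> {v. length v = m}"
    then show "linear_on_chars (n + m) (\<lambda>g. shs g u v)"
      unfolding linear_on_chars_def
      by (intro exI[of _ "\<lambda>w. shs (\<lambda>x. if x = w then 1 else 0) u v"] allI impI shs_expand) simp
  qed
  moreover have "F g * G g = (\<Sum>u | length u = n. \<Sum>v | length v = m. c u * d v * shs g u v)"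
    if g: "shuffle_char (n + m) g" for g
  proof -
    have "F g * G g = (\<Sum>u | length u = n. \<Sum>v | length v = m. (c u * g u) * (d v * g v))"
      using g by (simp add: c d shuffle_char_mono sum_product)
    also have "\<dots> = (\<Sum>u | length u = n. \<Sum>v | length v = m. c u * d v * shs g u v)"
      using g by (intro sum.cong refl) (simp add: shuffle_charD(2))
    finally show ?thesis .
  qed
  ultimately show ?thesis by (simp add: linear_on_chars_def)
qed

lemma linear_on_chars_spow:
  "linear_on_chars (length w) (\<lambda>g :: 'd :: finite series. spow (\<lambda>u. g u - sone u) k w)"
proof (induction k arbitrary: w)
  case 0
  show ?case
  proof (cases w)
    case Nil
    then show ?thesis
      unfolding linear_on_chars_def by (intro exI[of _ "\<lambda>_. 1"]) (simp add: shuffle_char_def)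
  qed (simp add: linear_on_chars_zero)
next
  case (Suc k)
  have diff: "linear_on_chars (length v) (\<lambda>g :: 'd series. g v - sone v)" for v
  proof (cases "v = []")
    case True
    then show ?thesis
      unfolding linear_on_chars_def by (intro exI[of _ "\<lambda>_. 0"]) (simp add: shuffle_char_def)
  qed (simp add: linear_on_chars_coeff)
  have "linear_on_chars (length w) (\<lambda>g :: 'd series. spow (\<lambda>u. g u - sone u) k (take i w) * (g (drop i w) - sone (drop i w)))"
    if "i \<le> length w" for i
    using linear_on_chars_mult[OF Suc[of "take i w"] diff[of "drop i w"]] that by simp
  then show ?case
    by (auto simp: concat_prod_def intro!: linear_on_chars_sum)
qed

lemma linear_on_chars_log: "linear_on_chars (length w) (\<lambda>g :: 'd :: finite series. series_log g w)"
  unfolding series_log_def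
  by (intro linear_on_chars_sum linear_on_chars_scale linear_on_chars_spow)

subsection \<open>Gaussian moments\<close>

text \<open>\<open>lborel\<close> is the image of a product measure indexed by basis vectors, so the
  factors are reindexed from coordinates to basis vectors.\<close>

lemma integrable_prod_coordinates:
  fixes f :: "'d :: finite \<Rightarrow> real \<Rightarrow> real"
  assumes "\<And>i. integrable lborel (f i)"
  shows "integrable lborel (\<lambda>x :: real ^ 'd. \<Prod>i\<in>UNIV. f i (x $ i))"
proof -
  interpret product_sigma_finite "\<lambda>_ :: real ^ 'd. lborel :: real measure" ..
  have inj: "inj (\<lambda>i. axis i (1 :: real) :: real ^ 'd)"
    by (auto simp: inj_on_def axis_eq_axis)
  have B: "(Basis :: (real ^ 'd) set) = range (\<lambda>i. axis i 1)"
    by (auto simp: Basis_vec_def)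
  have [measurable]: "f i \<in> borel_measurable borel" for i
    using assms[of i] by (auto dest: borel_measurable_integrable)
  define f' where "f' b = f (inv_into UNIV (\<lambda>i. axis i 1) b)" for b :: "real ^ 'd"
  have f': "f' (axis i 1) = f i" for i
    by (simp add: f'_def inv_f_f[OF inj])
  have "integrable (\<Pi>\<^sub>M b\<in>Basis. lborel) (\<lambda>g. \<Prod>b\<in>(Basis :: (real ^ 'd) set). f' b (g b))"
    by (rule product_integrable_prod) (auto simp: B f' assms)
  moreover have "(\<Prod>b\<in>(Basis :: (real ^ 'd) set). f' b (g b)) = (\<Prod>i\<in>UNIV. f i ((\<Sum>b\<in>Basis. g b *\<^sub>R b) $ i))" for g
  proof -
    have "(\<Sum>b\<in>(Basis :: (real ^ 'd) set). g b *\<^sub>R b) $ i = g (axis i 1)" for i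
    proof -
      have "(\<Sum>b\<in>(Basis :: (real ^ 'd) set). g b *\<^sub>R b) $ i = (\<Sum>j\<in>UNIV. g (axis j 1) * (axis j 1 :: real ^ 'd) $ i)"
        unfolding B by (subst sum.reindex[OF inj]) simp
      also have "\<dots> = (\<Sum>j\<in>UNIV. if j = i then g (axis i 1) else 0)"
        by (intro sum.cong) (auto simp: axis_def)
      finally show ?thesis by simp
    qed
    then show ?thesis
      unfolding B by (subst prod.reindex[OF inj]) (simp add: f')
  qed
  ultimately show ?thesis
    by (subst lborel_eq, subst integrable_distr_eq) simp_all
qed

definition word_monomial :: "real ^ 'd \<Rightarrow> 'd list \<Rightarrow> real" where
  "word_monomial x w = prod_list (map (\<lambda>a. x $ a) w)"

definition gaussian_moment :: "real ^ 'd ^ 'd \<Rightarrow> 'd :: finite list \<Rightarrow> real" where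
  "gaussian_moment R w =
     (\<integral>z. (\<Prod>i\<in>UNIV. std_normal_density (z $ i)) * word_monomial (R *v z) w \<partial>lborel)"

lemma word_monomial_scale: "word_monomial (c *\<^sub>R x) w = c ^ length w * word_monomial x w"
  by (induction w) (auto simp: word_monomial_def)

lemma borel_measurable_word_monomial [measurable]:
  "(\<lambda>x :: real ^ 'd :: finite. word_monomial x w) \<in> borel_measurable borel"
  by (induction w) (simp_all add: word_monomial_def)

lemma borel_measurable_matrix_vector [measurable]:
  "(\<lambda>x. R *v x) \<in> borel_measurable (borel :: (real ^ 'd :: finite) measure)"
  by (intro borel_measurable_continuous_onI matrix_vector_mult_linear_continuous_on)

text \<open>Integrability over the product measure calls for a dominating function that factors over
  the coordinates. The product \<open>P\<close> of all 1 + |z_i| does so and still bounds every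
  single coordinate.\<close>

lemma integrable_gaussian_word:
  fixes R :: "real ^ 'd :: finite ^ 'd"
  shows "integrable lborel (\<lambda>z. (\<Prod>i\<in>UNIV. std_normal_density (z $ i)) * word_monomial (R *v z) w)"
proof -
  define K where "K = (\<Sum>a\<in>UNIV. \<Sum>b\<in>UNIV. \<bar>R $ a $ b\<bar>)"
  define n where "n = length w"
  have K0: "0 \<le> K" by (auto simp: K_def intro!: sum_nonneg)
  define P where "P z = (\<Prod>i\<in>UNIV. 1 + \<bar>z $ i\<bar>)" for z :: "real ^ 'd"
  have P: "0 \<le> P z" for z by (auto simp: P_def intro!: prod_nonneg)
  have coord: "\<bar>(R *v z) $ a\<bar> \<le> K * P z" for z a
  proof -
    have zP: "\<bar>z $ b\<bar> \<le> P z" for b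
    proof -
      have "1 * (1 + \<bar>z $ b\<bar>) \<le> (\<Prod>i\<in>UNIV - {b}. 1 + \<bar>z $ i\<bar>) * (1 + \<bar>z $ b\<bar>)"
        by (intro mult_right_mono prod_ge_1) auto
      also have "\<dots> = P z" by (simp add: P_def prod.remove[of UNIV b] mult.commute)
      finally show ?thesis by simp
    qed
    have "\<bar>(R *v z) $ a\<bar> \<le> (\<Sum>b\<in>UNIV. \<bar>R $ a $ b\<bar> * \<bar>z $ b\<bar>)"
      unfolding matrix_vector_mult_def by (simp add: abs_mult[symmetric] sum_abs)
    also have "\<dots> \<le> (\<Sum>b\<in>UNIV. \<bar>R $ a $ b\<bar> * P z)"
      by (intro sum_mono mult_left_mono zP) auto
    also have "\<dots> = (\<Sum>b\<in>UNIV. \<bar>R $ a $ b\<bar>) * P z" by (simp add: sum_distrib_right)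
    also have "\<dots> \<le> K * P z"
      unfolding K_def by (intro mult_right_mono P member_le_sum) (auto intro!: sum_nonneg)
    finally show ?thesis .
  qed
  have mon: "\<bar>word_monomial (R *v z) w\<bar> \<le> (K * P z) ^ n" for z
    unfolding n_def
  proof (induction w)
    case (Cons a w)
    have "\<bar>word_monomial (R *v z) (a # w)\<bar> = \<bar>(R *v z) $ a\<bar> * \<bar>word_monomial (R *v z) w\<bar>"
      by (simp add: word_monomial_def abs_mult)
    also have "\<dots> \<le> (K * P z) * (K * P z) ^ length w"
      using K0 P by (intro mult_mono coord Cons) auto
    finally show ?case by simp
  qed (simp add: word_monomial_def)
  have int1: "integrable lborel (\<lambda>x. std_normal_density x * (1 + \<bar>x\<bar>) ^ n)"
  proof -
    have "integrable lborel (\<lambda>x. \<Sum>k\<le>n. real (n choose k) * (std_normal_density x * \<bar>x\<bar> ^ k))"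
      using integrable_normal_moment_abs[of 1 0] by (intro Bochner_Integration.integrable_sum integrable_mult_right) simp
    moreover have "(\<Sum>k\<le>n. real (n choose k) * (std_normal_density x * \<bar>x\<bar> ^ k)) = std_normal_density x * (1 + \<bar>x\<bar>) ^ n" for x
      using binomial_ring[of "\<bar>x\<bar>" 1 n] by (simp add: sum_distrib_left add.commute mult.left_commute)
    ultimately show ?thesis by simp
  qed
  have "integrable lborel (\<lambda>z :: real ^ 'd. K ^ n * (\<Prod>i\<in>UNIV. std_normal_density (z $ i) * (1 + \<bar>z $ i\<bar>) ^ n))"
    by (intro integrable_mult_right integrable_prod_coordinates int1)
  then show ?thesis
  proof (rule Bochner_Integration.integrable_bound)
    show "AE z in lborel. norm ((\<Prod>i\<in>UNIV. std_normal_density (z $ i)) * word_monomial (R *v z) w)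
      \<le> norm (K ^ n * (\<Prod>i\<in>UNIV. std_normal_density (z $ i) * (1 + \<bar>z $ i\<bar>) ^ n))"
    proof (rule AE_I2)
      fix z :: "real ^ 'd"
      let ?G = "\<Prod>i\<in>UNIV. std_normal_density (z $ i)"
      have G: "0 \<le> ?G" by (intro prod_nonneg) (simp add: normal_density_nonneg)
      have "norm (?G * word_monomial (R *v z) w) \<le> ?G * (K * P z) ^ n"
        using mon[of z] G by (simp add: abs_mult mult_left_mono)
      also have "\<dots> = K ^ n * (\<Prod>i\<in>UNIV. std_normal_density (z $ i) * (1 + \<bar>z $ i\<bar>) ^ n)"
        by (simp add: power_mult_distrib P_def prod_power_distrib prod.distrib)
      finally show "norm (?G * word_monomial (R *v z) w)
          \<le> norm (K ^ n * (\<Prod>i\<in>UNIV. std_normal_density (z $ i) * (1 + \<bar>z $ i\<bar>) ^ n))"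
        by simp
    qed
  qed measurable
qed

text \<open>The change of variables x = c z. Positive \<open>c\<close> gives Brownian scaling of
  moments, while \<open>c = -1\<close> gives the symmetry that removes the odd ones.\<close>

lemma gaussian_scale:
  fixes g :: "real ^ 'd :: finite \<Rightarrow> real"
  assumes c: "c \<noteq> 0" and g [measurable]: "g \<in> borel_measurable borel"
  shows "integrable lborel (\<lambda>x. (\<Prod>i\<in>UNIV. normal_density 0 \<bar>c\<bar> (x $ i)) * g x) \<longleftrightarrow>
           integrable lborel (\<lambda>z. (\<Prod>i\<in>UNIV. std_normal_density (z $ i)) * g (c *\<^sub>R z))" (is ?I)
    and "(\<integral>x. (\<Prod>i\<in>UNIV. normal_density 0 \<bar>c\<bar> (x $ i)) * g x \<partial>lborel) =
           (\<integral>z. (\<Prod>i\<in>UNIV. std_normal_density (z $ i)) * g (c *\<^sub>R z) \<partial>lborel)" (is ?E)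
proof -
  let ?f = "\<lambda>x :: real ^ 'd. (\<Prod>i\<in>UNIV. normal_density 0 \<bar>c\<bar> (x $ i)) * g x"
  have lb: "(lborel :: (real ^ 'd) measure) = density (distr lborel borel (\<lambda>x. c *\<^sub>R x)) (\<lambda>_. ennreal (\<bar>c\<bar> ^ CARD('d)))"
    using lborel_affine[OF c, of "0 :: real ^ 'd"] by (simp add: ennreal_power)
  have nd: "normal_density 0 \<bar>c\<bar> (c * y) = std_normal_density y / \<bar>c\<bar>" for y
    using c by (simp add: normal_density_def power_mult_distrib real_sqrt_mult)
  have eq: "\<bar>c\<bar> ^ CARD('d) * ?f (c *\<^sub>R z) = (\<Prod>i\<in>UNIV. std_normal_density (z $ i)) * g (c *\<^sub>R z)" for z
    using c by (simp add: nd prod_dividef)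
  have [measurable]: "?f \<in> borel_measurable borel" by measurable
  have "integrable lborel ?f \<longleftrightarrow> integrable (distr lborel borel (\<lambda>x. c *\<^sub>R x)) (\<lambda>x. \<bar>c\<bar> ^ CARD('d) * ?f x)"
    by (subst lb, subst integrable_density) simp_all
  also have "\<dots> \<longleftrightarrow> integrable lborel (\<lambda>z. \<bar>c\<bar> ^ CARD('d) * ?f (c *\<^sub>R z))"
    by (subst integrable_distr_eq) simp_all
  finally show ?I by (simp only: eq)
  have "(\<integral>x. ?f x \<partial>lborel) = (\<integral>x. \<bar>c\<bar> ^ CARD('d) * ?f x \<partial>distr lborel borel (\<lambda>x. c *\<^sub>R x))"
    by (subst lb, subst integral_density) simp_all
  also have "\<dots> = (\<integral>z. \<bar>c\<bar> ^ CARD('d) * ?f (c *\<^sub>R z) \<partial>lborel)"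
    by (subst integral_distr) simp_all
  finally show ?E by (simp only: eq)
qed

lemma gaussian_moment_odd:
  assumes "odd (length w)"
  shows "gaussian_moment R w = 0"
proof -
  have "gaussian_moment R w =
     (\<integral>z. (\<Prod>i\<in>UNIV. std_normal_density (z $ i)) * word_monomial (R *v ((-1) *\<^sub>R z)) w \<partial>lborel)"
    unfolding gaussian_moment_def
    using gaussian_scale(2)[of "-1" "\<lambda>z. word_monomial (R *v z) w"] by simp
  also have "\<dots> = - gaussian_moment R w"
    using assms unfolding matrix_vector_mult_scaleR word_monomial_scale
    by (simp add: gaussian_moment_def)
  finally show ?thesis by simp
qed

lemma (in prob_space) gaussian_increment_moment:
  fixes Z :: "'a \<Rightarrow> real ^ 'd :: finite"
  assumes Z: "distributed M lborel Z (\<lambda>x. ennreal (\<Prod>i\<in>UNIV. normal_density 0 s (x $ i)))" and s: "0 < s"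
  shows "integrable M (\<lambda>\<omega>. word_monomial (R *v Z \<omega>) w)"
    and "(\<integral>\<omega>. word_monomial (R *v Z \<omega>) w \<partial>M) = s ^ length w * gaussian_moment R w"
proof -
  let ?g = "\<lambda>x. word_monomial (R *v x) w"
  have nn: "0 \<le> (\<Prod>i\<in>UNIV. normal_density 0 s (x $ i))" for x :: "real ^ 'd"
    by (intro prod_nonneg) (simp add: normal_density_nonneg)
  have scale: "word_monomial (R *v (s *\<^sub>R z)) w = s ^ length w * word_monomial (R *v z) w" for z
    by (simp add: matrix_vector_mult_scaleR word_monomial_scale)
  have "integrable lborel (\<lambda>x. (\<Prod>i\<in>UNIV. normal_density 0 s (x $ i)) * ?g x)"
    using gaussian_scale(1)[of s ?g] s integrable_mult_right[OF integrable_gaussian_word[of R w], of "s ^ length w"]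
    by (simp add: scale mult.left_commute)
  then show "integrable M (\<lambda>\<omega>. word_monomial (R *v Z \<omega>) w)"
    using distributed_integrable[OF Z, of ?g] nn by simp
  have "(\<integral>\<omega>. word_monomial (R *v Z \<omega>) w \<partial>M) = (\<integral>x. (\<Prod>i\<in>UNIV. normal_density 0 s (x $ i)) * ?g x \<partial>lborel)"
    using distributed_integral[OF Z, of ?g] nn by simp
  also have "\<dots> = s ^ length w * gaussian_moment R w"
    using gaussian_scale(2)[of s ?g] s by (simp add: scale mult.left_commute gaussian_moment_def)
  finally show "(\<integral>\<omega>. word_monomial (R *v Z \<omega>) w \<partial>M) = s ^ length w * gaussian_moment R w" .
qed

subsection \<open>Signatures of dyadic interpolations\<close>

definition incr :: "(real \<Rightarrow> 'w \<Rightarrow> real ^ 'd) \<Rightarrow> nat \<Rightarrow> nat \<Rightarrow> 'w \<Rightarrow> real ^ 'd" where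
  "incr X n k \<omega> = X (real (Suc k) / 2 ^ n) \<omega> - X (real k / 2 ^ n) \<omega>"

text \<open>\<open>dyadic_sig X n j k\<close> is the signature of the piecewise linear interpolation of \<open>X\<close> with mesh
  \<open>2\<^sup>-\<^sup>n\<close> over the interval from \<open>j / 2 ^ n\<close> to \<open>(j + k) / 2 ^ n\<close>.\<close>

primrec dyadic_sig :: "(real \<Rightarrow> 'w \<Rightarrow> real ^ 'd) \<Rightarrow> nat \<Rightarrow> nat \<Rightarrow> nat \<Rightarrow> 'w \<Rightarrow> 'd series" where
  "dyadic_sig X n j 0 \<omega> = sone"
| "dyadic_sig X n j (Suc k) \<omega> = dyadic_sig X n j k \<omega> \<odot> texp (\<lambda>a. incr X n (j + k) \<omega> $ a)"

primrec dyadic_sig_inv :: "(real \<Rightarrow> 'w \<Rightarrow> real ^ 'd) \<Rightarrow> nat \<Rightarrow> nat \<Rightarrow> 'w \<Rightarrow> 'd series" where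
  "dyadic_sig_inv X n 0 \<omega> = sone"
| "dyadic_sig_inv X n (Suc k) \<omega> = texp (\<lambda>a. - (incr X n k \<omega> $ a)) \<odot> dyadic_sig_inv X n k \<omega>"

lemma shuffle_char_dyadic_sig: "shuffle_char L (dyadic_sig X n j k \<omega>)"
  by (induction k) (simp_all add: shuffle_char_sone shuffle_char_cprod shuffle_char_texp)

lemma shuffle_char_dyadic_sig_inv: "shuffle_char L (dyadic_sig_inv X n k \<omega>)"
  by (induction k) (simp_all add: shuffle_char_sone shuffle_char_cprod shuffle_char_texp)

lemma dyadic_sig_Nil [simp]: "dyadic_sig X n j k \<omega> [] = 1"
  by (induction k) simp_all

lemma dyadic_sig_inverse: "dyadic_sig X n 0 k \<omega> \<odot> dyadic_sig_inv X n k \<omega> = sone"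
proof (induction k)
  case (Suc k)
  let ?x = "\<lambda>a. incr X n k \<omega> $ a"
  have "dyadic_sig X n 0 (Suc k) \<omega> \<odot> dyadic_sig_inv X n (Suc k) \<omega> =
      dyadic_sig X n 0 k \<omega> \<odot> (texp ?x \<odot> texp (\<lambda>a. - ?x a)) \<odot> dyadic_sig_inv X n k \<omega>"
    by (simp add: cprod_assoc)
  then show ?case using Suc by (simp add: texp_inverse)
qed simp

lemma dyadic_sig_add: "dyadic_sig X n j (k + l) \<omega> = dyadic_sig X n j k \<omega> \<odot> dyadic_sig X n (j + k) l \<omega>"
  by (induction l) (simp_all add: cprod_assoc add.assoc)

lemma dyadic_sig_letter:
  "dyadic_sig X n j k \<omega> [a] = X (real (j + k) / 2 ^ n) \<omega> $ a - X (real j / 2 ^ n) \<omega> $ a"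
  by (induction k) (simp_all add: cprod_Cons incr_def)

text \<open>The expected signature of one linear step of duration \<epsilon>, where \<mu> gives the
  mixed moments of an increment over unit time. General \<epsilon> is allowed because rescaled
  blocks have steps of duration 1/k.\<close>

definition step_moment :: "('d list \<Rightarrow> real) \<Rightarrow> real \<Rightarrow> 'd series" where
  "step_moment \<mu> \<epsilon> w = sqrt \<epsilon> ^ length w * \<mu> w / fact (length w)"

text \<open>What is retained of the Gaussian law. \<open>\<mu>_odd\<close> makes a sign change of
  the increments invisible in expectation and removes odd moments of blocks;
  \<open>\<mu>_swap\<close> centres the Levy area.\<close>

locale brownian_increments = prob_space M for M :: "'w measure" +
  fixes X :: "real \<Rightarrow> 'w \<Rightarrow> real ^ 'd :: finite" and \<mu> :: "'d list \<Rightarrow> real"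
  assumes indep_incr: "indep_vars (\<lambda>_. borel) (incr X n) {..<2 ^ n}"
    and integrable_incr: "k < 2 ^ n \<Longrightarrow> integrable M (\<lambda>\<omega>. word_monomial (incr X n k \<omega>) w)"
    and moment_incr: "k < 2 ^ n \<Longrightarrow>
      expectation (\<lambda>\<omega>. word_monomial (incr X n k \<omega>) w) = sqrt (1 / 2 ^ n) ^ length w * \<mu> w"
    and \<mu>_Nil [simp]: "\<mu> [] = 1"
    and \<mu>_odd: "odd (length w) \<Longrightarrow> \<mu> w = 0"
    and \<mu>_swap: "\<mu> [a, b] = \<mu> [b, a]"
begin

text \<open>The sigma-algebra generated by the increments with index in \<open>A\<close>.
  Measurability with respect to it makes functionals of disjoint blocks independent.\<close>

definition incr_algebra :: "nat \<Rightarrow> nat set \<Rightarrow> 'w measure" where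
  "incr_algebra n A = vimage_algebra (space M) (\<lambda>\<omega>. restrict (\<lambda>k. incr X n k \<omega>) A) (Pi\<^sub>M A (\<lambda>_. borel))"

lemma space_incr_algebra [simp]: "space (incr_algebra n A) = space M"
  by (simp add: incr_algebra_def)

lemma measurable_incr_algebra: "k \<in> A \<Longrightarrow> incr X n k \<in> borel_measurable (incr_algebra n A)"
proof -
  assume k: "k \<in> A"
  have "(\<lambda>\<omega>. restrict (\<lambda>k. incr X n k \<omega>) A) \<in> incr_algebra n A \<rightarrow>\<^sub>M Pi\<^sub>M A (\<lambda>_. borel)"
    unfolding incr_algebra_def by (intro measurable_vimage_algebra1) (auto simp: space_PiM)
  from measurable_compose[OF this measurable_component_singleton[OF k]] show ?thesis
    using k by simp
qed

lemma indep_incr_algebra: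
  assumes AB: "A \<inter> B = {}" "A \<subseteq> {..<2 ^ n}" "B \<subseteq> {..<2 ^ n}"
    and Z: "Z \<in> borel_measurable (incr_algebra n A)" and Y: "Y \<in> borel_measurable (incr_algebra n B)"
    and int: "integrable M Z" "integrable M Y"
  shows "integrable M (\<lambda>\<omega>. Z \<omega> * Y \<omega> :: real)"
    and "expectation (\<lambda>\<omega>. Z \<omega> * Y \<omega>) = expectation Z * expectation Y"
proof -
  have sets: "sets (incr_algebra n C) = sigma_sets (space M)
     {(\<lambda>\<omega>. restrict (\<lambda>k. incr X n k \<omega>) C) -` S \<inter> space M | S. S \<in> sets (Pi\<^sub>M C (\<lambda>_. borel))}" for C
    unfolding incr_algebra_def by (rule sets_vimage_algebra)
  have ind: "indep_set (sets (incr_algebra n A)) (sets (incr_algebra n B))"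
    using indep_var_restrict[OF indep_incr AB] unfolding indep_var_eq sets by blast
  have sub: "sigma_sets (space M) {V -` S \<inter> space M | S. S \<in> sets borel} \<subseteq> sets (incr_algebra n C)"
    if "V \<in> borel_measurable (incr_algebra n C)" for V :: "'w \<Rightarrow> real" and C
    using sets.sigma_sets_subset[of "{V -` S \<inter> space M | S. S \<in> sets borel}" "incr_algebra n C"]
      measurable_sets[OF that] by auto
  have "indep_set (sigma_sets (space M) {Z -` S \<inter> space M | S. S \<in> sets borel})
          (sigma_sets (space M) {Y -` S \<inter> space M | S. S \<in> sets borel})"
    using ind sub[OF Z] sub[OF Y] unfolding indep_sets2_eq by blast
  then have "indep_var borel Z borel Y"
    using int by (simp add: indep_var_eq borel_measurable_integrable)
  then show "integrable M (\<lambda>\<omega>. Z \<omega> * Y \<omega>)"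
    and "expectation (\<lambda>\<omega>. Z \<omega> * Y \<omega>) = expectation Z * expectation Y"
    using int by (auto intro: indep_var_integrable indep_var_lebesgue_integral)
qed

lemma measurable_texp:
  assumes "k \<in> A"
  shows "(\<lambda>\<omega>. texp (\<lambda>a. incr X n k \<omega> $ a) w) \<in> borel_measurable (incr_algebra n A)"
    and "(\<lambda>\<omega>. texp (\<lambda>a. - (incr X n k \<omega> $ a)) w) \<in> borel_measurable (incr_algebra n A)"
proof -
  have [measurable]: "(\<lambda>\<omega>. incr X n k \<omega> $ a) \<in> borel_measurable (incr_algebra n A)" for a
    by (rule measurable_compose[OF measurable_incr_algebra[OF assms]]) measurable
  have "(\<lambda>\<omega>. prod_list (map (\<lambda>a. incr X n k \<omega> $ a) w)) \<in> borel_measurable (incr_algebra n A)"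
    "(\<lambda>\<omega>. prod_list (map (\<lambda>a. - (incr X n k \<omega> $ a)) w)) \<in> borel_measurable (incr_algebra n A)"
    by (induction w) (simp_all add: borel_measurable_times)
  then show "(\<lambda>\<omega>. texp (\<lambda>a. incr X n k \<omega> $ a) w) \<in> borel_measurable (incr_algebra n A)"
    and "(\<lambda>\<omega>. texp (\<lambda>a. - (incr X n k \<omega> $ a)) w) \<in> borel_measurable (incr_algebra n A)"
    by (simp_all add: texp_def)
qed

lemma measurable_dyadic_sig:
  assumes "{j..<j + k} \<subseteq> A"
  shows "(\<lambda>\<omega>. dyadic_sig X n j k \<omega> w) \<in> borel_measurable (incr_algebra n A)"
  using assms
proof (induction k arbitrary: w)
  case (Suc k)
  have [measurable]: "(\<lambda>\<omega>. dyadic_sig X n j k \<omega> v) \<in> borel_measurable (incr_algebra n A)" for v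
    using Suc.prems by (intro Suc.IH) (auto simp: subset_eq)
  have [measurable]: "(\<lambda>\<omega>. texp (\<lambda>a. incr X n (j + k) \<omega> $ a) v) \<in> borel_measurable (incr_algebra n A)" for v
    using Suc.prems by (intro measurable_texp) auto
  show ?case by (simp add: concat_prod_def)
qed simp

lemma measurable_dyadic_sig_inv:
  assumes "{..<k} \<subseteq> A"
  shows "(\<lambda>\<omega>. dyadic_sig_inv X n k \<omega> w) \<in> borel_measurable (incr_algebra n A)"
  using assms
proof (induction k arbitrary: w)
  case (Suc k)
  have [measurable]: "(\<lambda>\<omega>. dyadic_sig_inv X n k \<omega> v) \<in> borel_measurable (incr_algebra n A)" for v
    using Suc.prems by (intro Suc.IH) (auto simp: subset_eq)
  have [measurable]: "(\<lambda>\<omega>. texp (\<lambda>a. - (incr X n k \<omega> $ a)) v) \<in> borel_measurable (incr_algebra n A)" for v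
    using Suc.prems by (intro measurable_texp) auto
  show ?case by (simp add: concat_prod_def)
qed simp

abbreviation step_mean :: "nat \<Rightarrow> 'd series" where
  "step_mean n \<equiv> step_moment \<mu> (1 / 2 ^ n)"

lemma texp_moment:
  assumes "k < 2 ^ n"
  shows "integrable M (\<lambda>\<omega>. texp (\<lambda>a. incr X n k \<omega> $ a) w)"
    and "expectation (\<lambda>\<omega>. texp (\<lambda>a. incr X n k \<omega> $ a) w) = step_mean n w"
    and "integrable M (\<lambda>\<omega>. texp (\<lambda>a. - (incr X n k \<omega> $ a)) w)"
    and "expectation (\<lambda>\<omega>. texp (\<lambda>a. - (incr X n k \<omega> $ a)) w) = step_mean n w"
proof -
  have 1: "texp (\<lambda>a. x $ a) w = word_monomial x w / fact (length w)" for x :: "real ^ 'd"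
    by (simp add: texp_def word_monomial_def)
  have 2: "texp (\<lambda>a. - (x $ a)) w = (-1) ^ length w * (word_monomial x w / fact (length w))" for x :: "real ^ 'd"
    using word_monomial_scale[of "-1" x w] by (simp add: texp_def word_monomial_def)
  show "integrable M (\<lambda>\<omega>. texp (\<lambda>a. incr X n k \<omega> $ a) w)"
    and "integrable M (\<lambda>\<omega>. texp (\<lambda>a. - (incr X n k \<omega> $ a)) w)"
    unfolding 1 2 using integrable_incr[OF assms] by auto
  show "expectation (\<lambda>\<omega>. texp (\<lambda>a. incr X n k \<omega> $ a) w) = step_mean n w"
    unfolding 1 using moment_incr[OF assms] by (simp add: step_moment_def)
  show "expectation (\<lambda>\<omega>. texp (\<lambda>a. - (incr X n k \<omega> $ a)) w) = step_mean n w"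
    unfolding 2 using moment_incr[OF assms] \<mu>_odd[of w] by (cases "even (length w)") (simp_all add: step_moment_def)
qed

lemma dyadic_sig_moment:
  assumes "j + k \<le> 2 ^ n"
  shows "integrable M (\<lambda>\<omega>. dyadic_sig X n j k \<omega> w) \<and> expectation (\<lambda>\<omega>. dyadic_sig X n j k \<omega> w) = spow (step_mean n) k w"
  using assms
proof (induction k arbitrary: w)
  case 0
  then show ?case by (simp add: prob_space)
next
  case (Suc k)
  have sub: "{j..<j + k} \<subseteq> {..<2 ^ n}" using Suc.prems by auto
  have f: "integrable M (\<lambda>\<omega>. dyadic_sig X n j k \<omega> u * texp (\<lambda>a. incr X n (j + k) \<omega> $ a) v)
    \<and> expectation (\<lambda>\<omega>. dyadic_sig X n j k \<omega> u * texp (\<lambda>a. incr X n (j + k) \<omega> $ a) v) = spow (step_mean n) k u * step_mean n v" for u v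
    using indep_incr_algebra[of "{j..<j + k}" "{j + k}" n "\<lambda>\<omega>. dyadic_sig X n j k \<omega> u"
        "\<lambda>\<omega>. texp (\<lambda>a. incr X n (j + k) \<omega> $ a) v"]
      Suc sub measurable_dyadic_sig[OF order_refl, of n j k u] measurable_texp(1)[of "j + k" "{j + k}" n v] texp_moment[of "j + k" n v]
    by auto
  show ?case
    using f by (simp add: concat_prod_def)
qed

text \<open>Reversal is invisible after taking expectations: the factors are independent and share
  the mean \<open>step_mean n\<close>, whose powers commute with it. So the moments are those of
  \<open>dyadic_sig\<close>.\<close>

lemma dyadic_sig_inv_moment:
  assumes "k \<le> 2 ^ n"
  shows "integrable M (\<lambda>\<omega>. dyadic_sig_inv X n k \<omega> w) \<and> expectation (\<lambda>\<omega>. dyadic_sig_inv X n k \<omega> w) = spow (step_mean n) k w"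
  using assms
proof (induction k arbitrary: w)
  case 0
  then show ?case by (simp add: prob_space)
next
  case (Suc k)
  have f: "integrable M (\<lambda>\<omega>. texp (\<lambda>a. - (incr X n k \<omega> $ a)) u * dyadic_sig_inv X n k \<omega> v)
    \<and> expectation (\<lambda>\<omega>. texp (\<lambda>a. - (incr X n k \<omega> $ a)) u * dyadic_sig_inv X n k \<omega> v) = step_mean n u * spow (step_mean n) k v" for u v
    using indep_incr_algebra[of "{k}" "{..<k}" n 
        "\<lambda>\<omega>. texp (\<lambda>a. - (incr X n k \<omega> $ a)) u" "\<lambda>\<omega>. dyadic_sig_inv X n k \<omega> v"]
      Suc measurable_dyadic_sig_inv[OF order_refl, of n k v] measurable_texp(2)[of k "{k}" n u] texp_moment[of k n u]
    by auto
  have "integrable M (\<lambda>\<omega>. dyadic_sig_inv X n (Suc k) \<omega> w) \<and>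
     expectation (\<lambda>\<omega>. dyadic_sig_inv X n (Suc k) \<omega> w) = (step_mean n \<odot> spow (step_mean n) k) w"
    using f by (simp add: concat_prod_def)
  then show ?case by (simp add: spow_commute)
qed

text \<open>Every nonconstant coefficient of the step mean is of order 1/K: odd ones vanish and even
  ones carry at least one factor 1/K. One multiplication thus changes the coefficient of
  \<open>w\<close> by the order 1/K, given bounds for shorter words, and at most \<open>K\<close>
  multiplications change it by a bounded amount.\<close>

lemma spow_step_moment_bounded:
  "\<exists>C. \<forall>K k. 0 < K \<longrightarrow> k \<le> K \<longrightarrow> \<bar>spow (step_moment \<mu> (1 / real K)) k w\<bar> \<le> C"
proof (induction "length w" arbitrary: w rule: less_induct)
  case less
  have "\<forall>u\<in>{u. length u < length w}. \<exists>C. \<forall>K k. 0 < K \<longrightarrow> k \<le> K \<longrightarrow> \<bar>spow (step_moment \<mu> (1 / real K)) k u\<bar> \<le> C"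
    using less by simp
  then obtain C where C: "\<And>u K k. length u < length w \<Longrightarrow> 0 < K \<Longrightarrow> k \<le> K \<Longrightarrow> \<bar>spow (step_moment \<mu> (1 / real K)) k u\<bar> \<le> C u"
    unfolding bchoice_iff by auto
  define c where "c = (\<Sum>i<length w. C (take i w) * \<bar>\<mu> (drop i w)\<bar>)"
  have m1: "\<bar>step_moment \<mu> (1 / real K) v\<bar> \<le> \<bar>\<mu> v\<bar> / real K" if K: "0 < K" and v: "v \<noteq> []" for K v
  proof (cases "odd (length v)")
    case False
    then obtain l where l: "length v = 2 * Suc l"
      using v by (metis evenE length_0_conv mult_0_right not0_implies_Suc)
    have "sqrt (1 / real K) ^ length v = (1 / real K) ^ Suc l"
      unfolding l power_mult using K by simp
    also have "\<dots> \<le> 1 / real K"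
      using K power_le_one[of "1 / real K" l] by (simp add: divide_right_mono)
    finally have s: "sqrt (1 / real K) ^ length v \<le> 1 / real K" .
    have "\<bar>step_moment \<mu> (1 / real K) v\<bar> = sqrt (1 / real K) ^ length v * \<bar>\<mu> v\<bar> / fact (length v)"
      by (simp add: step_moment_def abs_mult)
    also have "\<dots> \<le> sqrt (1 / real K) ^ length v * \<bar>\<mu> v\<bar> / 1"
      by (intro divide_left_mono) (auto simp: fact_ge_1)
    also have "\<dots> \<le> (1 / real K) * \<bar>\<mu> v\<bar>"
      using mult_right_mono[OF s, of "\<bar>\<mu> v\<bar>"] by simp
    finally show ?thesis by simp
  qed (use K in \<open>simp add: step_moment_def \<mu>_odd\<close>)
  have "\<bar>spow (step_moment \<mu> (1 / real K)) k w\<bar> \<le> 1 + c * real k / real K" if "0 < K" "k \<le> K" for K k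
    using that(2)
  proof (induction k)
    case (Suc k)
    let ?m = "step_moment \<mu> (1 / real K)"
    have "\<bar>spow ?m (Suc k) w\<bar> \<le> (\<Sum>i<length w. \<bar>spow ?m k (take i w) * ?m (drop i w)\<bar>) + \<bar>spow ?m k w * ?m []\<bar>"
      unfolding spow.simps cprod_last by (rule order_trans[OF abs_triangle_ineq add_mono[OF sum_abs order_refl]])
    also have "?m [] = 1"
      by (simp add: step_moment_def)
    also have "\<bar>spow ?m k w * 1\<bar> \<le> 1 + c * real k / real K"
      using Suc by simp
    also have "(\<Sum>i<length w. \<bar>spow ?m k (take i w) * ?m (drop i w)\<bar>) \<le> (\<Sum>i<length w. C (take i w) * (\<bar>\<mu> (drop i w)\<bar> / real K))"
    proof (rule sum_mono)
      fix i assume "i \<in> {..<length w}"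
      then have i: "i < length w" by simp
      have "\<bar>spow ?m k (take i w)\<bar> \<le> C (take i w)"
        using i that Suc by (intro C) auto
      moreover have "\<bar>?m (drop i w)\<bar> \<le> \<bar>\<mu> (drop i w)\<bar> / real K"
        using i that by (intro m1) auto
      ultimately show "\<bar>spow ?m k (take i w) * ?m (drop i w)\<bar> \<le> C (take i w) * (\<bar>\<mu> (drop i w)\<bar> / real K)"
        unfolding abs_mult by (intro mult_mono) auto
    qed
    also have "\<dots> = c / real K"
      by (simp add: c_def sum_divide_distrib)
    finally show ?case by (simp add: add_divide_distrib distrib_left add.commute)
  qed (simp add: sone_def)
  moreover have "c * real k / real K \<le> \<bar>c\<bar>" if "0 < K" "k \<le> K" for K k
  proof -
    have "c * real k / real K \<le> \<bar>c\<bar> * (real k / real K)"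
      using that by (simp add: divide_right_mono mult_right_mono)
    also have "\<dots> \<le> \<bar>c\<bar> * 1" using that by (intro mult_left_mono) auto
    finally show ?thesis by simp
  qed
  ultimately have "\<forall>K k. 0 < K \<longrightarrow> k \<le> K \<longrightarrow> \<bar>spow (step_moment \<mu> (1 / real K)) k w\<bar> \<le> 1 + \<bar>c\<bar>"
    by (smt (verit, best))
  then show ?case by blast
qed

text \<open>Brownian scaling: a block of \<open>k\<close> fine steps is a unit-time block of
  \<open>k\<close> steps of duration 1/k, dilated by the square root of its true duration.\<close>

lemma spow_step_moment_scale:
  assumes "0 < k"
  shows "spow (step_mean n) k w = sqrt (real k / 2 ^ n) ^ length w * spow (step_moment \<mu> (1 / real k)) k w"
proof -
  have "step_mean n = (\<lambda>v. sqrt (real k / 2 ^ n) ^ length v * step_moment \<mu> (1 / real k) v)"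
    using assms by (simp add: fun_eq_iff step_moment_def real_sqrt_divide power_divide)
  then show ?thesis by (simp only: spow_homogeneous)
qed

lemma spow_step_moment_odd:
  assumes "odd (length w)"
  shows "spow (step_moment \<mu> \<epsilon>) k w = 0"
proof -
  have "step_moment \<mu> \<epsilon> = (\<lambda>v. (-1) ^ length v * step_moment \<mu> \<epsilon> v)"
  proof
    fix v show "step_moment \<mu> \<epsilon> v = (-1) ^ length v * step_moment \<mu> \<epsilon> v"
      using \<mu>_odd[of v] by (cases "even (length v)") (simp_all add: step_moment_def)
  qed
  from arg_cong[OF this, of "\<lambda>x. spow x k w"] show ?thesis
    using assms by (simp add: spow_homogeneous)
qed

text \<open>As first moments vanish, no cross terms arise in degree two, and the symmetric
  contributions of the steps simply add up.\<close>

lemma spow_step_moment_swap: "spow (step_moment \<mu> \<epsilon>) k [a, b] = spow (step_moment \<mu> \<epsilon>) k [b, a]"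
proof (induction k)
  case (Suc k)
  then show ?case
    using \<mu>_odd[of "[a]"] \<mu>_odd[of "[b]"] \<mu>_swap[of a b] by (simp add: cprod_Cons step_moment_def)
qed (simp add: sone_def)

text \<open>A functional of weight \<open>r\<close> has expectation of order the r/2-th power of the
  duration of the block, with a constant that depends neither on the mesh nor on the
  position.\<close>

lemma char_moment_bound:
  assumes "linear_on_chars r F"
  shows "\<exists>C\<ge>0. \<forall>n j k. j + k \<le> 2 ^ n \<longrightarrow>
    integrable M (\<lambda>\<omega>. F (dyadic_sig X n j k \<omega>)) \<and>
    \<bar>expectation (\<lambda>\<omega>. F (dyadic_sig X n j k \<omega>))\<bar> \<le> C * sqrt (real k / 2 ^ n) ^ r \<and>
    (odd r \<longrightarrow> expectation (\<lambda>\<omega>. F (dyadic_sig X n j k \<omega>)) = 0)"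
proof -
  obtain c where c: "\<And>g. shuffle_char r g \<Longrightarrow> F g = (\<Sum>w | length w = r. c w * g w)"
    using assms unfolding linear_on_chars_def by blast
  have F: "F (dyadic_sig X n j k \<omega>) = (\<Sum>w | length w = r. c w * dyadic_sig X n j k \<omega> w)" for n j k \<omega>
    by (intro c shuffle_char_dyadic_sig)
  have "\<forall>w. \<exists>C. \<forall>K k. 0 < K \<longrightarrow> k \<le> K \<longrightarrow> \<bar>spow (step_moment \<mu> (1 / real K)) k w\<bar> \<le> C"
    using spow_step_moment_bounded by blast
  then obtain C where C: "\<And>w K k. 0 < K \<Longrightarrow> k \<le> K \<Longrightarrow> \<bar>spow (step_moment \<mu> (1 / real K)) k w\<bar> \<le> C w"
    unfolding choice_iff by blast
  have C0: "0 \<le> C w" for w using C[of 1 0 w] by linarith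
  \<comment> \<open>The summand 1 leaves room for the empty word in an empty block, where the
    coefficient is 1.\<close>
  have bd: "\<bar>spow (step_mean n) k w\<bar> \<le> (1 + C w) * sqrt (real k / 2 ^ n) ^ length w" for n k w
  proof (cases "k = 0")
    case True
    then show ?thesis using C0[of w] by (cases w) auto
  next
    case False
    have "\<bar>spow (step_mean n) k w\<bar> = sqrt (real k / 2 ^ n) ^ length w * \<bar>spow (step_moment \<mu> (1 / real k)) k w\<bar>"
      using False spow_step_moment_scale[of k n w] by (simp add: abs_mult)
    also have "\<dots> \<le> sqrt (real k / 2 ^ n) ^ length w * (1 + C w)"
      using False C[of k k w] by (intro mult_left_mono) auto
    finally show ?thesis by (simp add: mult.commute)
  qed
  define D where "D = (\<Sum>w | length w = r. \<bar>c w\<bar> * (1 + C w))"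
  have D0: "0 \<le> D" unfolding D_def using C0 by (intro sum_nonneg mult_nonneg_nonneg add_nonneg_nonneg) auto
  show ?thesis
  proof (intro exI[of _ D] conjI D0 allI impI)
    fix n j k :: nat assume jk: "j + k \<le> 2 ^ n"
    note mom = dyadic_sig_moment[OF jk]
    show "integrable M (\<lambda>\<omega>. F (dyadic_sig X n j k \<omega>))"
      unfolding F using mom by (intro Bochner_Integration.integrable_sum integrable_mult_right) auto
    have E: "expectation (\<lambda>\<omega>. F (dyadic_sig X n j k \<omega>)) = (\<Sum>w | length w = r. c w * spow (step_mean n) k w)"
      unfolding F using mom by (subst Bochner_Integration.integral_sum) auto
    show "expectation (\<lambda>\<omega>. F (dyadic_sig X n j k \<omega>)) = 0" if "odd r"
      unfolding E using that by (intro sum.neutral) (auto simp: spow_step_moment_odd)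
    have "\<bar>expectation (\<lambda>\<omega>. F (dyadic_sig X n j k \<omega>))\<bar> \<le> (\<Sum>w | length w = r. \<bar>c w * spow (step_mean n) k w\<bar>)"
      unfolding E by (rule sum_abs)
    also have "\<dots> \<le> (\<Sum>w | length w = r. (\<bar>c w\<bar> * (1 + C w)) * sqrt (real k / 2 ^ n) ^ r)"
    proof (rule sum_mono)
      fix w :: "'d list" assume "w \<in> {w. length w = r}"
      then have "\<bar>spow (step_mean n) k w\<bar> \<le> (1 + C w) * sqrt (real k / 2 ^ n) ^ r" using bd[of n k w] by simp
      from mult_left_mono[OF this, of "\<bar>c w\<bar>"]
      show "\<bar>c w * spow (step_mean n) k w\<bar> \<le> \<bar>c w\<bar> * (1 + C w) * sqrt (real k / 2 ^ n) ^ r"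
        by (simp add: abs_mult mult.assoc)
    qed
    also have "\<dots> = D * sqrt (real k / 2 ^ n) ^ r"
      by (simp add: D_def sum_distrib_right)
    finally show "\<bar>expectation (\<lambda>\<omega>. F (dyadic_sig X n j k \<omega>))\<bar> \<le> D * sqrt (real k / 2 ^ n) ^ r" .
  qed
qed

subsection \<open>The trapezoidal error\<close>

text \<open>\<open>local_error w a\<close> is the error of one trapezoidal step for the iterated integral of \<open>w a\<close>.\<close>

definition local_error :: "'d list \<Rightarrow> 'd \<Rightarrow> 'd series \<Rightarrow> real" where
  "local_error w a g = g (w @ [a]) - (g w + sone w) / 2 * g [a]"

lemma linear_on_chars_local_error:
  assumes "w \<noteq> []"
  shows "linear_on_chars (length w + 1) (local_error w a)"
proof -
  have "linear_on_chars (length w + 1) (\<lambda>g. g (w @ [a]) + (- 1 / 2) * (g w * g [a]))"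
    using linear_on_chars_coeff[of "w @ [a]"] linear_on_chars_mult[OF linear_on_chars_coeff[of w] linear_on_chars_coeff[of "[a]"]]
    by (intro linear_on_chars_add linear_on_chars_scale) simp_all
  moreover have "local_error w a = (\<lambda>g. g (w @ [a]) + (- 1 / 2) * (g w * g [a]))"
    using assms by (simp add: local_error_def fun_eq_iff)
  ultimately show ?thesis by simp
qed

lemma sqrt_power_le:
  assumes "0 \<le> x" "x \<le> 1" "4 \<le> r"
  shows "sqrt x ^ r \<le> x ^ 2"
proof -
  have "sqrt x ^ r \<le> sqrt x ^ 4"
    using assms by (intro power_decreasing) auto
  also have "\<dots> = ((sqrt x)^2)^2" by simp
  also have "\<dots> = x ^ 2" using assms by simp
  finally show ?thesis .
qed

lemma block_le_1: "j + k \<le> 2 ^ n \<Longrightarrow> real k / 2 ^ n \<le> 1"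
  using of_nat_mono[of k "2 ^ n", where 'a = real] by simp

text \<open>The Levy area of a block is centred and third moments vanish, so the local error has mean of second order.\<close>

lemma local_error_mean:
  "\<exists>C\<ge>0. \<forall>n j k. j + k \<le> 2 ^ n \<longrightarrow>
     integrable M (\<lambda>\<omega>. local_error w a (dyadic_sig X n j k \<omega>)) \<and>
     \<bar>expectation (\<lambda>\<omega>. local_error w a (dyadic_sig X n j k \<omega>))\<bar> \<le> C * (real k / 2 ^ n) ^ 2"
proof -
  \<comment> \<open>For the empty word the trapezoidal step is exact. For one letter the error is
    the Levy area. For two letters its weight three is odd, and from three letters on its weight is
    at least four, which is already quadratic in the duration.\<close>
  consider "w = []" | b where "w = [b]" | "length w = 2" | "3 \<le> length w"
    by (cases w rule: list.exhaust; cases "tl w") (auto simp: numeral_eq_Suc Suc_le_eq)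
  then show ?thesis
  proof cases
    case 1
    then show ?thesis by (intro exI[of _ 0]) (simp add: local_error_def)
  next
    case (2 b)
    have "integrable M (\<lambda>\<omega>. local_error w a (dyadic_sig X n j k \<omega>)) \<and>
       expectation (\<lambda>\<omega>. local_error w a (dyadic_sig X n j k \<omega>)) = 0" if jk: "j + k \<le> 2 ^ n" for n j k
    proof -
      have eq: "local_error w a (dyadic_sig X n j k \<omega>) = (dyadic_sig X n j k \<omega> [b, a] - dyadic_sig X n j k \<omega> [a, b]) / 2" for \<omega>
        using shuffle_charD(2)[OF shuffle_char_dyadic_sig[of 2 X n j k \<omega>], of "[b]" "[a]"]
        by (simp add: local_error_def 2 field_simps)
      show ?thesis
        unfolding eq using dyadic_sig_moment[OF jk] by (simp add: spow_step_moment_swap[of _ _ b a])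
    qed
    then show ?thesis by (intro exI[of _ 0]) simp
  next
    case 3
    then have "w \<noteq> []" "odd (length w + 1)" by auto
    then show ?thesis
      using char_moment_bound[OF linear_on_chars_local_error[of w a]] by (intro exI[of _ 0]) auto
  next
    case 4
    then have "w \<noteq> []" by auto
    from char_moment_bound[OF linear_on_chars_local_error[OF this, of a]] obtain C where "0 \<le> C"
      and C: "\<And>n j k. j + k \<le> 2 ^ n \<Longrightarrow> integrable M (\<lambda>\<omega>. local_error w a (dyadic_sig X n j k \<omega>)) \<and>
       \<bar>expectation (\<lambda>\<omega>. local_error w a (dyadic_sig X n j k \<omega>))\<bar> \<le> C * sqrt (real k / 2 ^ n) ^ (length w + 1)"
      by blast
    have "C * sqrt (real k / 2 ^ n) ^ (length w + 1) \<le> C * (real k / 2 ^ n) ^ 2" if "j + k \<le> 2 ^ n" for n j k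
      using that 4 \<open>0 \<le> C\<close> by (intro mult_left_mono sqrt_power_le block_le_1) auto
    with C \<open>0 \<le> C\<close> show ?thesis by (meson order_trans)
  qed
qed

text \<open>A nonzero local error has weight at least two, so a product of two has weight at least
  four and its mean is quadratic in the duration.\<close>

lemma local_error_second_moment:
  "\<exists>C\<ge>0. \<forall>n j k. j + k \<le> 2 ^ n \<longrightarrow>
     integrable M (\<lambda>\<omega>. local_error u a (dyadic_sig X n j k \<omega>) * local_error v a (dyadic_sig X n j k \<omega>)) \<and>
     \<bar>expectation (\<lambda>\<omega>. local_error u a (dyadic_sig X n j k \<omega>) * local_error v a (dyadic_sig X n j k \<omega>))\<bar>
       \<le> C * (real k / 2 ^ n) ^ 2"
proof (cases "u = [] \<or> v = []")
  case True
  then show ?thesis by (intro exI[of _ 0]) (auto simp: local_error_def)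
next
  case False
  then have uv: "u \<noteq> []" "v \<noteq> []" by auto
  then have len: "4 \<le> (length u + 1) + (length v + 1)"
    by (cases u; cases v) auto
  from char_moment_bound[OF linear_on_chars_mult[OF linear_on_chars_local_error[OF uv(1), of a] linear_on_chars_local_error[OF uv(2), of a]]]
  obtain C where "0 \<le> C"
    and C: "\<And>n j k. j + k \<le> 2 ^ n \<Longrightarrow>
     integrable M (\<lambda>\<omega>. local_error u a (dyadic_sig X n j k \<omega>) * local_error v a (dyadic_sig X n j k \<omega>)) \<and>
     \<bar>expectation (\<lambda>\<omega>. local_error u a (dyadic_sig X n j k \<omega>) * local_error v a (dyadic_sig X n j k \<omega>))\<bar>
       \<le> C * sqrt (real k / 2 ^ n) ^ ((length u + 1) + (length v + 1))"
    by blast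
  have "C * sqrt (real k / 2 ^ n) ^ ((length u + 1) + (length v + 1)) \<le> C * (real k / 2 ^ n) ^ 2" if "j + k \<le> 2 ^ n" for n j k
    using that len \<open>0 \<le> C\<close> by (intro mult_left_mono sqrt_power_le block_le_1) auto
  with C \<open>0 \<le> C\<close> show ?thesis by (meson order_trans)
qed

lemma dyadic_sig_second_moment:
  "\<exists>C\<ge>0. \<forall>n j k. j + k \<le> 2 ^ n \<longrightarrow>
     integrable M (\<lambda>\<omega>. dyadic_sig X n j k \<omega> u * dyadic_sig X n j k \<omega> v) \<and>
     \<bar>expectation (\<lambda>\<omega>. dyadic_sig X n j k \<omega> u * dyadic_sig X n j k \<omega> v)\<bar> \<le> C"
proof -
  from char_moment_bound[OF linear_on_chars_mult[OF linear_on_chars_coeff[of u] linear_on_chars_coeff[of v]]]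
  obtain C where "0 \<le> C"
    and C: "\<And>n j k. j + k \<le> 2 ^ n \<Longrightarrow>
     integrable M (\<lambda>\<omega>. dyadic_sig X n j k \<omega> u * dyadic_sig X n j k \<omega> v) \<and>
     \<bar>expectation (\<lambda>\<omega>. dyadic_sig X n j k \<omega> u * dyadic_sig X n j k \<omega> v)\<bar> \<le> C * sqrt (real k / 2 ^ n) ^ (length u + length v)"
    by blast
  have "C * sqrt (real k / 2 ^ n) ^ (length u + length v) \<le> C" if "j + k \<le> 2 ^ n" for n j k
    using block_le_1[OF that] \<open>0 \<le> C\<close> mult_left_mono[OF power_le_one, of "sqrt (real k / 2 ^ n)" C] by simp
  with C \<open>0 \<le> C\<close> show ?thesis by (meson order_trans)
qed

section \<open>Global error over blocks of fine steps\<close>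

definition dyadic_trapezoid :: "nat \<Rightarrow> nat \<Rightarrow> 'd list \<Rightarrow> 'd \<Rightarrow> nat \<Rightarrow> 'w \<Rightarrow> real" where
  "dyadic_trapezoid n K w a i \<omega> =
     (\<Sum>b<i. (dyadic_sig X n 0 (b * K) \<omega> w + dyadic_sig X n 0 (Suc b * K) \<omega> w) / 2 * dyadic_sig X n (b * K) K \<omega> [a])"

text \<open>Chen's identity splits the new signature into past and block. The added error is then
  bilinear: coefficients of the past, times local errors that depend on the new block alone and are
  independent of it.\<close>

lemma trapezoid_error_step:
  "dyadic_sig X n 0 (Suc i * K) \<omega> (w @ [a]) - dyadic_trapezoid n K w a (Suc i) \<omega> =
     dyadic_sig X n 0 (i * K) \<omega> (w @ [a]) - dyadic_trapezoid n K w a i \<omega> +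
     (\<Sum>l\<le>length w. dyadic_sig X n 0 (i * K) \<omega> (take l w) * local_error (drop l w) a (dyadic_sig X n (i * K) K \<omega>))"
proof -
  let ?A = "dyadic_sig X n 0 (i * K) \<omega>" and ?B = "dyadic_sig X n (i * K) K \<omega>"
  have S: "dyadic_sig X n 0 (Suc i * K) \<omega> = ?A \<odot> ?B"
    using dyadic_sig_add[of X n 0 "i * K" K \<omega>] by (simp add: add.commute)
  have "(?A \<odot> ?B) (w @ [a]) = (\<Sum>l\<le>length w. ?A (take l w) * ?B (drop l w @ [a])) + ?A (w @ [a])"
    unfolding concat_prod_def by simp
  \<comment> \<open>The value at the left end point is expanded along the same splittings as the
    value at the right one; this is the origin of \<open>sone\<close> in
    \<open>local_error\<close>.\<close>
  moreover have "?A w = (\<Sum>l\<le>length w. ?A (take l w) * sone (drop l w))"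
    using fun_cong[OF cprod_sone[of ?A], of w] by (simp add: concat_prod_def)
  then have "?A w + (?A \<odot> ?B) w = (\<Sum>l\<le>length w. ?A (take l w) * (?B (drop l w) + sone (drop l w)))"
    by (simp add: concat_prod_def distrib_left sum.distrib add.commute)
  then have "(?A w + (?A \<odot> ?B) w) / 2 * ?B [a] = (\<Sum>l\<le>length w. ?A (take l w) * ((?B (drop l w) + sone (drop l w)) / 2 * ?B [a]))"
    by (simp add: sum_divide_distrib sum_distrib_right mult.assoc)
  moreover have "dyadic_trapezoid n K w a (Suc i) \<omega> = dyadic_trapezoid n K w a i \<omega> + (?A w + (?A \<odot> ?B) w) / 2 * ?B [a]"
    by (simp only: dyadic_trapezoid_def sum.lessThan_Suc S)
  moreover have "(\<Sum>l\<le>length w. ?A (take l w) * local_error (drop l w) a ?B) =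
     (\<Sum>l\<le>length w. ?A (take l w) * ?B (drop l w @ [a])) -
     (\<Sum>l\<le>length w. ?A (take l w) * ((?B (drop l w) + sone (drop l w)) / 2 * ?B [a]))"
    by (simp only: local_error_def right_diff_distrib sum_subtractf)
  ultimately show ?thesis
    unfolding S by linarith
qed

lemma integrable_mult_of_squares:
  assumes "integrable M (\<lambda>\<omega>. f \<omega> ^ 2)" "integrable M (\<lambda>\<omega>. g \<omega> ^ 2)"
    and [measurable]: "f \<in> borel_measurable M" "g \<in> borel_measurable M"
  shows "integrable M (\<lambda>\<omega>. f \<omega> * g \<omega> :: real)"
    and "\<bar>expectation (\<lambda>\<omega>. f \<omega> * g \<omega>)\<bar> \<le> expectation (\<lambda>\<omega>. f \<omega> ^ 2) + expectation (\<lambda>\<omega>. g \<omega> ^ 2)"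
proof -
  have le: "\<bar>x * y\<bar> \<le> x ^ 2 + y ^ 2" for x y :: real
  proof -
    have "0 \<le> (\<bar>x\<bar> - \<bar>y\<bar>) ^ 2" by simp
    then have "2 * \<bar>x * y\<bar> \<le> x ^ 2 + y ^ 2" by (simp add: power2_diff abs_mult)
    then show ?thesis using abs_ge_zero[of "x * y"] by linarith
  qed
  show int: "integrable M (\<lambda>\<omega>. f \<omega> * g \<omega>)"
    by (rule Bochner_Integration.integrable_bound[OF Bochner_Integration.integrable_add[OF assms(1,2)]])
       (use le in \<open>auto intro: order_trans\<close>)
  have "\<bar>expectation (\<lambda>\<omega>. f \<omega> * g \<omega>)\<bar> \<le> expectation (\<lambda>\<omega>. \<bar>f \<omega> * g \<omega>\<bar>)"
    by (rule integral_abs_bound)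
  also have "\<dots> \<le> expectation (\<lambda>\<omega>. f \<omega> ^ 2 + g \<omega> ^ 2)"
    using assms int by (intro integral_mono) (auto intro: le)
  finally show "\<bar>expectation (\<lambda>\<omega>. f \<omega> * g \<omega>)\<bar> \<le> expectation (\<lambda>\<omega>. f \<omega> ^ 2) + expectation (\<lambda>\<omega>. g \<omega> ^ 2)"
    using assms by simp
qed

lemma measurable_from_incr_algebra:
  assumes "A \<subseteq> {..<2 ^ n}" "Z \<in> borel_measurable (incr_algebra n A)"
  shows "(Z :: 'w \<Rightarrow> real) \<in> borel_measurable M"
proof -
  have "(\<lambda>\<omega>. restrict (\<lambda>k. incr X n k \<omega>) A) \<in> M \<rightarrow>\<^sub>M Pi\<^sub>M A (\<lambda>_. borel)"
    using indep_incr[of n] assms(1) unfolding indep_vars_def by (intro measurable_restrict) auto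
  then have "sets (incr_algebra n A) \<subseteq> sets M"
    unfolding incr_algebra_def by (subst sets_vimage_algebra2) (auto simp: measurable_sets space_PiM)
  then show ?thesis
    using assms(2) unfolding measurable_def by auto
qed

text \<open>Discrete Gronwall: for a block of duration s, the squared error plus 1 grows at most by
  the factor 1 + c s^2 per block. As at most 1/s blocks fit into the unit interval, the product
  stays below exp(c s). Adding 1 absorbs the inhomogeneous part of the recursion.\<close>

lemma trapezoid_error:
  "\<exists>c\<ge>0. \<forall>n K i. i * K \<le> 2 ^ n \<longrightarrow>
     integrable M (\<lambda>\<omega>. (dyadic_sig X n 0 (i * K) \<omega> (w @ [a]) - dyadic_trapezoid n K w a i \<omega>) ^ 2) \<and>
     expectation (\<lambda>\<omega>. (dyadic_sig X n 0 (i * K) \<omega> (w @ [a]) - dyadic_trapezoid n K w a i \<omega>) ^ 2)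
       \<le> exp (c * (real K / 2 ^ n)) - 1"
proof -
  obtain Ca where Ca0: "\<And>v. 0 \<le> Ca v" and Ca: "\<And>v n j k. j + k \<le> 2 ^ n \<Longrightarrow>
     integrable M (\<lambda>\<omega>. local_error v a (dyadic_sig X n j k \<omega>)) \<and>
     \<bar>expectation (\<lambda>\<omega>. local_error v a (dyadic_sig X n j k \<omega>))\<bar> \<le> Ca v * (real k / 2 ^ n) ^ 2"
    using local_error_mean[of _ a] by metis
  define Pb where "Pb u v C \<longleftrightarrow> (\<forall>n j k. j + k \<le> 2 ^ n \<longrightarrow>
     integrable M (\<lambda>\<omega>. local_error u a (dyadic_sig X n j k \<omega>) * local_error v a (dyadic_sig X n j k \<omega>)) \<and>
     \<bar>expectation (\<lambda>\<omega>. local_error u a (dyadic_sig X n j k \<omega>) * local_error v a (dyadic_sig X n j k \<omega>))\<bar>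
       \<le> C * (real k / 2 ^ n) ^ 2)" for u v C
  have "\<exists>C\<ge>0. Pb u v C" for u v
    unfolding Pb_def by (rule local_error_second_moment)
  then obtain Cb where Cb0: "\<And>u v. 0 \<le> Cb u v" and "\<And>u v. Pb u v (Cb u v)"
    by metis
  then have Cb: "\<And>u v n j k. j + k \<le> 2 ^ n \<Longrightarrow>
     integrable M (\<lambda>\<omega>. local_error u a (dyadic_sig X n j k \<omega>) * local_error v a (dyadic_sig X n j k \<omega>)) \<and>
     \<bar>expectation (\<lambda>\<omega>. local_error u a (dyadic_sig X n j k \<omega>) * local_error v a (dyadic_sig X n j k \<omega>))\<bar>
       \<le> Cb u v * (real k / 2 ^ n) ^ 2"
    unfolding Pb_def by blast
  define Pc where "Pc u v C \<longleftrightarrow> (\<forall>n j k. j + k \<le> 2 ^ n \<longrightarrow>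
     integrable M (\<lambda>\<omega>. dyadic_sig X n j k \<omega> u * dyadic_sig X n j k \<omega> v) \<and>
     \<bar>expectation (\<lambda>\<omega>. dyadic_sig X n j k \<omega> u * dyadic_sig X n j k \<omega> v)\<bar> \<le> C)" for u v C
  have "\<exists>C\<ge>0. Pc u v C" for u v
    unfolding Pc_def by (rule dyadic_sig_second_moment)
  then obtain Cc where Cc0: "\<And>u v. 0 \<le> Cc u v" and "\<And>u v. Pc u v (Cc u v)"
    by metis
  then have Cc: "\<And>u v n j k. j + k \<le> 2 ^ n \<Longrightarrow>
     integrable M (\<lambda>\<omega>. dyadic_sig X n j k \<omega> u * dyadic_sig X n j k \<omega> v) \<and>
     \<bar>expectation (\<lambda>\<omega>. dyadic_sig X n j k \<omega> u * dyadic_sig X n j k \<omega> v)\<bar> \<le> Cc u v"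
    unfolding Pc_def by blast
  let ?t = "\<lambda>l. take l w" and ?d = "\<lambda>l. drop l w" and ?I = "{..length w}"
  \<comment> \<open>\<open>c1\<close> controls the cross term between the old error and the new
    local errors, \<open>c2\<close> the square of the new contribution.\<close>
  define c1 where "c1 = (\<Sum>l\<in>?I. (1 + Cc (?t l) (?t l)) * Ca (?d l))"
  define c2 where "c2 = (\<Sum>l\<in>?I. \<Sum>l'\<in>?I. Cc (?t l) (?t l') * Cb (?d l) (?d l'))"
  define c where "c = 2 * c1 + c2"
  have c1: "0 \<le> c1" unfolding c1_def using Ca0 Cc0 by (intro sum_nonneg mult_nonneg_nonneg) (auto intro: add_nonneg_nonneg)
  have c2: "0 \<le> c2" unfolding c2_def using Cb0 Cc0 by (intro sum_nonneg mult_nonneg_nonneg) auto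
  have c0: "0 \<le> c" using c1 c2 by (simp add: c_def)
  have main: "integrable M (\<lambda>\<omega>. (dyadic_sig X n 0 (i * K) \<omega> (w @ [a]) - dyadic_trapezoid n K w a i \<omega>) ^ 2) \<and>
     expectation (\<lambda>\<omega>. (dyadic_sig X n 0 (i * K) \<omega> (w @ [a]) - dyadic_trapezoid n K w a i \<omega>) ^ 2) + 1
       \<le> (1 + c * (real K / 2 ^ n) ^ 2) ^ i" if "i * K \<le> 2 ^ n" for n K i
    using that
  proof (induction i)
    case (Suc i)
    define D where "D i \<omega> = dyadic_sig X n 0 (i * K) \<omega> (w @ [a]) - dyadic_trapezoid n K w a i \<omega>" for i \<omega>
    define A where "A l \<omega> = dyadic_sig X n 0 (i * K) \<omega> (?t l)" for l \<omega>
    define r where "r l \<omega> = local_error (?d l) a (dyadic_sig X n (i * K) K \<omega>)" for l \<omega>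
    define \<delta> where "\<delta> = (real K / 2 ^ n) ^ 2"
    define d where "d = expectation (\<lambda>\<omega>. (D i \<omega>) ^ 2)"
    let ?F = "{..<i * K}" and ?G = "{i * K..<i * K + K}"
    have iK: "i * K + K \<le> 2 ^ n" using Suc.prems by (simp add: add.commute)
    have sub: "?F \<subseteq> {..<2 ^ n}" "?G \<subseteq> {..<2 ^ n}" "?F \<inter> ?G = {}" using iK by auto
    have "0 \<le> \<delta>" by (simp add: \<delta>_def)
    have IH: "integrable M (\<lambda>\<omega>. (D i \<omega>) ^ 2)" "d + 1 \<le> (1 + c * \<delta>) ^ i"
      using Suc.IH iK by (simp_all add: D_def d_def \<delta>_def)
    have d0: "0 \<le> d" by (simp add: d_def)
    have mA: "A l \<in> borel_measurable (incr_algebra n ?F)" for l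
      unfolding A_def by (rule measurable_dyadic_sig) auto
    have mr: "r l \<in> borel_measurable (incr_algebra n ?G)" for l
      unfolding r_def local_error_def
      by (intro borel_measurable_diff borel_measurable_times borel_measurable_divide borel_measurable_add
           measurable_dyadic_sig order_refl borel_measurable_const)
    have mD: "D i \<in> borel_measurable (incr_algebra n ?F)"
    proof -
      have bK: "b * K + K \<le> i * K" if "b < i" for b
        using mult_le_mono1[of "Suc b" i K] that by (simp add: add.commute)
      have "dyadic_trapezoid n K w a i \<in> borel_measurable (incr_algebra n ?F)"
        unfolding dyadic_trapezoid_def
        by (intro borel_measurable_sum borel_measurable_times borel_measurable_divide borel_measurable_add
             measurable_dyadic_sig borel_measurable_const) (use bK in \<open>force simp: add.commute\<close>)+
      then show ?thesis unfolding D_def by (intro borel_measurable_diff measurable_dyadic_sig) auto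
    qed
    have MA: "A l \<in> borel_measurable M" for l
      by (rule measurable_from_incr_algebra[OF sub(1) mA])
    have MD: "D i \<in> borel_measurable M"
      by (rule measurable_from_incr_algebra[OF sub(1) mD])
    have EA: "integrable M (\<lambda>\<omega>. A l \<omega> * A l' \<omega>)" "\<bar>expectation (\<lambda>\<omega>. A l \<omega> * A l' \<omega>)\<bar> \<le> Cc (?t l) (?t l')" for l l'
      using Cc[of 0 "i * K" n "?t l" "?t l'"] iK by (simp_all add: A_def)
    have EDA: "integrable M (\<lambda>\<omega>. D i \<omega> * A l \<omega>)" "\<bar>expectation (\<lambda>\<omega>. D i \<omega> * A l \<omega>)\<bar> \<le> d + Cc (?t l) (?t l)" for l
      using integrable_mult_of_squares[OF IH(1) _ MD MA, of l] EA[of l l]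
      by (auto simp: d_def power2_eq_square)
    have Er: "integrable M (r l)" "\<bar>expectation (r l)\<bar> \<le> Ca (?d l) * \<delta>" for l
      using Ca[OF iK, of "?d l"] by (simp_all add: r_def[abs_def] \<delta>_def)
    have Err: "integrable M (\<lambda>\<omega>. r l \<omega> * r l' \<omega>)" "\<bar>expectation (\<lambda>\<omega>. r l \<omega> * r l' \<omega>)\<bar> \<le> Cb (?d l) (?d l') * \<delta>" for l l'
      using Cb[OF iK, of "?d l" "?d l'"] by (simp_all add: r_def \<delta>_def)
    \<comment> \<open>By independence the cross term sees the local error only through its mean,
      which is of second order in the block duration; the available bound on its root mean square is
      only of first order and would not be summable over the blocks.\<close>
    have EDAr: "integrable M (\<lambda>\<omega>. (D i \<omega> * A l \<omega>) * r l \<omega>)"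
      "expectation (\<lambda>\<omega>. (D i \<omega> * A l \<omega>) * r l \<omega>) \<le> (d + 1) * ((1 + Cc (?t l) (?t l)) * Ca (?d l)) * \<delta>" for l
    proof -
      note f = indep_incr_algebra[OF sub(3,1,2) borel_measurable_times[OF mD mA] mr EDA(1) Er(1), of l l]
      show "integrable M (\<lambda>\<omega>. (D i \<omega> * A l \<omega>) * r l \<omega>)" by (rule f(1))
      have "expectation (\<lambda>\<omega>. (D i \<omega> * A l \<omega>) * r l \<omega>) \<le> \<bar>expectation (\<lambda>\<omega>. D i \<omega> * A l \<omega>)\<bar> * \<bar>expectation (r l)\<bar>"
        unfolding f(2) abs_mult[symmetric] by (rule abs_ge_self)
      also have "\<dots> \<le> (d + Cc (?t l) (?t l)) * (Ca (?d l) * \<delta>)"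
        using d0 Cc0 by (intro mult_mono EDA Er) auto
      also have "\<dots> \<le> ((d + 1) * (1 + Cc (?t l) (?t l))) * (Ca (?d l) * \<delta>)"
        using d0 Cc0[of "?t l" "?t l"] Ca0[of "?d l"] \<open>0 \<le> \<delta>\<close> by (intro mult_right_mono) (auto simp: algebra_simps)
      finally show "expectation (\<lambda>\<omega>. (D i \<omega> * A l \<omega>) * r l \<omega>) \<le> (d + 1) * ((1 + Cc (?t l) (?t l)) * Ca (?d l)) * \<delta>"
        by (simp add: mult.assoc)
    qed
    have EAArr: "integrable M (\<lambda>\<omega>. (A l \<omega> * A l' \<omega>) * (r l \<omega> * r l' \<omega>))"
      "expectation (\<lambda>\<omega>. (A l \<omega> * A l' \<omega>) * (r l \<omega> * r l' \<omega>)) \<le> Cc (?t l) (?t l') * Cb (?d l) (?d l') * \<delta>" for l l'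
    proof -
      note f = indep_incr_algebra[OF sub(3,1,2) borel_measurable_times[OF mA mA] borel_measurable_times[OF mr mr] EA(1) Err(1), of l l' l l']
      show "integrable M (\<lambda>\<omega>. (A l \<omega> * A l' \<omega>) * (r l \<omega> * r l' \<omega>))" by (rule f(1))
      have "expectation (\<lambda>\<omega>. (A l \<omega> * A l' \<omega>) * (r l \<omega> * r l' \<omega>)) \<le> \<bar>expectation (\<lambda>\<omega>. A l \<omega> * A l' \<omega>)\<bar> * \<bar>expectation (\<lambda>\<omega>. r l \<omega> * r l' \<omega>)\<bar>"
        unfolding f(2) abs_mult[symmetric] by (rule abs_ge_self)
      also have "\<dots> \<le> Cc (?t l) (?t l') * (Cb (?d l) (?d l') * \<delta>)"
        using Cc0 by (intro mult_mono EA Err) auto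
      finally show "expectation (\<lambda>\<omega>. (A l \<omega> * A l' \<omega>) * (r l \<omega> * r l' \<omega>)) \<le> Cc (?t l) (?t l') * Cb (?d l) (?d l') * \<delta>"
        by (simp add: mult.assoc)
    qed
    have D_Suc: "D (Suc i) \<omega> = D i \<omega> + (\<Sum>l\<in>?I. A l \<omega> * r l \<omega>)" for \<omega>
      unfolding D_def A_def r_def by (rule trapezoid_error_step)
    have sq: "(D (Suc i) \<omega>) ^ 2 = (D i \<omega>) ^ 2 + (2 * (\<Sum>l\<in>?I. (D i \<omega> * A l \<omega>) * r l \<omega>)
       + (\<Sum>l\<in>?I. \<Sum>l'\<in>?I. (A l \<omega> * A l' \<omega>) * (r l \<omega> * r l' \<omega>)))" for \<omega>
      unfolding D_Suc power2_sum by (simp add: power2_eq_square sum_product sum_distrib_left algebra_simps)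
    have ints: "integrable M (\<lambda>\<omega>. 2 * (\<Sum>l\<in>?I. (D i \<omega> * A l \<omega>) * r l \<omega>))"
      "integrable M (\<lambda>\<omega>. \<Sum>l\<in>?I. \<Sum>l'\<in>?I. (A l \<omega> * A l' \<omega>) * (r l \<omega> * r l' \<omega>))"
      by (intro integrable_mult_right Bochner_Integration.integrable_sum EDAr(1) EAArr(1))+
    have int: "integrable M (\<lambda>\<omega>. (D (Suc i) \<omega>) ^ 2)"
      unfolding sq by (intro Bochner_Integration.integrable_add IH(1) ints)
    have "expectation (\<lambda>\<omega>. (D (Suc i) \<omega>) ^ 2) = d + (2 * (\<Sum>l\<in>?I. expectation (\<lambda>\<omega>. (D i \<omega> * A l \<omega>) * r l \<omega>))
       + (\<Sum>l\<in>?I. \<Sum>l'\<in>?I. expectation (\<lambda>\<omega>. (A l \<omega> * A l' \<omega>) * (r l \<omega> * r l' \<omega>))))"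
      unfolding sq d_def
      unfolding Bochner_Integration.integral_add[OF IH(1) Bochner_Integration.integrable_add[OF ints]]
        Bochner_Integration.integral_add[OF ints]
      by (simp add: Bochner_Integration.integral_sum EDAr(1) EAArr(1) Bochner_Integration.integrable_sum)
    also have "\<dots> \<le> d + (2 * (\<Sum>l\<in>?I. (d + 1) * ((1 + Cc (?t l) (?t l)) * Ca (?d l)) * \<delta>)
       + (\<Sum>l\<in>?I. \<Sum>l'\<in>?I. Cc (?t l) (?t l') * Cb (?d l) (?d l') * \<delta>))"
      by (intro add_left_mono add_mono mult_left_mono sum_mono EDAr EAArr) auto
    also have "\<dots> = d + (2 * ((d + 1) * c1 * \<delta>) + c2 * \<delta>)"
      by (simp add: c1_def c2_def sum_distrib_left sum_distrib_right)
    also have "\<dots> \<le> d + (2 * ((d + 1) * c1 * \<delta>) + (d + 1) * c2 * \<delta>)"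
      using c2 d0 \<open>0 \<le> \<delta>\<close> by (intro add_left_mono mult_right_mono) (auto simp: algebra_simps)
    also have "\<dots> = (d + 1) * (1 + c * \<delta>) - 1"
      by (simp add: c_def algebra_simps)
    also have "\<dots> \<le> (1 + c * \<delta>) ^ i * (1 + c * \<delta>) - 1"
      using IH(2) c0 \<open>0 \<le> \<delta>\<close> by (intro diff_right_mono mult_right_mono) auto
    finally have "expectation (\<lambda>\<omega>. (D (Suc i) \<omega>) ^ 2) + 1 \<le> (1 + c * \<delta>) ^ Suc i"
      by (simp add: mult.commute)
    with int show ?case unfolding D_def \<delta>_def by simp
  qed (simp add: dyadic_trapezoid_def)
  show ?thesis
  proof (intro exI[of _ c] conjI c0 allI impI)
    fix n K i :: nat assume iK: "i * K \<le> 2 ^ n"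
    let ?\<delta> = "real K / 2 ^ n"
    show "integrable M (\<lambda>\<omega>. (dyadic_sig X n 0 (i * K) \<omega> (w @ [a]) - dyadic_trapezoid n K w a i \<omega>) ^ 2)"
      using main[OF iK] by simp
    have "(1 + c * ?\<delta> ^ 2) ^ i \<le> exp (c * ?\<delta> ^ 2) ^ i"
      using c0 by (intro power_mono exp_ge_add_one_self) auto
    also have "\<dots> = exp (c * ?\<delta> * (real i * ?\<delta>))"
      by (simp add: exp_of_nat_mult[symmetric] power2_eq_square ac_simps)
    also have "\<dots> \<le> exp (c * ?\<delta> * 1)"
    proof -
      have "real i * ?\<delta> \<le> 1"
        using of_nat_mono[OF iK, where 'a = real] by simp
      then show ?thesis using c0 by (intro exp_le_cancel_iff[THEN iffD2] mult_left_mono) auto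
    qed
    finally show "expectation (\<lambda>\<omega>. (dyadic_sig X n 0 (i * K) \<omega> (w @ [a]) - dyadic_trapezoid n K w a i \<omega>) ^ 2)
       \<le> exp (c * ?\<delta>) - 1"
      using main[OF iK] by simp
  qed
qed

end

subsection \<open>Convergence in probability\<close>

context prob_space
begin

text \<open>Measurability is required only eventually, because a dyadic time of a given level lies
  on the level-n grid only for large n. One \<eta> serves as threshold and as bound on the
  probability, as in \<open>has_stratonovich_integral\<close>.\<close>

definition conv_prob :: "(nat \<Rightarrow> 'a \<Rightarrow> real) \<Rightarrow> ('a \<Rightarrow> real) \<Rightarrow> bool" where
  "conv_prob Y Z \<longleftrightarrow> Z \<in> borel_measurable M \<and> (\<forall>\<^sub>F n in sequentially. Y n \<in> borel_measurable M) \<and>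
     (\<forall>\<eta>>0. \<forall>\<^sub>F n in sequentially. prob {\<omega> \<in> space M. \<eta> < \<bar>Y n \<omega> - Z \<omega>\<bar>} < \<eta>)"

lemma conv_probD:
  assumes "conv_prob Y Z"
  shows "Z \<in> borel_measurable M" "\<forall>\<^sub>F n in sequentially. Y n \<in> borel_measurable M"
    "0 < \<eta> \<Longrightarrow> \<forall>\<^sub>F n in sequentially. prob {\<omega> \<in> space M. \<eta> < \<bar>Y n \<omega> - Z \<omega>\<bar>} < \<eta>"
  using assms by (auto simp: conv_prob_def)

lemma conv_prob_cong:
  assumes "\<forall>\<^sub>F n in sequentially. Y n = Y' n" "conv_prob Y Z"
  shows "conv_prob Y' Z"
  unfolding conv_prob_def
proof (intro conjI allI impI)
  show "Z \<in> borel_measurable M" by (rule conv_probD[OF assms(2)])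
  show "\<forall>\<^sub>F n in sequentially. Y' n \<in> borel_measurable M"
    using assms(1) conv_probD(2)[OF assms(2)] by eventually_elim simp
  fix \<eta> :: real assume "0 < \<eta>"
  show "\<forall>\<^sub>F n in sequentially. prob {\<omega> \<in> space M. \<eta> < \<bar>Y' n \<omega> - Z \<omega>\<bar>} < \<eta>"
    using assms(1) conv_probD(3)[OF assms(2) \<open>0 < \<eta>\<close>] by eventually_elim simp
qed

lemma prob_mono_union:
  assumes "{\<omega> \<in> space M. P \<omega>} \<in> events" "{\<omega> \<in> space M. Q \<omega>} \<in> events"
    and "\<And>\<omega>. \<omega> \<in> space M \<Longrightarrow> R \<omega> \<Longrightarrow> P \<omega> \<or> Q \<omega>"
  shows "prob {\<omega> \<in> space M. R \<omega>} \<le> prob {\<omega> \<in> space M. P \<omega>} + prob {\<omega> \<in> space M. Q \<omega>}"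
proof -
  have "prob {\<omega> \<in> space M. R \<omega>} \<le> prob ({\<omega> \<in> space M. P \<omega>} \<union> {\<omega> \<in> space M. Q \<omega>})"
    using assms by (intro finite_measure_mono sets.Un) auto
  also have "\<dots> \<le> prob {\<omega> \<in> space M. P \<omega>} + prob {\<omega> \<in> space M. Q \<omega>}"
    using assms by (intro measure_Un_le) auto
  finally show ?thesis .
qed

lemma conv_prob_const:
  assumes "Z \<in> borel_measurable M"
  shows "conv_prob (\<lambda>n. Z) Z"
  using assms by (simp add: conv_prob_def)

lemma conv_prob_add:
  assumes Y: "conv_prob Y Z" and Y': "conv_prob Y' Z'"
  shows "conv_prob (\<lambda>n \<omega>. Y n \<omega> + Y' n \<omega>) (\<lambda>\<omega>. Z \<omega> + Z' \<omega>)"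
  unfolding conv_prob_def
proof (intro conjI allI impI)
  note [measurable] = conv_probD(1)[OF Y] conv_probD(1)[OF Y']
  show "(\<lambda>\<omega>. Z \<omega> + Z' \<omega>) \<in> borel_measurable M" by measurable
  show "\<forall>\<^sub>F n in sequentially. (\<lambda>\<omega>. Y n \<omega> + Y' n \<omega>) \<in> borel_measurable M"
    using conv_probD(2)[OF Y] conv_probD(2)[OF Y'] by eventually_elim measurable
  fix \<eta> :: real assume "0 < \<eta>"
  then have "0 < \<eta> / 2" by simp
  from conv_probD(2)[OF Y] conv_probD(2)[OF Y'] conv_probD(3)[OF Y this] conv_probD(3)[OF Y' this]
  show "\<forall>\<^sub>F n in sequentially. prob {\<omega> \<in> space M. \<eta> < \<bar>Y n \<omega> + Y' n \<omega> - (Z \<omega> + Z' \<omega>)\<bar>} < \<eta>"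
  proof eventually_elim
    case (elim n)
    note [measurable] = elim(1,2)
    have "prob {\<omega> \<in> space M. \<eta> < \<bar>Y n \<omega> + Y' n \<omega> - (Z \<omega> + Z' \<omega>)\<bar>} \<le>
      prob {\<omega> \<in> space M. \<eta> / 2 < \<bar>Y n \<omega> - Z \<omega>\<bar>} + prob {\<omega> \<in> space M. \<eta> / 2 < \<bar>Y' n \<omega> - Z' \<omega>\<bar>}"
      by (rule prob_mono_union) (measurable, linarith)
    with elim show ?case by linarith
  qed
qed

lemma conv_prob_sum:
  assumes "\<And>i. i \<in> A \<Longrightarrow> conv_prob (Y i) (Z i)"
  shows "conv_prob (\<lambda>n \<omega>. \<Sum>i\<in>A. Y i n \<omega>) (\<lambda>\<omega>. \<Sum>i\<in>A. Z i \<omega>)"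
  using assms
proof (induction A rule: infinite_finite_induct)
  case (insert a A)
  have "conv_prob (\<lambda>n \<omega>. Y a n \<omega> + (\<Sum>i\<in>A. Y i n \<omega>)) (\<lambda>\<omega>. Z a \<omega> + (\<Sum>i\<in>A. Z i \<omega>))"
    using insert by (intro conv_prob_add) auto
  then show ?case using insert by simp
qed (simp_all add: conv_prob_const)

text \<open>Chebyshev's inequality confines the fixed factor \<open>V\<close> to a bounded range
  outside an event of small probability; on that range the product inherits the convergence.\<close>

lemma conv_prob_mult:
  assumes Y: "conv_prob Y Z" and [measurable]: "V \<in> borel_measurable M" and V: "integrable M (\<lambda>\<omega>. V \<omega> ^ 2)"
  shows "conv_prob (\<lambda>n \<omega>. Y n \<omega> * V \<omega>) (\<lambda>\<omega>. Z \<omega> * V \<omega>)"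
  unfolding conv_prob_def
proof (intro conjI allI impI)
  note [measurable] = conv_probD(1)[OF Y]
  show "(\<lambda>\<omega>. Z \<omega> * V \<omega>) \<in> borel_measurable M" by measurable
  show "\<forall>\<^sub>F n in sequentially. (\<lambda>\<omega>. Y n \<omega> * V \<omega>) \<in> borel_measurable M"
    using conv_probD(2)[OF Y] by eventually_elim (intro borel_measurable_times assms(2))
  fix \<eta> :: real assume \<eta>: "0 < \<eta>"
  let ?E = "expectation (\<lambda>\<omega>. V \<omega> ^ 2)"
  \<comment> \<open>This makes ?E / a less than \<eta> / 2; the summand 1 ensures a \<ge> 1, so that
    the Chebyshev bound ?E / a^2 is at most ?E / a.\<close>
  define a where "a = 2 * ?E / \<eta> + 1"
  have E: "0 \<le> ?E" by simp
  have a: "1 \<le> a" using \<eta> E by (simp add: a_def)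
  have "prob {\<omega> \<in> space M. a \<le> \<bar>V \<omega>\<bar>} \<le> ?E / a\<^sup>2"
    using a V by (intro second_moment_method) auto
  also have "\<dots> \<le> ?E / a"
    using a E self_le_power[of a 2] by (intro divide_left_mono) auto
  also have "\<dots> < \<eta> / 2"
  proof -
    have "\<eta> * a = 2 * ?E + \<eta>" using \<eta> by (simp add: a_def distrib_left)
    then show ?thesis using a \<eta> by (simp add: pos_divide_less_eq)
  qed
  finally have Va: "prob {\<omega> \<in> space M. a \<le> \<bar>V \<omega>\<bar>} < \<eta> / 2" .
  define \<eta>' where "\<eta>' = \<eta> / (2 * a)"
  have \<eta>': "0 < \<eta>'" "\<eta>' \<le> \<eta> / 2" "\<eta>' * a \<le> \<eta>" using \<eta> a by (auto simp: \<eta>'_def field_simps)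
  from conv_probD(2)[OF Y] conv_probD(3)[OF Y \<eta>'(1)]
  show "\<forall>\<^sub>F n in sequentially. prob {\<omega> \<in> space M. \<eta> < \<bar>Y n \<omega> * V \<omega> - Z \<omega> * V \<omega>\<bar>} < \<eta>"
  proof eventually_elim
    case (elim n)
    note [measurable] = elim(1)
    have "prob {\<omega> \<in> space M. \<eta> < \<bar>Y n \<omega> * V \<omega> - Z \<omega> * V \<omega>\<bar>} \<le>
      prob {\<omega> \<in> space M. \<eta>' < \<bar>Y n \<omega> - Z \<omega>\<bar>} + prob {\<omega> \<in> space M. a \<le> \<bar>V \<omega>\<bar>}"
    proof (rule prob_mono_union)
      fix \<omega> assume less: "\<eta> < \<bar>Y n \<omega> * V \<omega> - Z \<omega> * V \<omega>\<bar>"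
      show "\<eta>' < \<bar>Y n \<omega> - Z \<omega>\<bar> \<or> a \<le> \<bar>V \<omega>\<bar>"
      proof (rule ccontr)
        assume "\<not> (\<eta>' < \<bar>Y n \<omega> - Z \<omega>\<bar> \<or> a \<le> \<bar>V \<omega>\<bar>)"
        then have "\<bar>Y n \<omega> - Z \<omega>\<bar> * \<bar>V \<omega>\<bar> \<le> \<eta>' * a"
          using \<eta>' a by (intro mult_mono) auto
        with less \<eta>'(3) show False by (simp add: abs_mult[symmetric] left_diff_distrib)
      qed
    qed measurable
    with elim Va \<eta>' show ?case by linarith
  qed
qed

text \<open>Differences capped at 1 converge to 0 in mean. Their sum over the finite set
  \<open>W\<close> is a single such sequence, so one subsequence works for all words at
  once.\<close>

lemma conv_prob_AE_subseq:
  assumes W: "finite W" and conv: "\<And>w. w \<in> W \<Longrightarrow> conv_prob (Y w) (Z w)"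
    and [measurable]: "\<And>w n. w \<in> W \<Longrightarrow> Y w n \<in> borel_measurable M"
  shows "\<exists>r. strict_mono r \<and> (AE \<omega> in M. \<forall>w\<in>W. (\<lambda>n. Y w (r n) \<omega>) \<longlonglongrightarrow> Z w \<omega>)"
proof -
  have [measurable]: "Z w \<in> borel_measurable M" if "w \<in> W" for w
    using conv_probD(1)[OF conv[OF that]] .
  define d where "d w n \<omega> = min 1 \<bar>Y w n \<omega> - Z w \<omega>\<bar>" for w n \<omega>
  have d_meas [measurable]: "d w n \<in> borel_measurable M" if "w \<in> W" for w n
    unfolding d_def using that by measurable
  have d: "0 \<le> d w n \<omega>" "d w n \<omega> \<le> 1" for w n \<omega> by (auto simp: d_def)
  have d_int: "integrable M (d w n)" if "w \<in> W" for w n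
    using that d by (intro integrable_const_bound[of _ 1]) auto
  have lim: "(\<lambda>n. expectation (d w n)) \<longlonglongrightarrow> 0" if w: "w \<in> W" for w
  proof (rule tendstoI)
    fix e :: real assume "0 < e"
    then have "0 < e / 2" by simp
    from conv_probD(3)[OF conv[OF w] this]
    show "\<forall>\<^sub>F n in sequentially. dist (expectation (d w n)) 0 < e"
    proof eventually_elim
      case (elim n)
      let ?S = "{\<omega> \<in> space M. e / 2 < \<bar>Y w n \<omega> - Z w \<omega>\<bar>}"
      have S: "?S \<in> events" using w by measurable
      have "expectation (d w n) \<le> expectation (\<lambda>\<omega>. e / 2 + indicat_real ?S \<omega>)"
      proof (rule integral_mono)
        show "integrable M (\<lambda>\<omega>. e / 2 + indicat_real ?S \<omega>)"
          using S by (intro Bochner_Integration.integrable_add) (auto simp: emeasure_eq_measure)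
        show "d w n \<omega> \<le> e / 2 + indicat_real ?S \<omega>" if "\<omega> \<in> space M" for \<omega>
          using that \<open>0 < e\<close> by (cases "\<omega> \<in> ?S") (auto simp: d_def min_def)
      qed (rule d_int[OF w])
      also have "\<dots> = e / 2 + prob ?S"
        using S by (subst Bochner_Integration.integral_add) (simp_all add: prob_space emeasure_eq_measure Int_absorb1[OF sets.sets_into_space[OF S]])
      also have "\<dots> < e" using elim by linarith
      finally have "expectation (d w n) < e" .
      moreover have "0 \<le> expectation (d w n)" using d by (intro Bochner_Integration.integral_nonneg) auto
      ultimately show ?case by simp
    qed
  qed
  define D where "D n \<omega> = (\<Sum>w\<in>W. d w n \<omega>)" for n \<omega>
  have "integrable M (D n)" for n
    unfolding D_def using d_int by (intro Bochner_Integration.integrable_sum)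
  moreover have "(\<lambda>n. expectation (\<lambda>\<omega>. norm (D n \<omega>))) \<longlonglongrightarrow> 0"
  proof -
    have "norm (D n \<omega>) = (\<Sum>w\<in>W. d w n \<omega>)" for n \<omega>
      using d by (simp add: D_def sum_nonneg)
    then have "expectation (\<lambda>\<omega>. norm (D n \<omega>)) = (\<Sum>w\<in>W. expectation (d w n))" for n
      using d_int by (simp add: Bochner_Integration.integral_sum)
    then show ?thesis using tendsto_sum[of W "\<lambda>w n. expectation (d w n)" "\<lambda>_. 0"] lim by simp
  qed
  ultimately obtain r where r: "strict_mono r" and AE: "AE \<omega> in M. (\<lambda>n. D (r n) \<omega>) \<longlonglongrightarrow> 0"
    using tendsto_L1_AE_subseq[of M D] by blast
  from AE have "AE \<omega> in M. \<forall>w\<in>W. (\<lambda>n. Y w (r n) \<omega>) \<longlonglongrightarrow> Z w \<omega>"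
  proof eventually_elim
    case (elim \<omega>)
    show ?case
    proof (intro ballI tendstoI)
      fix w and e :: real assume w: "w \<in> W" and e: "0 < e"
      have "0 < min 1 e" using e by simp
      from order_tendstoD(2)[OF elim this]
      show "\<forall>\<^sub>F n in sequentially. dist (Y w (r n) \<omega>) (Z w \<omega>) < e"
      proof eventually_elim
        case (elim n)
        have "d w (r n) \<omega> \<le> D (r n) \<omega>"
          unfolding D_def using W w d by (intro member_le_sum) auto
        with elim show ?case by (auto simp: d_def dist_real_def)
      qed
    qed
  qed
  with r show ?thesis by blast
qed

text \<open>Fatou's lemma bounds the second moment of the limit. Differences capped at a level
  \<open>a\<close> are handled by dominated convergence; above \<open>a\<close> one has |x - z|
  \<le> (x - z)^2 / a, so the remainder is controlled by second moments.\<close>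

lemma expectation_limit_of_L2_bounded:
  assumes [measurable]: "\<And>n. Y n \<in> borel_measurable M" "Z \<in> borel_measurable M"
    and sq: "\<And>n. integrable M (\<lambda>\<omega>. Y n \<omega> ^ 2)" and C: "\<And>n. expectation (\<lambda>\<omega>. Y n \<omega> ^ 2) \<le> C"
    and lim: "AE \<omega> in M. (\<lambda>n. Y n \<omega>) \<longlonglongrightarrow> (Z \<omega> :: real)"
  shows "integrable M Z" and "(\<lambda>n. expectation (Y n)) \<longlonglongrightarrow> expectation Z"
proof -
  have C0: "0 \<le> C" using C[of 0] by (rule order_trans[rotated]) simp
  have "(\<integral>\<^sup>+ \<omega>. ennreal (Z \<omega> ^ 2) \<partial>M) = (\<integral>\<^sup>+ \<omega>. liminf (\<lambda>n. ennreal (Y n \<omega> ^ 2)) \<partial>M)"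
  proof (rule nn_integral_cong_AE)
    from lim show "AE \<omega> in M. ennreal (Z \<omega> ^ 2) = liminf (\<lambda>n. ennreal (Y n \<omega> ^ 2))"
    proof eventually_elim
      case (elim \<omega>)
      have "(\<lambda>n. ennreal (Y n \<omega> ^ 2)) \<longlonglongrightarrow> ennreal (Z \<omega> ^ 2)"
        by (intro tendsto_ennrealI tendsto_power elim)
      then show ?case by (rule lim_imp_Liminf[OF trivial_limit_sequentially, symmetric])
    qed
  qed
  also have "\<dots> \<le> liminf (\<lambda>n. \<integral>\<^sup>+ \<omega>. ennreal (Y n \<omega> ^ 2) \<partial>M)"
    by (rule nn_integral_liminf) measurable
  also have "\<dots> \<le> ennreal C"
  proof (rule Liminf_le)
    show "\<forall>\<^sub>F n in sequentially. (\<integral>\<^sup>+ \<omega>. ennreal (Y n \<omega> ^ 2) \<partial>M) \<le> ennreal C"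
      using sq C by (simp add: nn_integral_eq_integral ennreal_leI)
  qed simp
  finally have ZC: "(\<integral>\<^sup>+ \<omega>. ennreal (Z \<omega> ^ 2) \<partial>M) \<le> ennreal C" .
  have sqZ: "integrable M (\<lambda>\<omega>. Z \<omega> ^ 2)"
    using ZC by (intro integrableI_nonneg) (auto intro: order_le_less_trans)
  have CZ: "expectation (\<lambda>\<omega>. Z \<omega> ^ 2) \<le> C"
    using ZC C0 sqZ by (simp add: nn_integral_eq_integral)
  show intZ: "integrable M Z"
    by (rule square_integrable_imp_integrable[OF _ sqZ]) measurable
  have intY: "integrable M (Y n)" for n
    by (rule square_integrable_imp_integrable[OF _ sq]) measurable
  show "(\<lambda>n. expectation (Y n)) \<longlonglongrightarrow> expectation Z"
  proof (rule tendstoI)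
    fix e :: real assume e: "0 < e"
    \<comment> \<open>Chosen so that the remainder \<open>(2 / a) * (C + C)\<close> is below e /
      2.\<close>
    define a where "a = 8 * C / e + 1"
    have a: "0 < a" "4 * C / a < e / 2" using C0 e by (auto simp: a_def field_simps add_pos_nonneg)
    have "(\<lambda>n. expectation (\<lambda>\<omega>. min a \<bar>Y n \<omega> - Z \<omega>\<bar>)) \<longlonglongrightarrow> expectation (\<lambda>\<omega>. 0)"
    proof (rule integral_dominated_convergence[where w = "\<lambda>_. a"])
      from lim show "AE \<omega> in M. (\<lambda>n. min a \<bar>Y n \<omega> - Z \<omega>\<bar>) \<longlonglongrightarrow> 0"
      proof eventually_elim
        case (elim \<omega>)
        have "(\<lambda>n. min a \<bar>Y n \<omega> - Z \<omega>\<bar>) \<longlonglongrightarrow> min a \<bar>Z \<omega> - Z \<omega>\<bar>"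
          by (intro tendsto_intros elim)
        then show ?case using a by simp
      qed
    qed (use a in auto)
    then have "\<forall>\<^sub>F n in sequentially. expectation (\<lambda>\<omega>. min a \<bar>Y n \<omega> - Z \<omega>\<bar>) < e / 2"
      using e by (intro order_tendstoD) auto
    then show "\<forall>\<^sub>F n in sequentially. dist (expectation (Y n)) (expectation Z) < e"
    proof eventually_elim
      case (elim n)
      have pt: "\<bar>x - z\<bar> \<le> min a \<bar>x - z\<bar> + (2 / a) * (x ^ 2 + z ^ 2)" for x z :: real
      proof (cases "\<bar>x - z\<bar> \<le> a")
        case False
        have "a * \<bar>x - z\<bar> \<le> (x - z) ^ 2"
          using False a by (simp add: power2_eq_square abs_mult_self_eq[symmetric, of "x - z"] mult_right_mono del: abs_mult_self_eq)
        also have "\<dots> \<le> 2 * (x ^ 2 + z ^ 2)"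
          using zero_le_power2[of "x + z"] by (simp add: power2_eq_square algebra_simps)
        finally have "\<bar>x - z\<bar> \<le> (2 / a) * (x ^ 2 + z ^ 2)"
          using a by (simp add: pos_le_divide_eq mult.commute)
        moreover have "0 \<le> min a \<bar>x - z\<bar>" using a by simp
        ultimately show ?thesis by linarith
      qed (use a in \<open>simp add: min_def\<close>)
      have mi: "integrable M (\<lambda>\<omega>. min a \<bar>Y n \<omega> - Z \<omega>\<bar>)"
        using a by (intro integrable_const_bound[of _ a]) auto
      have "\<bar>expectation (Y n) - expectation Z\<bar> = \<bar>expectation (\<lambda>\<omega>. Y n \<omega> - Z \<omega>)\<bar>"
        using intY intZ by simp
      also have "\<dots> \<le> expectation (\<lambda>\<omega>. \<bar>Y n \<omega> - Z \<omega>\<bar>)" by (rule integral_abs_bound)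
      also have "\<dots> \<le> expectation (\<lambda>\<omega>. min a \<bar>Y n \<omega> - Z \<omega>\<bar> + (2 / a) * (Y n \<omega> ^ 2 + Z \<omega> ^ 2))"
        using intY intZ sq sqZ mi
        by (intro integral_mono pt integrable_abs Bochner_Integration.integrable_diff Bochner_Integration.integrable_add integrable_mult_right) auto
      also have "\<dots> = expectation (\<lambda>\<omega>. min a \<bar>Y n \<omega> - Z \<omega>\<bar>) + (2 / a) * (expectation (\<lambda>\<omega>. Y n \<omega> ^ 2) + expectation (\<lambda>\<omega>. Z \<omega> ^ 2))"
        using sq sqZ mi by (simp add: Bochner_Integration.integral_add integrable_mult_right)
      also have "\<dots> \<le> expectation (\<lambda>\<omega>. min a \<bar>Y n \<omega> - Z \<omega>\<bar>) + (2 / a) * (C + C)"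
        using C CZ a by (intro add_left_mono mult_left_mono add_mono) auto
      also have "\<dots> < e" using elim a by simp
      finally show ?case by (simp add: dist_real_def)
    qed
  qed
qed

end

subsection \<open>Convergence of the dyadic signatures\<close>

context brownian_increments
begin

lemma measurable_dyadic_sig_M:
  "j + k \<le> 2 ^ n \<Longrightarrow> (\<lambda>\<omega>. dyadic_sig X n j k \<omega> w) \<in> borel_measurable M"
  using dyadic_sig_moment[of j k n w] by (auto intro: borel_measurable_integrable)

lemma incr_square_integrable:
  assumes "k < 2 ^ n"
  shows "(\<lambda>\<omega>. incr X n k \<omega> $ a) \<in> borel_measurable M" "integrable M (\<lambda>\<omega>. (incr X n k \<omega> $ a) ^ 2)"
  using integrable_incr[OF assms, of "[a]"] integrable_incr[OF assms, of "[a, a]"]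
  by (auto simp: word_monomial_def power2_eq_square intro: borel_measurable_integrable)

lemma dyadic_refine:
  assumes "k \<le> n"
  shows "real (b * 2 ^ (n - k)) / 2 ^ n = real b / 2 ^ k"
proof -
  have "(2 :: real) ^ n = 2 ^ k * 2 ^ (n - k)" using assms by (simp flip: power_add)
  then show ?thesis by simp
qed

text \<open>The claim covers every dyadic time of every level because the trapezoidal sum for a
  longer word evaluates the shorter one at all points of a grid whose level is chosen only in the
  proof.\<close>

lemma dyadic_sig_converges:
  assumes I: "stratonovich_iterated_integrals M X I"
  shows "i \<le> 2 ^ m' \<Longrightarrow> conv_prob (\<lambda>n \<omega>. dyadic_sig X n 0 (i * 2 ^ (n - m')) \<omega> w) (I w (real i / 2 ^ m'))"
proof (induction w arbitrary: i m' rule: rev_induct)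
  case Nil
  have t: "real i / 2 ^ m' \<in> {0..1}"
    using of_nat_mono[OF Nil, where 'a = real] by simp
  have one: "\<And>\<omega>. \<omega> \<in> space M \<Longrightarrow> I [] (real i / 2 ^ m') \<omega> = 1"
    using I t by (auto simp: stratonovich_iterated_integrals_def)
  have "I [] (real i / 2 ^ m') \<in> borel_measurable M"
    using one by (subst measurable_cong[where g = "\<lambda>_. 1"]) auto
  moreover have "prob {\<omega> \<in> space M. \<eta> < \<bar>1 - I [] (real i / 2 ^ m') \<omega>\<bar>} < \<eta>" if "0 < \<eta>" for \<eta> :: real
  proof -
    have "{\<omega> \<in> space M. \<eta> < \<bar>1 - I [] (real i / 2 ^ m') \<omega>\<bar>} = {}"
      using that one by auto
    then show ?thesis using that by (simp only: measure_empty)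
  qed
  ultimately show ?case by (simp add: conv_prob_def)
next
  case (snoc a w)
  define t where "t = real i / 2 ^ m'"
  have t: "t \<in> {0..1}"
    using of_nat_mono[OF snoc.prems, where 'a = real] by (simp add: t_def)
  have strat: "has_stratonovich_integral M (I w) (\<lambda>s \<omega>. X s \<omega> $ a) t (I (w @ [a]) t)"
    using I t by (auto simp: stratonovich_iterated_integrals_def)
  then have [measurable]: "I (w @ [a]) t \<in> borel_measurable M"
    by (auto simp: has_stratonovich_integral_def)
  have ile: "i * 2 ^ (n - m') \<le> 2 ^ n" if "m' \<le> n" for n
    using mult_le_mono1[OF snoc.prems, of "2 ^ (n - m')"] that by (simp flip: power_add)
  obtain c where c0: "0 \<le> c" and c: "\<And>n K i. i * K \<le> 2 ^ n \<Longrightarrow>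
     integrable M (\<lambda>\<omega>. (dyadic_sig X n 0 (i * K) \<omega> (w @ [a]) - dyadic_trapezoid n K w a i \<omega>) ^ 2) \<and>
     expectation (\<lambda>\<omega>. (dyadic_sig X n 0 (i * K) \<omega> (w @ [a]) - dyadic_trapezoid n K w a i \<omega>) ^ 2)
       \<le> exp (c * (real K / 2 ^ n)) - 1"
    using trapezoid_error[of w a] by blast
  show ?case
    unfolding conv_prob_def t_def[symmetric]
  proof (intro conjI allI impI)
    show "\<forall>\<^sub>F n in sequentially. (\<lambda>\<omega>. dyadic_sig X n 0 (i * 2 ^ (n - m')) \<omega> (w @ [a])) \<in> borel_measurable M"
      using eventually_ge_at_top[of m'] by eventually_elim (use ile in \<open>auto intro: measurable_dyadic_sig_M\<close>)
    fix \<eta> :: real assume "0 < \<eta>"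
    define \<eta>' where "\<eta>' = \<eta> / 3"
    have \<eta>3: "\<eta> = 3 * \<eta>'" by (simp add: \<eta>'_def)
    have \<eta>': "0 < \<eta>'" using \<open>0 < \<eta>\<close> by (simp add: \<eta>'_def)
    obtain \<delta> where \<delta>: "0 < \<delta>" and strat\<delta>: "\<And>n p. is_partition 0 t n p \<Longrightarrow> (\<And>i. i < n \<Longrightarrow> p (Suc i) - p i < \<delta>) \<Longrightarrow>
        prob {\<omega> \<in> space M. \<eta>' < \<bar>trapezoidal_sum (I w) (\<lambda>s \<omega>. X s \<omega> $ a) n p \<omega> - I (w @ [a]) t \<omega>\<bar>} < \<eta>'"
      using strat \<eta>' unfolding has_stratonovich_integral_def by meson
    have half: "(\<lambda>k. 1 / 2 ^ k :: real) \<longlonglongrightarrow> 0"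
      using LIMSEQ_realpow_zero[of "1 / 2 :: real"] by (simp add: power_one_over)
    have "(\<lambda>k. (exp (c * (1 / 2 ^ k)) - 1) / \<eta>'\<^sup>2) \<longlonglongrightarrow> (exp (c * 0) - 1) / \<eta>'\<^sup>2"
      using \<eta>' by (intro tendsto_intros half) auto
    then have "\<forall>\<^sub>F k in sequentially. (exp (c * (1 / 2 ^ k)) - 1) / \<eta>'\<^sup>2 < \<eta>'"
      using \<eta>' by (intro order_tendstoD) auto
    with order_tendstoD(2)[OF half \<delta>] eventually_ge_at_top[of m']
    have "\<forall>\<^sub>F k in sequentially. 1 / 2 ^ k < \<delta> \<and> (exp (c * (1 / 2 ^ k)) - 1) / \<eta>'\<^sup>2 < \<eta>' \<and> m' \<le> k"
      by eventually_elim simp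
    \<comment> \<open>The coarse level is fixed before n: its mesh is fine enough for the
      Stratonovich sums, and the Gronwall bound, after Chebyshev, is already below \<eta>'.\<close>
    then obtain k where k: "1 / 2 ^ k < \<delta>" "(exp (c * (1 / 2 ^ k)) - 1) / \<eta>'\<^sup>2 < \<eta>'" "m' \<le> k"
      by (auto simp: eventually_sequentially)
    define i' where "i' = i * 2 ^ (k - m')"
    have i': "i' \<le> 2 ^ k" unfolding i'_def by (rule ile[OF k(3)])
    have t': "t = real i' / 2 ^ k"
      unfolding t_def i'_def dyadic_refine[OF k(3)] ..
    define p where "p j = real j / 2 ^ k" for j
    define T where "T = trapezoidal_sum (I w) (\<lambda>s \<omega>. X s \<omega> $ a) i' p"
    have "is_partition 0 t i' p"
      by (simp add: is_partition_def p_def t' divide_strict_right_mono)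
    moreover have "p (Suc j) - p j < \<delta>" for j
      using k(1) by (simp add: p_def diff_divide_distrib[symmetric])
    ultimately have P1: "prob {\<omega> \<in> space M. \<eta>' < \<bar>T \<omega> - I (w @ [a]) t \<omega>\<bar>} < \<eta>'"
      unfolding T_def by (intro strat\<delta>)
    \<comment> \<open>Only finitely many times of the coarse grid occur, so the induction hypothesis
      passes through the sum. The increments do not move with n, as the interpolation agrees with
      \<open>X\<close> at the coarse grid points.\<close>
    have convT: "conv_prob (\<lambda>n. dyadic_trapezoid n (2 ^ (n - k)) w a i') T"
    proof -
      let ?Y = "\<lambda>b n \<omega>. dyadic_sig X n 0 (b * 2 ^ (n - k)) \<omega> w"
      have "conv_prob (\<lambda>n \<omega>. \<Sum>b<i'. (?Y b n \<omega> + ?Y (Suc b) n \<omega>) * (incr X k b \<omega> $ a / 2))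
          (\<lambda>\<omega>. \<Sum>b<i'. (I w (p b) \<omega> + I w (p (Suc b)) \<omega>) * (incr X k b \<omega> $ a / 2))"
      proof (rule conv_prob_sum)
        fix b assume "b \<in> {..<i'}"
        then have b: "b < 2 ^ k" "Suc b \<le> 2 ^ k" using i' by auto
        note sq = incr_square_integrable[OF b(1), of a]
        show "conv_prob (\<lambda>n \<omega>. (?Y b n \<omega> + ?Y (Suc b) n \<omega>) * (incr X k b \<omega> $ a / 2))
            (\<lambda>\<omega>. (I w (p b) \<omega> + I w (p (Suc b)) \<omega>) * (incr X k b \<omega> $ a / 2))"
          unfolding p_def using sq b by (intro conv_prob_mult conv_prob_add snoc.IH) (auto simp: power_divide)
      qed
      also have "(\<lambda>\<omega>. \<Sum>b<i'. (I w (p b) \<omega> + I w (p (Suc b)) \<omega>) * (incr X k b \<omega> $ a / 2)) = T"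
        by (simp add: T_def trapezoidal_sum_def fun_eq_iff incr_def p_def)
      finally show ?thesis
      proof (rule conv_prob_cong[rotated])
        show "\<forall>\<^sub>F n in sequentially. (\<lambda>\<omega>. \<Sum>b<i'. (?Y b n \<omega> + ?Y (Suc b) n \<omega>) * (incr X k b \<omega> $ a / 2))
            = dyadic_trapezoid n (2 ^ (n - k)) w a i'"
          using eventually_ge_at_top[of k]
        proof eventually_elim
          case (elim n)
          have q: "real (b * 2 ^ (n - k)) / 2 ^ n = real b / 2 ^ k" for b
            by (rule dyadic_refine[OF elim])
          have "dyadic_sig X n (b * 2 ^ (n - k)) (2 ^ (n - k)) \<omega> [a] = incr X k b \<omega> $ a" for b \<omega>
          proof -
            have s: "b * 2 ^ (n - k) + 2 ^ (n - k) = Suc b * 2 ^ (n - k)" by simp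
            show ?thesis unfolding dyadic_sig_letter s q incr_def by simp
          qed
          then show ?case by (simp add: dyadic_trapezoid_def fun_eq_iff)
        qed
      qed
    qed
    note [measurable] = conv_probD(1)[OF convT]
    from conv_probD(2)[OF convT] conv_probD(3)[OF convT \<eta>'] eventually_ge_at_top[of k]
    show "\<forall>\<^sub>F n in sequentially. prob {\<omega> \<in> space M. \<eta> < \<bar>dyadic_sig X n 0 (i * 2 ^ (n - m')) \<omega> (w @ [a]) - I (w @ [a]) t \<omega>\<bar>} < \<eta>"
    proof eventually_elim
      case (elim n)
      define J where "J \<omega> = dyadic_sig X n 0 (i * 2 ^ (n - m')) \<omega> (w @ [a])" for \<omega>
      define S where "S = dyadic_trapezoid n (2 ^ (n - k)) w a i'"
      have mS [measurable]: "S \<in> borel_measurable M" using elim by (simp add: S_def)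
      have mJ [measurable]: "J \<in> borel_measurable M"
        unfolding J_def using ile[of n] elim k by (intro measurable_dyadic_sig_M) auto
      have eq: "i * 2 ^ (n - m') = i' * 2 ^ (n - k)"
        using elim k(3) by (simp add: i'_def flip: power_add)
      have "real (2 ^ (n - k)) / 2 ^ n = 1 / 2 ^ k"
        using dyadic_refine[OF elim(3), of 1] by simp
      moreover have "i' * 2 ^ (n - k) \<le> 2 ^ n" using ile[of n] elim k unfolding eq[symmetric] by auto
      ultimately have J2: "integrable M (\<lambda>\<omega>. (J \<omega> - S \<omega>) ^ 2)" "expectation (\<lambda>\<omega>. (J \<omega> - S \<omega>) ^ 2) \<le> exp (c * (1 / 2 ^ k)) - 1"
        using c[of i' "2 ^ (n - k)" n] by (simp_all add: J_def S_def eq)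
      have "prob {\<omega> \<in> space M. \<eta>' \<le> \<bar>J \<omega> - S \<omega>\<bar>} \<le> expectation (\<lambda>\<omega>. (J \<omega> - S \<omega>) ^ 2) / \<eta>'\<^sup>2"
        using J2 \<eta>' by (intro second_moment_method) auto
      also have "\<dots> \<le> (exp (c * (1 / 2 ^ k)) - 1) / \<eta>'\<^sup>2"
        using J2 by (intro divide_right_mono) auto
      also have "\<dots> < \<eta>'" by (rule k)
      finally have P3: "prob {\<omega> \<in> space M. \<eta>' \<le> \<bar>J \<omega> - S \<omega>\<bar>} < \<eta>'" .
      have "prob {\<omega> \<in> space M. 2 * \<eta>' < \<bar>S \<omega> - I (w @ [a]) t \<omega>\<bar>} \<le>
        prob {\<omega> \<in> space M. \<eta>' < \<bar>S \<omega> - T \<omega>\<bar>} + prob {\<omega> \<in> space M. \<eta>' < \<bar>T \<omega> - I (w @ [a]) t \<omega>\<bar>}"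
        by (rule prob_mono_union) (measurable, linarith)
      moreover have "prob {\<omega> \<in> space M. \<eta> < \<bar>J \<omega> - I (w @ [a]) t \<omega>\<bar>} \<le>
        prob {\<omega> \<in> space M. \<eta>' \<le> \<bar>J \<omega> - S \<omega>\<bar>} + prob {\<omega> \<in> space M. 2 * \<eta>' < \<bar>S \<omega> - I (w @ [a]) t \<omega>\<bar>}"
      proof (rule prob_mono_union)
        show "\<eta>' \<le> \<bar>J \<omega> - S \<omega>\<bar> \<or> 2 * \<eta>' < \<bar>S \<omega> - I (w @ [a]) t \<omega>\<bar>"
          if "\<eta> < \<bar>J \<omega> - I (w @ [a]) t \<omega>\<bar>" for \<omega>
          using that \<eta>3 by linarith
      qed measurable
      ultimately have "prob {\<omega> \<in> space M. \<eta> < \<bar>J \<omega> - I (w @ [a]) t \<omega>\<bar>} < \<eta>"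
        using P1 P3 elim(2) \<eta>3 unfolding S_def by linarith
      then show ?case by (simp add: J_def)
    qed
  qed measurable
qed

section \<open>Shuffle identity and expectations in the limit\<close>

lemma signature_limit:
  assumes I: "stratonovich_iterated_integrals M X I"
  obtains r where "strict_mono r"
    "AE \<omega> in M. \<forall>w\<in>{w. length w \<le> L}. (\<lambda>n. dyadic_sig X (r n) 0 (2 ^ r n) \<omega> w) \<longlonglongrightarrow> I w 1 \<omega>"
proof -
  have conv: "conv_prob (\<lambda>n \<omega>. dyadic_sig X n 0 (2 ^ n) \<omega> w) (I w 1)" for w
    using dyadic_sig_converges[OF I, of 1 0 w] by simp
  have fin: "finite {w :: 'd list. length w \<le> L}"
    using finite_lists_length_le[of "UNIV :: 'd set" L] by simp
  show ?thesis
    using conv_prob_AE_subseq[OF fin, of "\<lambda>w n \<omega>. dyadic_sig X n 0 (2 ^ n) \<omega> w" "\<lambda>w. I w 1"] conv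
      measurable_dyadic_sig_M[of 0 "2 ^ _"] that by auto
qed

lemma measurable_iterated_integral:
  assumes "stratonovich_iterated_integrals M X I"
  shows "I w 1 \<in> borel_measurable M"
  using dyadic_sig_converges[OF assms, of 1 0 w] by (auto dest: conv_probD(1))

lemma shuffle_char_signature:
  assumes I: "stratonovich_iterated_integrals M X I"
  shows "AE \<omega> in M. shuffle_char L (signature I \<omega>)"
proof -
  obtain r where "strict_mono r" "AE \<omega> in M. \<forall>w\<in>{w. length w \<le> L}. (\<lambda>n. dyadic_sig X (r n) 0 (2 ^ r n) \<omega> w) \<longlonglongrightarrow> I w 1 \<omega>"
    by (rule signature_limit[OF I])
  from this(2) show ?thesis
  proof eventually_elim
    case (elim \<omega>)
    let ?J = "\<lambda>n. dyadic_sig X (r n) 0 (2 ^ r n) \<omega>"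
    have lim: "(\<lambda>n. ?J n w) \<longlonglongrightarrow> signature I \<omega> w" if "length w \<le> L" for w
      using elim that by (simp add: signature_def)
    show ?case
      unfolding shuffle_char_def
    proof (intro conjI allI impI)
      show "signature I \<omega> [] = 1"
        using LIMSEQ_unique[OF lim[of "[]"], of 1] by simp
      fix u v :: "'d list" assume uv: "length u + length v \<le> L"
      have "(\<lambda>n. shs (?J n) u v) \<longlonglongrightarrow> shs (signature I \<omega>) u v"
      proof -
        define c where "c w = shs (\<lambda>x. if x = w then 1 else 0) u v" for w
        have e: "shs g u v = (\<Sum>w | length w = length u + length v. c w * g w)" for g
          unfolding c_def by (rule shs_expand) simp
        show ?thesis unfolding e using uv by (intro tendsto_intros lim) auto
      qed
      moreover have "(\<lambda>n. shs (?J n) u v) = (\<lambda>n. ?J n u * ?J n v)"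
        by (intro ext shuffle_charD(2)[OF shuffle_char_dyadic_sig uv])
      moreover have "(\<lambda>n. ?J n u * ?J n v) \<longlonglongrightarrow> signature I \<omega> u * signature I \<omega> v"
        using uv by (intro tendsto_mult lim) auto
      ultimately show "shs (signature I \<omega>) u v = signature I \<omega> u * signature I \<omega> v"
        by (simp only: LIMSEQ_unique)
    qed
  qed
qed

lemma iterated_integral_limit:
  assumes I: "stratonovich_iterated_integrals M X I"
  obtains r where "strict_mono r"
    "\<And>w. length w \<le> L \<Longrightarrow> integrable M (I w 1) \<and>
       (\<lambda>n. spow (step_mean (r n)) (2 ^ r n) w) \<longlonglongrightarrow> expectation (I w 1)"
proof -
  obtain r where r: "strict_mono r"
    "AE \<omega> in M. \<forall>w\<in>{w. length w \<le> L}. (\<lambda>n. dyadic_sig X (r n) 0 (2 ^ r n) \<omega> w) \<longlonglongrightarrow> I w 1 \<omega>"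
    by (rule signature_limit[OF I])
  have "integrable M (I w 1) \<and> (\<lambda>n. spow (step_mean (r n)) (2 ^ r n) w) \<longlonglongrightarrow> expectation (I w 1)" if w: "length w \<le> L" for w
  proof -
    obtain C where C: "\<And>n j k. j + k \<le> 2 ^ n \<Longrightarrow>
       integrable M (\<lambda>\<omega>. dyadic_sig X n j k \<omega> w * dyadic_sig X n j k \<omega> w) \<and>
       \<bar>expectation (\<lambda>\<omega>. dyadic_sig X n j k \<omega> w * dyadic_sig X n j k \<omega> w)\<bar> \<le> C"
      using dyadic_sig_second_moment[of w w] by blast
    let ?Y = "\<lambda>n \<omega>. dyadic_sig X (r n) 0 (2 ^ r n) \<omega> w"
    have E: "expectation (?Y n) = spow (step_mean (r n)) (2 ^ r n) w" for n
      using dyadic_sig_moment[of 0 "2 ^ r n" "r n" w] by simp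
    have lim: "AE \<omega> in M. (\<lambda>n. ?Y n \<omega>) \<longlonglongrightarrow> I w 1 \<omega>"
      using r(2) by eventually_elim (use w in auto)
    have sq: "integrable M (\<lambda>\<omega>. (?Y n \<omega>) ^ 2)" "expectation (\<lambda>\<omega>. (?Y n \<omega>) ^ 2) \<le> C" for n
      using C[of 0 "2 ^ r n" "r n"] by (auto simp: power2_eq_square)
    have meas: "?Y n \<in> borel_measurable M" for n
      by (rule measurable_dyadic_sig_M) simp
    show ?thesis
      using expectation_limit_of_L2_bounded[OF meas measurable_iterated_integral[OF I] sq lim] E by simp
  qed
  with r(1) that show ?thesis by blast
qed

lemma expected_log_signature:
  assumes I: "stratonovich_iterated_integrals M X I"
  shows "integrable M (\<lambda>\<omega>. series_log (signature I \<omega>) w)"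
    and "expectation (\<lambda>\<omega>. series_log (signature I \<omega>) w) = 0"
proof -
  obtain c where c: "\<And>g. shuffle_char (length w) g \<Longrightarrow> series_log g w = (\<Sum>v | length v = length w. c v * g v)"
    using linear_on_chars_log[of w] unfolding linear_on_chars_def by blast
  \<comment> \<open>The linear form giving the logarithm takes opposite values at the interpolated
    signature and at its inverse, yet has the same expectation at both.\<close>
  have zero: "(\<Sum>v | length v = length w. c v * spow (step_mean n) (2 ^ n) v) = 0" for n
  proof -
    let ?J = "\<lambda>\<omega>. dyadic_sig X n 0 (2 ^ n) \<omega>" and ?G = "\<lambda>\<omega>. dyadic_sig_inv X n (2 ^ n) \<omega>"
    have G1: "?G \<omega> [] = 1" for \<omega>
      using shuffle_char_dyadic_sig_inv[of 0 X n "2 ^ n" \<omega>] by (simp add: shuffle_char_def)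
    have "series_log (?G \<omega>) w = - series_log (?J \<omega>) w" for \<omega>
      by (intro series_log_inverse dyadic_sig_inverse dyadic_sig_Nil G1)
    then have "(\<Sum>v | length v = length w. c v * ?G \<omega> v) = - (\<Sum>v | length v = length w. c v * ?J \<omega> v)" for \<omega>
      by (simp add: c shuffle_char_dyadic_sig shuffle_char_dyadic_sig_inv)
    then have "expectation (\<lambda>\<omega>. \<Sum>v | length v = length w. c v * ?G \<omega> v) = - expectation (\<lambda>\<omega>. \<Sum>v | length v = length w. c v * ?J \<omega> v)"
      by simp
    moreover have "expectation (\<lambda>\<omega>. \<Sum>v | length v = length w. c v * ?G \<omega> v) = (\<Sum>v | length v = length w. c v * spow (step_mean n) (2 ^ n) v)"
      using dyadic_sig_inv_moment[of "2 ^ n" n] by (subst Bochner_Integration.integral_sum) auto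
    moreover have "expectation (\<lambda>\<omega>. \<Sum>v | length v = length w. c v * ?J \<omega> v) = (\<Sum>v | length v = length w. c v * spow (step_mean n) (2 ^ n) v)"
      using dyadic_sig_moment[of 0 "2 ^ n" n] by (subst Bochner_Integration.integral_sum) auto
    ultimately show ?thesis by simp
  qed
  obtain r where "strict_mono r" and r: "\<And>v. length v \<le> length w \<Longrightarrow> integrable M (I v 1) \<and>
       (\<lambda>n. spow (step_mean (r n)) (2 ^ r n) v) \<longlonglongrightarrow> expectation (I v 1)"
    by (rule iterated_integral_limit[OF I, where L = "length w"]) (rule that, assumption, simp)
  have "(\<lambda>n. \<Sum>v | length v = length w. c v * spow (step_mean (r n)) (2 ^ r n) v) \<longlonglongrightarrow> (\<Sum>v | length v = length w. c v * expectation (I v 1))"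
    using r by (intro tendsto_intros) auto
  then have E0: "(\<Sum>v | length v = length w. c v * expectation (I v 1)) = 0"
    unfolding zero using LIMSEQ_unique tendsto_const by blast
  have AE: "AE \<omega> in M. series_log (signature I \<omega>) w = (\<Sum>v | length v = length w. c v * I v 1 \<omega>)"
    using shuffle_char_signature[OF I, of "length w"] by eventually_elim (simp add: c signature_def)
  have int: "integrable M (\<lambda>\<omega>. \<Sum>v | length v = length w. c v * I v 1 \<omega>)"
    using r by (intro Bochner_Integration.integrable_sum integrable_mult_right) auto
  have [measurable]: "(\<lambda>\<omega>. signature I \<omega> u) \<in> borel_measurable M" for u
    using measurable_iterated_integral[OF I, of u] by (simp add: signature_def)
  have pow: "(\<lambda>\<omega>. spow (\<lambda>u. signature I \<omega> u - sone u) k v) \<in> borel_measurable M" for k v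
    by (induction k arbitrary: v) (simp_all add: concat_prod_def)
  then have meas: "(\<lambda>\<omega>. series_log (signature I \<omega>) w) \<in> borel_measurable M"
    unfolding series_log_def by (intro borel_measurable_sum borel_measurable_times borel_measurable_const)
  show "integrable M (\<lambda>\<omega>. series_log (signature I \<omega>) w)"
    using integrable_cong_AE[THEN iffD2, OF meas _ AE int] int by (auto intro: borel_measurable_integrable)
  have "expectation (\<lambda>\<omega>. series_log (signature I \<omega>) w) = expectation (\<lambda>\<omega>. \<Sum>v | length v = length w. c v * I v 1 \<omega>)"
    using meas AE int by (intro integral_cong_AE) (auto intro: borel_measurable_integrable)
  also have "\<dots> = 0"
    using r E0 by (subst Bochner_Integration.integral_sum) auto
  finally show "expectation (\<lambda>\<omega>. series_log (signature I \<omega>) w) = 0" .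
qed

end

subsection \<open>Brownian motion and the barycenter\<close>

lemma brownian_increments_linear_image:
  fixes B :: "real \<Rightarrow> 'w \<Rightarrow> real ^ 'd :: finite"
  assumes B: "standard_brownian_motion M B"
  shows "brownian_increments M (\<lambda>t \<omega>. R *v B t \<omega>) (gaussian_moment R)"
proof -
  interpret prob_space M
    using B by (simp add: standard_brownian_motion_def)
  let ?X = "\<lambda>t \<omega>. R *v B t \<omega>"
  have incr: "incr ?X n k = (\<lambda>\<omega>. R *v (B (real (Suc k) / 2 ^ n) \<omega> - B (real k / 2 ^ n) \<omega>))" for n k
    by (simp add: incr_def fun_eq_iff matrix_vector_mult_diff_distrib)
  have dist: "distributed M lborel (\<lambda>\<omega>. B t \<omega> - B s \<omega>) (\<lambda>x. ennreal (\<Prod>i\<in>UNIV. normal_density 0 (sqrt (t - s)) (x $ i)))"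
    if "0 \<le> s" "s < t" "t \<le> 1" for s t
    using B that by (simp add: standard_brownian_motion_def)
  have mom: "integrable M (\<lambda>\<omega>. word_monomial (incr ?X n k \<omega>) w) \<and>
      expectation (\<lambda>\<omega>. word_monomial (incr ?X n k \<omega>) w) = sqrt (1 / 2 ^ n) ^ length w * gaussian_moment R w"
    if "k < 2 ^ n" for n k w
  proof -
    have "Suc k \<le> 2 ^ n" using that by simp
    from of_nat_mono[OF this, where 'a = real] have "real (Suc k) / 2 ^ n \<le> 1" by simp
    moreover have "real k / 2 ^ n < real (Suc k) / 2 ^ n" by (intro divide_strict_right_mono) auto
    moreover have "real (Suc k) / 2 ^ n - real k / 2 ^ n = 1 / 2 ^ n" by (simp flip: diff_divide_distrib)
    ultimately have "distributed M lborel (\<lambda>\<omega>. B (real (Suc k) / 2 ^ n) \<omega> - B (real k / 2 ^ n) \<omega>)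
        (\<lambda>x. ennreal (\<Prod>i\<in>UNIV. normal_density 0 (sqrt (1 / 2 ^ n)) (x $ i)))"
      using dist[of "real k / 2 ^ n" "real (Suc k) / 2 ^ n"] by simp
    from gaussian_increment_moment[OF this, of R w] show ?thesis
      by (simp add: incr)
  qed
  show ?thesis
  proof unfold_locales
    fix n
    define p where "p i = real i / 2 ^ n" for i
    have "is_partition 0 1 (2 ^ n) p"
      by (simp add: is_partition_def p_def divide_strict_right_mono)
    then have "indep_vars (\<lambda>_. borel) (\<lambda>i \<omega>. B (p (Suc i)) \<omega> - B (p i) \<omega>) {..<2 ^ n}"
      using B by (auto simp: standard_brownian_motion_def)
    from indep_vars_compose2[OF this, of "\<lambda>_ x. R *v x" "\<lambda>_. borel"]
    show "indep_vars (\<lambda>_. borel) (incr ?X n) {..<2 ^ n}"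
      by (simp add: incr[abs_def] p_def)
  next
    \<comment> \<open>The moment of the empty word is the total mass of the Gaussian density, read
      off here from the total mass of \<open>M\<close>.\<close>
    have "expectation (\<lambda>\<omega>. word_monomial (incr ?X 0 0 \<omega>) []) = gaussian_moment R []"
      using mom[of 0 0 "[]"] by simp
    then show "gaussian_moment R [] = 1"
      by (simp add: word_monomial_def prob_space)
  next
    fix a b
    show "gaussian_moment R [a, b] = gaussian_moment R [b, a]"
      by (simp add: gaussian_moment_def word_monomial_def mult.commute)
  qed (use mom in \<open>auto simp: gaussian_moment_odd\<close>)
qed

section \<open>Borel measurability on the space of series\<close>

lemma borel_measurable_tensor_log:
  "(\<lambda>x :: 'd :: countable series. tensor_log L (trunc L x) w) \<in> borel_measurable borel"
proof -
  have coord: "(\<lambda>x :: 'd series. trunc L x u - sone u) \<in> borel_measurable borel" for u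
    by (cases "length u \<le> L") (simp_all add: trunc_def)
  have pow: "(\<lambda>x :: 'd series. spow (\<lambda>u. trunc L x u - sone u) k v) \<in> borel_measurable borel" for k v
    by (induction k arbitrary: v)
       (auto simp: concat_prod_def intro!: borel_measurable_sum borel_measurable_times coord)
  have "(\<lambda>x :: 'd series. trunc L (spow (\<lambda>u. trunc L x u - sone u) k) w) \<in> borel_measurable borel" for k
    using pow by (cases "length w \<le> L") (simp_all add: trunc_def)
  then show ?thesis
    unfolding tensor_log_def tensor_alg_simps tensor_alg_pow
    by (intro borel_measurable_suminf borel_measurable_times borel_measurable_const)
qed

text \<open>Transferring an almost sure property to the image law asks for a measurable set.
  Truncated characters form one, cut out by countably many equations that each involve finitely many
  coefficients, and they lie in the group.\<close>

lemma sets_shuffle_char: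
  "{x :: 'd :: finite series. shuffle_char L x \<and> (\<forall>w. L < length w \<longrightarrow> x w = 0)} \<in> sets borel"
proof -
  have shs: "(\<lambda>x :: 'd series. shs x u v) \<in> borel_measurable borel" for u v
  proof -
    define c where "c w = shs (\<lambda>x. if x = w then 1 else 0) u v" for w
    have "shs x u v = (\<Sum>w | length w = length u + length v. c w * x w)" for x
      unfolding c_def by (rule shs_expand) simp
    then show ?thesis by simp
  qed
  have coord: "(\<lambda>x :: 'd series. x u) \<in> borel_measurable borel" for u
    by (rule measurable_product_coordinates)
  have eq: "Measurable.pred borel (\<lambda>x :: 'd series. c \<longrightarrow> f x = g x)"
    if "f \<in> borel_measurable borel" "g \<in> borel_measurable borel" for c and f g :: "'d series \<Rightarrow> real"
    using borel_measurable_eq[OF that] by (cases c) (simp_all add: pred_def)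
  have "Measurable.pred borel (\<lambda>x :: 'd series. (True \<longrightarrow> x [] = 1) \<and>
      (\<forall>u v. length u + length v \<le> L \<longrightarrow> shs x u v = x u * x v) \<and> (\<forall>w. L < length w \<longrightarrow> x w = 0))"
    by (intro pred_intros_logic(3) pred_intros_countable(1) eq shs coord borel_measurable_times borel_measurable_const)
  then show ?thesis
    by (simp only: pred_def space_borel UNIV_I simp_thms shuffle_char_def conj_assoc)
qed

theorem proposition53:
  fixes M :: "'w measure"
    and B :: "real \<Rightarrow> 'w \<Rightarrow> real ^ 'd"
    and C :: "real ^ 'd ^ 'd"
    and X :: "real \<Rightarrow> 'w \<Rightarrow> real ^ 'd"
    and I :: "'d list \<Rightarrow> real \<Rightarrow> 'w \<Rightarrow> real"
    and L :: nat
  assumes "positive_definite C"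
    and "standard_brownian_motion M B"
    and "X = (\<lambda>t \<omega>. matrix_sqrt C *v B t \<omega>)"
    and "stratonovich_iterated_integrals M X I"
  shows "(\<forall>w. integrable M (\<lambda>\<omega>. tensor_log L (trunc L (signature I \<omega>)) w) \<and>
              (\<integral>\<omega>. tensor_log L (trunc L (signature I \<omega>)) w \<partial>M) = 0) \<and>
         (\<forall>m. is_barycenter L (distr M borel (\<lambda>\<omega>. trunc L (signature I \<omega>))) m \<longleftrightarrow>
              m = \<one>\<^bsub>tensor_alg L\<^esub>)"
proof -
  interpret brownian_increments M X "gaussian_moment (matrix_sqrt C)"
    unfolding assms(3) by (rule brownian_increments_linear_image[OF assms(2)])
  note I = assms(4)
  let ?f = "\<lambda>\<omega>. trunc L (signature I \<omega>)"
  let ?D = "distr M borel ?f"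
  have S1: "signature I \<omega> [] = 1" if "\<omega> \<in> space M" for \<omega>
    using I that by (simp add: signature_def stratonovich_iterated_integrals_def)
  have log: "tensor_log L (?f \<omega>) w = (if length w \<le> L then series_log (signature I \<omega>) w else 0)"
    if "\<omega> \<in> space M" for \<omega> w
    by (rule tensor_log_trunc) (rule S1[OF that])
  have E0: "integrable M (\<lambda>\<omega>. tensor_log L (?f \<omega>) w)" "expectation (\<lambda>\<omega>. tensor_log L (?f \<omega>) w) = 0" for w
  proof -
    show "integrable M (\<lambda>\<omega>. tensor_log L (?f \<omega>) w)"
      using expected_log_signature(1)[OF I, of w]
      by (subst Bochner_Integration.integrable_cong[OF refl log]) (cases "length w \<le> L"; simp)+
    show "expectation (\<lambda>\<omega>. tensor_log L (?f \<omega>) w) = 0"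
      using expected_log_signature(2)[OF I, of w]
      by (subst Bochner_Integration.integral_cong[OF refl log]) (cases "length w \<le> L"; simp)+
  qed
  have f: "?f \<in> borel_measurable M"
  proof (rule measurable_coordinatewise_then_product)
    fix w show "(\<lambda>\<omega>. ?f \<omega> w) \<in> borel_measurable M"
      using measurable_iterated_integral[OF I, of w]
      by (cases "length w \<le> L") (simp_all add: trunc_def signature_def)
  qed
  have group: "AE x in ?D. x \<in> free_nilpotent_group L"
  proof -
    have "AE x in ?D. shuffle_char L x \<and> (\<forall>w. L < length w \<longrightarrow> x w = 0)"
    proof (subst AE_distr_iff[OF f])
      show "AE \<omega> in M. shuffle_char L (?f \<omega>) \<and> (\<forall>w. L < length w \<longrightarrow> ?f \<omega> w = 0)"
        using shuffle_char_signature[OF I, of L]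
        by eventually_elim (simp add: shuffle_char_trunc, simp add: trunc_def)
    qed (use sets_shuffle_char in simp)
    then show ?thesis
    proof eventually_elim
      case (elim x)
      then have "trunc L x = x" by (auto simp: trunc_def)
      with shuffle_char_in_group[of L x] elim show ?case by simp
    qed
  qed
  have one: "is_barycenter L ?D \<one>\<^bsub>tensor_alg L\<^esub>"
    unfolding is_barycenter_def monoid.inv_one[OF tensor_alg_monoid]
  proof (intro conjI allI group)
    show "prob_space ?D" by (rule prob_space_distr[OF f])
    show "(\<one>\<^bsub>tensor_alg L\<^esub> :: 'd series) \<in> free_nilpotent_group L"
    proof -
      have "trunc L (sone :: 'd series) \<in> free_nilpotent_group L"
        by (rule shuffle_char_in_group[OF shuffle_char_sone])
      then show ?thesis by (simp add: tensor_alg_simps)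
    qed
    fix w
    show "integrable ?D (\<lambda>x. tensor_log L (\<one>\<^bsub>tensor_alg L\<^esub> \<otimes>\<^bsub>tensor_alg L\<^esub> x) w)"
      "(\<integral>x. tensor_log L (\<one>\<^bsub>tensor_alg L\<^esub> \<otimes>\<^bsub>tensor_alg L\<^esub> x) w \<partial>?D) = 0"
      using E0[of w] borel_measurable_tensor_log[of L w]
      by (simp_all add: tensor_alg_simps integrable_distr_eq[OF f] integral_distr[OF f])
  qed simp
  have unique: "m = \<one>\<^bsub>tensor_alg L\<^esub>" if bary: "is_barycenter L ?D m" for m
  proof -
    have "m \<in> free_nilpotent_group L" using bary by (simp add: is_barycenter_def)
    note m = free_nilpotent_groupD[OF this]
    define m' where "m' = inv\<^bsub>tensor_alg L\<^esub> m"
    have inv: "trunc L (m' \<odot> m) = sone" unfolding m'_def by (rule tensor_alg_inv[OF m])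
    have m'1: "m' [] = 1"
      using fun_cong[OF inv, of "[]"] m(2) by (simp add: trunc_def)
    \<comment> \<open>Degree by degree: if \<open>m\<close> agrees with the unit in all lower
      degrees, the mean of log(m^-1 x) at \<open>w\<close> is the mean of log x minus
      \<open>m w\<close>, hence - \<open>m w\<close>, and the barycenter equation makes it vanish.
      The empty word and words longer than \<open>L\<close> are settled by membership in the
      group.\<close>
    have "m w = sone w" for w
    proof (induction "length w" arbitrary: w rule: less_induct)
      case less
      show ?case
      proof (cases "w = [] \<or> L < length w")
        case True
        then show ?thesis using m by (auto simp: tensor_alg_def sone_def)
      next
        case False
        let ?g = "\<lambda>x. tensor_log L (trunc L (m' \<odot> x)) w"
        have "integrable ?D ?g" "integral\<^sup>L ?D ?g = 0"
          using bary by (simp_all add: is_barycenter_def m'_def tensor_alg_simps)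
        then have "0 = expectation (\<lambda>\<omega>. ?g (?f \<omega>))"
          using integral_distr[OF f, of ?g] borel_measurable_integrable[of ?D ?g] by simp
        also have "\<dots> = expectation (\<lambda>\<omega>. series_log (signature I \<omega>) w - m w)"
        proof (rule Bochner_Integration.integral_cong[OF refl])
          fix \<omega> assume "\<omega> \<in> space M"
          note S = S1[OF this]
          have "?g (?f \<omega>) = series_log (m' \<odot> signature I \<omega>) w"
            using False m'1 S by (simp add: tensor_log_trunc)
          also have "\<dots> = series_log (signature I \<omega>) w - m w"
            using False less m(2) S by (intro series_log_inv_shift[OF inv]) auto
          finally show "?g (?f \<omega>) = series_log (signature I \<omega>) w - m w" .
        qed
        also have "\<dots> = - m w"
          using expected_log_signature[OF I, of w] by (simp add: prob_space)
        finally show ?thesis using False by simp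
      qed
    qed
    then show ?thesis by (auto simp: tensor_alg_simps)
  qed
  show ?thesis using E0 one unique by blast
qed

end
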